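(* Work in the infinite-width neural tangent kernel regime described in the context, and fix a level $n\in\{1,\ldots,N\}$. Assume: (A1) For any parameter $\Theta$ and any admissible input $\mathbf g$ (in particular the inputs $\mathbf x_{n,[i]}$), $\mathcal N_\Theta(\mathbf g)\in L^2(\mathbb R^2;\mathbb R)$ and has compact support contained in $\Omega$. (A2) For each $i\in\{1,\ldots,M\}$ and each level $n$, $|\widehat{f_{[i]}}|^2\not\equiv 0$ on $S_n$. (A3) For each $n\in\{1,\ldots,N\}$ there is an integer $\tau_n\ge 1$ such that the family $\{|\widehat{f_{[i]}}(\boldsymbol\nu)|^{2\tau_n}\}_{i=1}^M$ is linearly independent on $S_n$, i.e. if $c_i\in\mathbb C$ and $\sum_{i=1}^M c_i|\widehat{f_{[i]}}(\boldsymbol\nu)|^{2\tau_n}=0$ for all $\boldsymbol\nu\in S_n$, then $c_1=\cdots=c_M=0$. Let $\Theta(t)$ evolve under the gradient flow $\frac{d\Theta(t)}{dt}=-\nabla_\Theta\mathcal T^{(n)}(\Theta(t))$. If $\Theta(t)$ converges to $\Theta_n$ as $t\to\infty$ and $\nabla_\Theta\mathcal T^{(n)}(\Theta_n)=\mathbf 0$, then, writing $\mathcal N_{n,[i]}=\mathcal N_{\Theta_n}(\mathbf x_{n,[i]})$, for $i=1,\ldots,M$, $$\widehat{\mathcal N_{n,[i]}}(\boldsymbol\xi)=\widehat{f_{[i]}}(\boldsymbol\xi)\qquad\forall\,\boldsymbol\xi\in B_{n,[i]},$$ where $$B_{n,[i]}=\bigcup_{\substack{\boldsymbol\alpha\in\mathbb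 Z_{\ge0}^3\\ \gamma(\boldsymbol\alpha)\in\mathbb Z_{\ge0}}}\Big\{\boldsymbol\xi\in\mathbb R^2:\ \boldsymbol\xi=\sum_{p=1}^{\gamma(\boldsymbol\alpha)}\boldsymbol\nu^{(p)}+\sum_{p=1}^{\widetilde\gamma(\boldsymbol\alpha)}\boldsymbol w^{(p)},\ \ \boldsymbol\nu^{(p)}\in S_{n,[i]},\ \boldsymbol w^{(p)}\in\widetilde S_{n-1,[i]}\Big\},$$ with, for $\boldsymbol\alpha=(\alpha^{(1)},\alpha^{(2)},\alpha^{(3)})$, $\gamma(\boldsymbol\alpha)=2\alpha^{(1)}+\alpha^{(2)}-2\tau_n$ and $\widetilde\gamma(\boldsymbol\alpha)=\alpha^{(2)}+2\alpha^{(3)}$. Here $\mathbb Z_{\ge0}=\{0,1,2,\ldots\}$ and an empty sum is zero.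
   Context: **Domain, data, Fourier transform.** $\Omega=\{\mathbf r\in\mathbb R^2:|\mathbf r|<R\}$. There are $M$ training samples $f^\dagger_{[i]}\in L^2(\mathbb R^2;\mathbb R)$, $i=1,\ldots,M$, compactly supported in $\Omega$. For $h\in L^2(\mathbb R^2;\mathbb R)$ (compactly supported where needed), $\hat h(\boldsymbol\nu)=\int_{\mathbb R^2}h(\mathbf r)e^{\mathrm i2\pi\boldsymbol\nu\cdot\mathbf r}\,\mathrm d\mathbf r$; write $\widehat{f_{[i]}}$ for the transform of $f^\dagger_{[i]}$. **Frequency sets.** Let $0<\nu_1<\cdots<\nu_N$ and let $N_\theta\ge1$ be an integer. Set $S_n=\{\boldsymbol\nu\in\mathbb R^2:\|\boldsymbol\nu\|=\nu_n,\ \arg(\boldsymbol\nu)\in\{j\pi/N_\theta\}_{j=0}^{2N_\theta-1}\}$ (with $\arg\in[0,2\pi)$) and $\mathcal S=\bigcup_{n=1}^N S_n$. It is assumed that $|S_n|\ge M$. Put $S_{n,[i]}=\{\boldsymbol\nu\in S_n:\widehat{f_{[i]}}(\boldsymbol\nu)\ne0\}$ and $\widetilde S_{n-1,[i]}=\{\boldsymbol\nu\in\mathcal S:\widehat{\mathcal N_{n-1,[i]}}(\boldsymbol\nu)\neq0\}$, with $\mathcal N_{n-1,[i]}$ defined below. Choose $\eta_1<\cdots<\eta_{N+1}$ with $\eta_1>0$ and $\eta_n\le\nu_n<\eta_{n+1}$. For $1\le k\le N$, $1\le m\le N_\theta$ let $V_{k,m}=\{\boldsymbol\nu:\eta_k\le\|\boldsymbol\nu\|<\eta_{k+1},\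 (m-1)\pi/N_\theta\le\arg(\boldsymbol\nu)<m\pi/N_\theta\}$ and $V_{-k,m}=-V_{k,m}$; let $\mathcal I=\{(k,m)\in\mathbb Z^2:1\le|k|\le N,\ 1\le m\le N_\theta\}$. **Features and inputs.** $\tilde f_{n,[i]}(\mathbf r)=\sum_{\boldsymbol\nu\in S_n}\widehat{f_{[i]}}(\boldsymbol\nu)e^{-\mathrm i2\pi\boldsymbol\nu\cdot\mathbf r}$. The level-$n$ input is $\mathbf x_{n,[i]}=(\mathcal N_{n-1,[i]},\tilde f_{n,[i]})$, where $\mathcal N_{0,[i]}=0$ and, for $n\ge2$, $\mathcal N_{n-1,[i]}=\mathcal N_{\Theta_{n-1}}(\mathbf x_{n-1,[i]})$ is the output of the already trained (and now fixed) level-$(n-1)$ network. **Network.** With width $L$ and $\sigma(u)=\max\{0,u\}$, for an input $\mathbf x=(g,\tilde f)$, $$\mathcal N_\Theta(\mathbf x)(\mathbf r)=\frac1{\sqrt L}\sum_{l=1}^L w_l\,\sigma\Big(\frac1{\sqrt L}\sum_{j=1}^L\big((W^{(1)}_{lj}*g)(\mathbf r)+(W^{(2)}_{lj}*\tilde f)(\mathbf r)\big)\Big),$$ with parameters $\Theta=\{w_l,W^{(1)}_{lj},W^{(2)}_{lj}\}$. At initialization the $w_l$ are i.i.d. real standard normal, and $W^{(1)}_{lj}$, $W^{(2)}_{lj}$ are independent realizations of the real-valued random fields $$\mathcal W^{(1)}(\mathbf r)=C\sum_{\boldsymbol\nu\in\mathcal S}Z^{(1)}_{\boldsymbol\nu}e^{-\mathrm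 i2\pi\boldsymbol\nu\cdot\mathbf r},\qquad \mathcal W^{(2)}(\mathbf r)=C\sum_{(k,m)\in\mathcal I}Z^{(2)}_{k,m}\int_{V_{k,m}}e^{-\mathrm i2\pi\boldsymbol\nu\cdot\mathbf r}\,\mathrm d\boldsymbol\nu,$$ where $C>0$ is a fixed constant and the $Z$'s are standard complex normal ($\mathbb E|Z|^2=1$, $\mathbb E Z^2=0$), independent except for the constraints $Z^{(1)}_{-\boldsymbol\nu}=\overline{Z^{(1)}_{\boldsymbol\nu}}$, $Z^{(2)}_{-k,m}=\overline{Z^{(2)}_{k,m}}$. Convolution of $W^{(2)}_{lj}$ with a plane wave is understood through Fourier inversion: $W^{(2)}*e^{-\mathrm i2\pi\boldsymbol\nu'\cdot(\cdot)}(\mathbf r)=C\sum_{(k,m)}Z^{(2)}_{k,m}\mathbf 1_{V_{k,m}}(\boldsymbol\nu')e^{-\mathrm i2\pi\boldsymbol\nu'\cdot\mathbf r}$. **Loss and NTK regime.** With $E^{(n)}_{\Theta,[i]}=\mathcal N_\Theta(\mathbf x_{n,[i]})-f^\dagger_{[i]}$, the loss is $\mathcal T^{(n)}(\Theta)=\frac1M\sum_{i=1}^M\int_\Omega|E^{(n)}_{\Theta,[i]}(\mathbf r)|^2\,\mathrm d\mathbf r$. The limiting neural tangent kernel $\mathcal K_n(\mathbf x,\mathbf x';\mathbf r,\mathbf r')$ is the deterministic limit as $L\to\infty$ of $\langle\nabla_\Theta\mathcal N_\Theta(\mathbf x)(\mathbf r),\nabla_\Theta\mathcal N_\Theta(\mathbf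 x')(\mathbf r')\rangle$ at the random initialization, where gradients are taken in the $w_l$ and in the real standard Gaussian coordinates ($\sqrt2\,\mathrm{Re}\,Z$, $\sqrt2\,\mathrm{Im}\,Z$, one pair for each conjugate pair of coefficients) of the kernels $W^{(1)}_{lj},W^{(2)}_{lj}$. The theorem is stated in the infinite-width regime, in which this kernel stays constant during training; that is, it is a standing assumption that along the gradient flow (and at its limit point) $$-\|\nabla_\Theta\mathcal T^{(n)}(\Theta(t))\|^2=\frac{\mathrm d}{\mathrm dt}\mathcal T^{(n)}(\Theta(t))=-\frac4{M^2}\sum_{i,i'=1}^M\int_\Omega\int_\Omega E^{(n)}_{\Theta(t),[i]}(\mathbf r)\,\mathcal K_n(\mathbf x_{n,[i]},\mathbf x_{n,[i']};\mathbf r,\mathbf r')\,E^{(n)}_{\Theta(t),[i']}(\mathbf r')\,\mathrm d\mathbf r'\,\mathrm d\mathbf r .$$ *)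

theory Defs
  imports "HOL-Analysis.Analysis" "HOL-Probability.Probability"
begin

type_synonym plane = "real^2"

section \<open>Plane waves and the Fourier transform\<close>

definition wave :: "plane \<Rightarrow> plane \<Rightarrow> complex" where
  "wave \<nu> r = exp (- \<i> * complex_of_real (2 * pi * (\<nu> \<bullet> r)))"

definition fourier :: "(plane \<Rightarrow> real) \<Rightarrow> plane \<Rightarrow> complex" where
  "fourier h \<nu> =
     (LINT r|lborel. complex_of_real (h r) * exp (\<i> * complex_of_real (2 * pi * (\<nu> \<bullet> r))))"

definition arg2 :: "plane \<Rightarrow> real" where
  "arg2 \<nu> = Arg2pi (Complex (\<nu> $ 1) (\<nu> $ 2))"

definition sq_integrable :: "(plane \<Rightarrow> real) \<Rightarrow> bool" where
  "sq_integrable h \<longleftrightarrow> h \<in> borel_measurable lborel \<and> integrable lborel (\<lambda>r. (h r)\<^sup>2)"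

definition supported_in :: "plane set \<Rightarrow> (plane \<Rightarrow> real) \<Rightarrow> bool" where
  "supported_in A h \<longleftrightarrow> (AE r in lborel. r \<notin> A \<longrightarrow> h r = 0)"

definition compactly_supported_in :: "plane set \<Rightarrow> (plane \<Rightarrow> real) \<Rightarrow> bool" where
  "compactly_supported_in A h \<longleftrightarrow> (\<exists>K. compact K \<and> K \<subseteq> A \<and> supported_in K h)"

section \<open>Data and frequency sets\<close>

text \<open>
  \<open>freq\<close> is the sequence \<open>\<nu>\<close> of radii, \<open>band\<close> the sequence \<open>\<eta>\<close> of cell boundaries and \<open>amp\<close> the
  constant \<open>C\<close> in the random fields. Samples and levels are numbered from 1.
\<close>

record setup_data =
  radius :: real
  nsamples :: nat
  sample :: "nat \<Rightarrow> plane \<Rightarrow> real"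
  nlevels :: nat
  nangles :: nat
  freq :: "nat \<Rightarrow> real"
  band :: "nat \<Rightarrow> real"
  amp :: real

definition Omega :: "setup_data \<Rightarrow> plane set" where
  "Omega D = {r. norm r < radius D}"

definition S_level :: "setup_data \<Rightarrow> nat \<Rightarrow> plane set" where
  "S_level D n = {\<nu>. norm \<nu> = freq D n \<and>
     arg2 \<nu> \<in> {real j * pi / real (nangles D) | j. j < 2 * nangles D}}"

definition S_all :: "setup_data \<Rightarrow> plane set" where
  "S_all D = (\<Union>n\<in>{1..nlevels D}. S_level D n)"

definition cell_pos :: "setup_data \<Rightarrow> int \<Rightarrow> int \<Rightarrow> plane set" where
  "cell_pos D k m = {\<nu>. band D (nat k) \<le> norm \<nu> \<and> norm \<nu> < band D (nat k + 1) \<and>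
     of_int (m - 1) * pi / real (nangles D) \<le> arg2 \<nu> \<and> arg2 \<nu> < of_int m * pi / real (nangles D)}"

definition cell :: "setup_data \<Rightarrow> int \<times> int \<Rightarrow> plane set" where
  "cell D = (\<lambda>(k, m). if 0 < k then cell_pos D k m else uminus ` cell_pos D (- k) m)"

definition cell_indices :: "setup_data \<Rightarrow> (int \<times> int) set" where
  "cell_indices D = {(k, m). 1 \<le> \<bar>k\<bar> \<and> \<bar>k\<bar> \<le> int (nlevels D) \<and> 1 \<le> m \<and> m \<le> int (nangles D)}"

definition valid_setup :: "setup_data \<Rightarrow> bool" where
  "valid_setup D \<longleftrightarrow>
     0 < radius D \<and> 1 \<le> nsamples D \<and> 1 \<le> nlevels D \<and> 1 \<le> nangles D \<and> 0 < amp D \<and>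
     0 < freq D 1 \<and> strict_mono_on {1..nlevels D} (freq D) \<and>
     0 < band D 1 \<and> strict_mono_on {1..nlevels D + 1} (band D) \<and>
     (\<forall>n\<in>{1..nlevels D}. band D n \<le> freq D n \<and> freq D n < band D (n + 1)) \<and>
     (\<forall>n\<in>{1..nlevels D}. nsamples D \<le> card (S_level D n)) \<and>
     (\<forall>i\<in>{1..nsamples D}. sq_integrable (sample D i) \<and>
        compactly_supported_in (Omega D) (sample D i))"

section \<open>Parameters in real Gaussian coordinates\<close>

text \<open>
  A parameter vector is given by its real coordinates: the outer weight of each neuron, and for each
  conjugate pair of coefficients of each inner kernel the two numbers \<open>\<surd>2 Re Z\<close> and \<open>\<surd>2 Im Z\<close>. The
  pair \<open>{\<nu>, -\<nu>}\<close> is represented by the frequency with argument in \<open>[0, \<pi>)\<close> and the pair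
  \<open>{(k, m), (-k, m)}\<close> by the index with positive first entry. The finite set \<open>coords\<close> lists the
  coordinates of a network of width \<open>L\<close>; values outside it are irrelevant.
\<close>

datatype part = RePart | ImPart

datatype coord =
    Outer nat
  | Inner1 nat nat plane part
  | Inner2 nat nat "int \<times> int" part

type_synonym params = "coord \<Rightarrow> real"

definition coords :: "setup_data \<Rightarrow> nat \<Rightarrow> coord set" where
  "coords D L =
     {Outer l | l. l < L} \<union>
     {Inner1 l j \<nu> p | l j \<nu> p. l < L \<and> j < L \<and> \<nu> \<in> S_all D \<and> arg2 \<nu> < pi} \<union>
     {Inner2 l j km p | l j km p. l < L \<and> j < L \<and> km \<in> cell_indices D \<and> 0 < fst km}"

definition Z1 :: "params \<Rightarrow> nat \<Rightarrow> nat \<Rightarrow> plane \<Rightarrow> complex" where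
  "Z1 \<Theta> l j \<nu> =
     (let z = (\<lambda>\<mu>. Complex (\<Theta> (Inner1 l j \<mu> RePart)) (\<Theta> (Inner1 l j \<mu> ImPart))
                      / complex_of_real (sqrt 2))
      in if arg2 \<nu> < pi then z \<nu> else cnj (z (- \<nu>)))"

definition Z2 :: "params \<Rightarrow> nat \<Rightarrow> nat \<Rightarrow> int \<times> int \<Rightarrow> complex" where
  "Z2 \<Theta> l j = (\<lambda>(k, m).
     let z = (\<lambda>km. Complex (\<Theta> (Inner2 l j km RePart)) (\<Theta> (Inner2 l j km ImPart))
                     / complex_of_real (sqrt 2))
     in if 0 < k then z (k, m) else cnj (z (- k, m)))"

text \<open>Independent standard complex normal \<open>Z\<close>, up to conjugation symmetry, and standard normal
  outer weights: all coordinates are i.i.d. standard normal.\<close>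

definition init_law :: "setup_data \<Rightarrow> nat \<Rightarrow> params measure" where
  "init_law D L = (\<Pi>\<^sub>M c\<in>coords D L. density lborel (\<lambda>x. ennreal (std_normal_density x)))"

section \<open>The network\<close>

text \<open>An input is a pair \<open>(g, h)\<close> of real functions; \<open>h\<close> is a trigonometric polynomial.\<close>

type_synonym input = "(plane \<Rightarrow> real) \<times> (plane \<Rightarrow> real)"

text \<open>The sum defining the field is real because of the conjugation symmetry; \<open>Re\<close> only changes
  the type.\<close>

definition kernel1 :: "setup_data \<Rightarrow> params \<Rightarrow> nat \<Rightarrow> nat \<Rightarrow> plane \<Rightarrow> real" where
  "kernel1 D \<Theta> l j r = Re (complex_of_real (amp D) * (\<Sum>\<nu>\<in>S_all D. Z1 \<Theta> l j \<nu> * wave \<nu> r))"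

definition conv1 :: "setup_data \<Rightarrow> params \<Rightarrow> nat \<Rightarrow> nat \<Rightarrow> (plane \<Rightarrow> real) \<Rightarrow> plane \<Rightarrow> real" where
  "conv1 D \<Theta> l j g r = (LINT s|lborel. kernel1 D \<Theta> l j (r - s) * g s)"

text \<open>
  The second kernel is \<open>C \<Sum> Z2 (k, m) \<integral>\<^bsub>V(k, m)\<^esub> wave \<nu> r d\<nu>\<close>, i.e. the inverse transform of
  \<open>C \<Sum> Z2 (k, m) 1\<^bsub>V(k, m)\<^esub>\<close>. It is only ever convolved with trigonometric polynomials, and this
  convolution is defined by Fourier inversion: a plane wave is multiplied by the value of the
  transform at its frequency, and the rule is extended linearly.
\<close>

definition conv2_wave :: "setup_data \<Rightarrow> params \<Rightarrow> nat \<Rightarrow> nat \<Rightarrow> plane \<Rightarrow> plane \<Rightarrow> complex" where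
  "conv2_wave D \<Theta> l j \<nu> r = complex_of_real (amp D) *
     (\<Sum>km\<in>cell_indices D. Z2 \<Theta> l j km * indicator (cell D km) \<nu> * wave \<nu> r)"

text \<open>The coefficients of a trigonometric polynomial, unique because distinct plane waves are
  linearly independent.\<close>

definition wave_coeff :: "(plane \<Rightarrow> real) \<Rightarrow> plane \<Rightarrow> complex" where
  "wave_coeff h = (THE a. finite {\<nu>. a \<nu> \<noteq> 0} \<and>
     (\<forall>r. complex_of_real (h r) = (\<Sum>\<nu> | a \<nu> \<noteq> 0. a \<nu> * wave \<nu> r)))"

definition conv2 :: "setup_data \<Rightarrow> params \<Rightarrow> nat \<Rightarrow> nat \<Rightarrow> (plane \<Rightarrow> real) \<Rightarrow> plane \<Rightarrow> real" where
  "conv2 D \<Theta> l j h r =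
     Re (\<Sum>\<nu> | wave_coeff h \<nu> \<noteq> 0. wave_coeff h \<nu> * conv2_wave D \<Theta> l j \<nu> r)"

definition network :: "setup_data \<Rightarrow> nat \<Rightarrow> params \<Rightarrow> input \<Rightarrow> plane \<Rightarrow> real" where
  "network D L \<Theta> x r = 1 / sqrt (real L) *
     (\<Sum>l<L. \<Theta> (Outer l) *
        max 0 (1 / sqrt (real L) *
          (\<Sum>j<L. conv1 D \<Theta> l j (fst x) r + conv2 D \<Theta> l j (snd x) r)))"

definition admissible_input :: "setup_data \<Rightarrow> input \<Rightarrow> bool" where
  "admissible_input D x \<longleftrightarrow>
     sq_integrable (fst x) \<and> supported_in (Omega D) (fst x) \<and>
     (\<exists>a. \<forall>r. complex_of_real (snd x r) = (\<Sum>\<nu>\<in>S_all D. a \<nu> * wave \<nu> r))"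

text \<open>
  The network formula is a nonlinear function of trigonometric polynomials, so taken on the whole
  plane it is almost periodic in \<open>r\<close> and is never a nonzero function of compact support. What enters
  the loss and the kernel are the values on \<open>Omega\<close> only. A realization \<open>\<N>\<close> of the network is
  therefore any output map that agrees with the formula on \<open>Omega\<close>: the formula itself is one, its
  extension by zero from \<open>Omega\<close> is another. The support hypothesis on the outputs is imposed
  separately on \<open>\<N>\<close>.
\<close>

definition realizes_network ::
    "setup_data \<Rightarrow> nat \<Rightarrow> (params \<Rightarrow> input \<Rightarrow> plane \<Rightarrow> real) \<Rightarrow> bool" where
  "realizes_network D L \<N> \<longleftrightarrow> (\<forall>\<Theta> x. \<forall>r\<in>Omega D. \<N> \<Theta> x r = network D L \<Theta> x r)"

section \<open>Level inputs, loss\<close>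

definition feature :: "setup_data \<Rightarrow> nat \<Rightarrow> nat \<Rightarrow> plane \<Rightarrow> real" where
  "feature D n i r = Re (\<Sum>\<nu>\<in>S_level D n. fourier (sample D i) \<nu> * wave \<nu> r)"

text \<open>\<open>\<Theta>s n\<close> are the trained parameters of level \<open>n\<close>.\<close>

primrec level_output :: "setup_data \<Rightarrow> (params \<Rightarrow> input \<Rightarrow> plane \<Rightarrow> real) \<Rightarrow> (nat \<Rightarrow> params) \<Rightarrow>
    nat \<Rightarrow> nat \<Rightarrow> plane \<Rightarrow> real" where
  "level_output D \<N> \<Theta>s 0 i = (\<lambda>r. 0)"
| "level_output D \<N> \<Theta>s (Suc n) i = \<N> (\<Theta>s (Suc n)) (level_output D \<N> \<Theta>s n i, feature D (Suc n) i)"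

definition level_input :: "setup_data \<Rightarrow> (params \<Rightarrow> input \<Rightarrow> plane \<Rightarrow> real) \<Rightarrow> (nat \<Rightarrow> params) \<Rightarrow>
    nat \<Rightarrow> nat \<Rightarrow> input" where
  "level_input D \<N> \<Theta>s n i = (level_output D \<N> \<Theta>s (n - 1) i, feature D n i)"

definition err :: "setup_data \<Rightarrow> (params \<Rightarrow> input \<Rightarrow> plane \<Rightarrow> real) \<Rightarrow> (nat \<Rightarrow> params) \<Rightarrow>
    nat \<Rightarrow> params \<Rightarrow> nat \<Rightarrow> plane \<Rightarrow> real" where
  "err D \<N> \<Theta>s n \<Theta> i r = \<N> \<Theta> (level_input D \<N> \<Theta>s n i) r - sample D i r"

definition loss :: "setup_data \<Rightarrow> (params \<Rightarrow> input \<Rightarrow> plane \<Rightarrow> real) \<Rightarrow> (nat \<Rightarrow> params) \<Rightarrow>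
    nat \<Rightarrow> params \<Rightarrow> real" where
  "loss D \<N> \<Theta>s n \<Theta> = 1 / real (nsamples D) *
     (\<Sum>i = 1..nsamples D. LINT r:Omega D|lborel. \<bar>err D \<N> \<Theta>s n \<Theta> i r\<bar>\<^sup>2)"

section \<open>Gradients, gradient flow\<close>

text \<open>Frechet differentiability in the finitely many coordinates \<open>P\<close>, for the Euclidean norm.\<close>

definition has_gradient :: "coord set \<Rightarrow> (params \<Rightarrow> real) \<Rightarrow> params \<Rightarrow> params \<Rightarrow> bool" where
  "has_gradient P F \<Theta> G \<longleftrightarrow>
     (\<forall>\<epsilon>>0. \<exists>\<delta>>0. \<forall>\<Theta>'. (\<forall>c. c \<notin> P \<longrightarrow> \<Theta>' c = \<Theta> c) \<and> L2_set (\<lambda>c. \<Theta>' c - \<Theta> c) P < \<delta> \<longrightarrow>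
        \<bar>F \<Theta>' - F \<Theta> - (\<Sum>c\<in>P. G c * (\<Theta>' c - \<Theta> c))\<bar> \<le> \<epsilon> * L2_set (\<lambda>c. \<Theta>' c - \<Theta> c) P)"

definition gradient :: "coord set \<Rightarrow> (params \<Rightarrow> real) \<Rightarrow> params \<Rightarrow> params" where
  "gradient P F \<Theta> = (THE G. has_gradient P F \<Theta> G \<and> (\<forall>c. c \<notin> P \<longrightarrow> G c = 0))"

definition gradient_flow :: "coord set \<Rightarrow> (params \<Rightarrow> real) \<Rightarrow> (real \<Rightarrow> params) \<Rightarrow> bool" where
  "gradient_flow P F \<theta> \<longleftrightarrow>
     (\<forall>t\<ge>0. has_gradient P F (\<theta> t) (gradient P F (\<theta> t)) \<and>
        (\<forall>c\<in>P. ((\<lambda>s. \<theta> s c) has_real_derivative - gradient P F (\<theta> t) c) (at t within {0..})))"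

section \<open>The limiting neural tangent kernel\<close>

definition empirical_ntk ::
    "setup_data \<Rightarrow> nat \<Rightarrow> input \<Rightarrow> input \<Rightarrow> plane \<Rightarrow> plane \<Rightarrow> params \<Rightarrow> real" where
  "empirical_ntk D L x x' r r' \<Theta> =
     (\<Sum>c\<in>coords D L. gradient (coords D L) (\<lambda>\<Theta>'. network D L \<Theta>' x r) \<Theta> c *
                     gradient (coords D L) (\<lambda>\<Theta>'. network D L \<Theta>' x' r') \<Theta> c)"

text \<open>
  Convergence in probability to a constant. The deviation event is required to be contained in an
  event of small probability, because the measure of a nonmeasurable set is 0 by convention and the
  gradients above are unspecified on the null set where some pre-activation vanishes.
\<close>

definition tendsto_in_prob :: "(nat \<Rightarrow> 'a measure) \<Rightarrow> (nat \<Rightarrow> 'a \<Rightarrow> real) \<Rightarrow> real \<Rightarrow> bool" where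
  "tendsto_in_prob P X k \<longleftrightarrow>
     (\<forall>\<epsilon>>0. \<forall>\<delta>>0. \<forall>\<^sub>F L in sequentially.
        \<exists>A\<in>sets (P L). {\<omega>\<in>space (P L). \<epsilon> < \<bar>X L \<omega> - k\<bar>} \<subseteq> A \<and> measure (P L) A < \<delta>)"

definition limit_ntk :: "setup_data \<Rightarrow> input \<Rightarrow> input \<Rightarrow> plane \<Rightarrow> plane \<Rightarrow> real" where
  "limit_ntk D x x' r r' =
     (THE k. tendsto_in_prob (init_law D) (\<lambda>L. empirical_ntk D L x x' r r') k)"

definition ntk_form :: "setup_data \<Rightarrow> (params \<Rightarrow> input \<Rightarrow> plane \<Rightarrow> real) \<Rightarrow> (nat \<Rightarrow> params) \<Rightarrow>
    nat \<Rightarrow> params \<Rightarrow> real" where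
  "ntk_form D \<N> \<Theta>s n \<Theta> =
     (\<Sum>i = 1..nsamples D. \<Sum>i' = 1..nsamples D.
        LINT r:Omega D|lborel. LINT r':Omega D|lborel.
          err D \<N> \<Theta>s n \<Theta> i r *
          limit_ntk D (level_input D \<N> \<Theta>s n i) (level_input D \<N> \<Theta>s n i') r r' *
          err D \<N> \<Theta>s n \<Theta> i' r')"

text \<open>
  The infinite-width regime: along the flow \<open>\<theta>\<close> the loss dissipates as prescribed by the limiting
  kernel, and the same identity holds at the limit point \<open>\<Theta>s n\<close>.
\<close>

definition ntk_regime :: "setup_data \<Rightarrow> nat \<Rightarrow> (params \<Rightarrow> input \<Rightarrow> plane \<Rightarrow> real) \<Rightarrow>
    (nat \<Rightarrow> params) \<Rightarrow> nat \<Rightarrow> (real \<Rightarrow> params) \<Rightarrow> bool" where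
  "ntk_regime D L \<N> \<Theta>s n \<theta> \<longleftrightarrow>
     (let T = loss D \<N> \<Theta>s n;
          grad_sq = (\<lambda>\<Theta>. \<Sum>c\<in>coords D L. (gradient (coords D L) T \<Theta> c)\<^sup>2);
          rate = (\<lambda>\<Theta>. - (4 / (real (nsamples D))\<^sup>2) * ntk_form D \<N> \<Theta>s n \<Theta>)
      in (\<forall>t\<ge>0. - grad_sq (\<theta> t) = rate (\<theta> t) \<and>
             ((\<lambda>s. T (\<theta> s)) has_real_derivative rate (\<theta> t)) (at t within {0..})) \<and>
         - grad_sq (\<Theta>s n) = rate (\<Theta>s n))"

section \<open>The recovered frequencies\<close>

definition S_sample :: "setup_data \<Rightarrow> nat \<Rightarrow> nat \<Rightarrow> plane set" where
  "S_sample D n i = {\<nu> \<in> S_level D n. fourier (sample D i) \<nu> \<noteq> 0}"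

definition S_output :: "setup_data \<Rightarrow> (params \<Rightarrow> input \<Rightarrow> plane \<Rightarrow> real) \<Rightarrow> (nat \<Rightarrow> params) \<Rightarrow>
    nat \<Rightarrow> nat \<Rightarrow> plane set" where
  "S_output D \<N> \<Theta>s n i = {\<nu> \<in> S_all D. fourier (level_output D \<N> \<Theta>s n i) \<nu> \<noteq> 0}"

definition gam :: "nat \<Rightarrow> nat \<times> nat \<times> nat \<Rightarrow> int" where
  "gam \<tau> = (\<lambda>(\<alpha>1, \<alpha>2, \<alpha>3). 2 * int \<alpha>1 + int \<alpha>2 - 2 * int \<tau>)"

definition gam_tilde :: "nat \<times> nat \<times> nat \<Rightarrow> nat" where
  "gam_tilde = (\<lambda>(\<alpha>1, \<alpha>2, \<alpha>3). \<alpha>2 + 2 * \<alpha>3)"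

definition B_set :: "setup_data \<Rightarrow> (params \<Rightarrow> input \<Rightarrow> plane \<Rightarrow> real) \<Rightarrow> (nat \<Rightarrow> params) \<Rightarrow>
    nat \<Rightarrow> nat \<Rightarrow> nat \<Rightarrow> plane set" where
  "B_set D \<N> \<Theta>s \<tau> n i =
     (\<Union>\<alpha>\<in>{\<alpha>. 0 \<le> gam \<tau> \<alpha>}.
        {\<xi>. \<exists>\<nu> w. (\<forall>p\<in>{1..nat (gam \<tau> \<alpha>)}. \<nu> p \<in> S_sample D n i) \<and>
                  (\<forall>p\<in>{1..gam_tilde \<alpha>}. w p \<in> S_output D \<N> \<Theta>s (n - 1) i) \<and>
                  \<xi> = (\<Sum>p = 1..nat (gam \<tau> \<alpha>). \<nu> p) + (\<Sum>p = 1..gam_tilde \<alpha>. w p)})"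

end

theory Submission
  imports Defs
begin

text \<open>
  At a stationary point the kernel form of the errors \<open>e\<^sub>i\<close> vanishes. By the law of large numbers
  the limiting kernel is \<open>E[\<sigma>(u) \<sigma>(u')] + \<Sigma> E[\<sigma>'(u) \<sigma>'(u')]\<close>, where the pre-activation
  \<open>u = a\<^sub>i(r) \<bullet> z\<close> is linear in a standard Gaussian vector \<open>z\<close> and \<open>\<Sigma> = a\<^sub>i(r) \<bullet> a\<^sub>j(r')\<close>. Both
  summands are Gram kernels, so the form is the expectation of a sum of squares, one of which is the
  square of \<open>F(z) = \<Sum>\<^sub>i \<integral> e\<^sub>i(r) \<sigma>(a\<^sub>i(r) \<bullet> z) dr\<close>; as \<open>F\<close> is continuous, \<open>F = 0\<close> everywhere.

  The norm of \<open>a\<^sub>i(r)\<close> does not depend on \<open>r\<close>; write \<open>b\<^sub>i(r)\<close> for the normalized vector. Averaging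
  \<open>F(z + v)\<close> over \<open>z\<close> replaces the ramp by the entire function \<open>h(t) = E[\<sigma>(t + Z)]\<close>, and since
  \<open>h''\<close> is the Gaussian density, the Taylor coefficients of \<open>h\<close> of even order are nonzero. Hence every
  even power \<open>(b\<^sub>i(r) \<bullet> v)\<^sup>k\<close>, \<open>k \<ge> 2\<close>, is orthogonal to the (rescaled) errors. By polarization the
  same holds for products of an even number of the plane waves which, with their Fourier coefficients,
  make up \<open>a\<^sub>i(r)\<close>. Multiplying the plane waves that add up to \<open>\<xi>\<close> by \<open>\<tau>\<close> pairs of opposite waves of
  frequencies \<open>\<mu>\<close> and \<open>- \<mu>\<close> in \<open>S\<^sub>n\<close> produces the factors \<open>|f\<^sub>i(\<mu>)|\<^bsup>2\<tau>\<^esup>\<close> with \<open>f\<^sub>i\<close> the transform of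
  the \<open>i\<close>-th sample, whose linear independence separates the samples.
\<close>

text \<open>The ramp is not analytic at 0, so \<open>F = 0\<close> cannot be expanded directly; its
  Gaussian average can, and \<open>h\<close> is one and the same function for all samples and points
  because the vectors \<open>b\<close> have length 1. That the length of \<open>a\<close> is
  constant in \<open>r\<close> rests on the placement of the angles: each lies at the left end of
  its sector, so a coefficient of the second kernel acts on at most one plane wave of the feature,
  and the modulus of a plane wave is constant. (A2) makes this length positive, and positive
  homogeneity of the ramp moves it into the error. Odd powers from degree 3 on are lost, since the
  ramp is half of \<open>t + \<bar>t\<bar>\<close>. Hence the role of parity: gamma + 2 tau +
  gamma-tilde equals twice the sum of the entries of \<alpha>, the term - 2 tau in gamma leaving
  room for the tau opposite pairs. As the two waves of a pair cancel, their frequency can be varied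
  without moving the point at which the error is tested. No central limit theorem enters: a sum of
  \<open>L\<close> Gaussian coefficients divided by \<open>sqrt L\<close> has the same law for every
  \<open>L\<close>, so the neurons are exactly i.i.d. with a law independent of the width.\<close>

text \<open>Convergence everywhere allows termwise differentiation, and the derivative of the zero
  function is zero. As \<open>diffs\<close> lowers every index by one, induction brings coefficient
  \<open>k\<close> down to the constant term, which is read off at 0.\<close>

lemma powser_eq_0_imp_coeff_0:
  fixes c :: "nat \<Rightarrow> real"
  assumes "\<And>s. (\<lambda>k. c k * s ^ k) sums 0"
  shows "c k = 0"
  using assms
proof (induction k arbitrary: c)
  case 0
  from this[of 0] show ?case by simp
next
  case (Suc k)
  have sm: "summable (\<lambda>k. c k * s ^ k)" and z: "(\<Sum>k. c k * s ^ k) = 0" for s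
    using Suc.prems[of s] by (auto simp: sums_iff)
  have "(\<lambda>k. diffs c k * s ^ k) sums 0" for s
  proof -
    have "((\<lambda>x. \<Sum>n. c n * x ^ n) has_field_derivative (\<Sum>n. diffs c n * s ^ n)) (at s)"
      by (rule termdiffs_strong_converges_everywhere[OF sm])
    then have "((\<lambda>x. 0) has_field_derivative (\<Sum>n. diffs c n * s ^ n)) (at s)"
      by (simp add: z)
    then have "(\<Sum>n. diffs c n * s ^ n) = 0"
      using DERIV_unique DERIV_const by blast
    then show ?thesis
      using termdiff_converges_all[OF sm, of s] by (simp add: sums_iff)
  qed
  then have "diffs c k = 0" by (rule Suc.IH)
  then show ?case by (simp add: diffs_def)
qed

section \<open>Gaussian vectors\<close>

definition std_normal :: "real measure" where
  "std_normal = density lborel (\<lambda>x. ennreal (std_normal_density x))"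

lemma sets_std_normal [measurable_cong, simp]: "sets std_normal = sets borel"
  by (simp add: std_normal_def)

lemma space_std_normal [simp]: "space std_normal = UNIV"
  by (simp add: std_normal_def)

lemma prob_space_std_normal: "prob_space std_normal"
  unfolding std_normal_def by (rule prob_space_normal_density) simp

interpretation std_normal: prob_space std_normal
  by (rule prob_space_std_normal)

abbreviation gauss :: "'c set \<Rightarrow> ('c \<Rightarrow> real) measure" where
  "gauss C \<equiv> Pi\<^sub>M C (\<lambda>_. std_normal)"

lemma prob_space_gauss: "prob_space (gauss C)"
  by (intro prob_space_PiM prob_space_std_normal)

lemma integrable_std_normal_power: "integrable std_normal (\<lambda>x. x ^ k)"
  unfolding std_normal_def
  by (subst integrable_density) (auto simp: integrable_std_normal_moment)

lemma integrable_std_normal_abs_power: "integrable std_normal (\<lambda>x. \<bar>x\<bar> ^ k)"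
  unfolding std_normal_def
  by (subst integrable_density) (auto simp: integrable_std_normal_moment_abs)

lemma std_normal_second_moment: "(LINT x|std_normal. x\<^sup>2) = 1"
  using integral_std_normal_moment_even[of 1]
  by (simp add: std_normal_def integral_density)

lemma integrable_gauss_coord:
  assumes "c \<in> C" "integrable std_normal (f :: real \<Rightarrow> real)"
  shows "integrable (gauss C) (\<lambda>z. f (z c))"
proof -
  have "integrable (distr (gauss C) std_normal (\<lambda>z. z c)) f"
    using assms by (subst distr_PiM_component) (auto intro: prob_space_std_normal)
  then show ?thesis
    using assms by (subst (asm) integrable_distr_eq) auto
qed

text \<open>The joint law of the coordinates is the law of the identity map, that is the product
  measure itself, and a joint law that factorizes means independence. The empty index set is apart
  because the characterization by laws asks for a nonempty one.\<close>

lemma indep_vars_PiM_coordinates: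
  assumes M: "\<And>i. i \<in> I \<Longrightarrow> prob_space (M i)"
  shows "prob_space.indep_vars (Pi\<^sub>M I M) M (\<lambda>i \<omega>. \<omega> i) I"
proof -
  interpret prob_space "Pi\<^sub>M I M" by (intro prob_space_PiM M)
  show ?thesis
  proof (cases "I = {}")
    case True
    then show ?thesis unfolding indep_vars_def indep_sets_def by auto
  next
    case False
    have "distr (Pi\<^sub>M I M) (Pi\<^sub>M I M) (\<lambda>x. \<lambda>i\<in>I. x i) = distr (Pi\<^sub>M I M) (Pi\<^sub>M I M) (\<lambda>x. x)"
      by (intro distr_cong) (auto simp: space_PiM PiE_iff extensional_restrict)
    also have "\<dots> = (\<Pi>\<^sub>M i\<in>I. distr (Pi\<^sub>M I M) (M i) (\<lambda>\<omega>. \<omega> i))"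
      by (simp add: distr_PiM_component M cong: PiM_cong)
    finally show ?thesis
      using False by (subst indep_vars_iff_distr_eq_PiM') auto
  qed
qed

lemma distr_indep_normal_sum:
  assumes "prob_space P" and C: "finite C"
    and ind: "prob_space.indep_vars P (\<lambda>_. std_normal) X C"
    and law: "\<And>c. c \<in> C \<Longrightarrow> distr P std_normal (X c) = std_normal"
    and s: "0 < s" "(\<Sum>c\<in>C. (a c)\<^sup>2) = s\<^sup>2"
  shows "distr P borel (\<lambda>z. \<Sum>c\<in>C. a c * X c z) = density lborel (normal_density 0 s)"
proof -
  interpret prob_space P by fact
  \<comment> \<open>A term of weight 0 has no normal density; such terms are dropped first, which
    changes neither the sum nor its variance.\<close>
  define C' where "C' = {c\<in>C. a c \<noteq> 0}"
  have C': "finite C'" "C' \<subseteq> C" using C by (auto simp: C'_def)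
  have sum': "(\<Sum>c\<in>C'. (a c)\<^sup>2) = s\<^sup>2"
    unfolding s(2)[symmetric] using C by (intro sum.mono_neutral_left) (auto simp: C'_def)
  have ne: "C' \<noteq> {}" using sum' s(1) by auto
  have rv: "X c \<in> borel_measurable P" if "c \<in> C" for c
    using ind that by (auto simp: indep_vars_def measurable_cong_sets[OF refl sets_std_normal])
  have "distributed P lborel (\<lambda>z. \<Sum>c\<in>C'. a c * X c z)
          (normal_density (\<Sum>c\<in>C'. 0) (sqrt (\<Sum>c\<in>C'. \<bar>a c\<bar>\<^sup>2)))"
  proof (rule sum_indep_normal[OF C'(1) ne])
    have "indep_vars (\<lambda>_. std_normal) X C'"
      by (rule indep_vars_subset[OF ind C'(2)])
    then show "indep_vars (\<lambda>i. borel) (\<lambda>c z. a c * X c z) C'"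
      by (rule indep_vars_compose2) auto
    fix c assume c: "c \<in> C'"
    then show "0 < \<bar>a c\<bar>" by (auto simp: C'_def)
    have cC: "c \<in> C" using c C' by auto
    have "distr P lborel (X c) = distr P std_normal (X c)"
      by (rule distr_cong) auto
    then have "distributed P lborel (X c) (normal_density 0 1)"
      using law[OF cC] rv[OF cC] by (auto simp: distributed_def std_normal_def)
    from normal_density_affine[OF this, of "a c" 0] c
    show "distributed P lborel (\<lambda>z. a c * X c z) (normal_density 0 \<bar>a c\<bar>)"
      by (simp add: C'_def)
  qed
  moreover have "(\<lambda>z. \<Sum>c\<in>C'. a c * X c z) = (\<lambda>z. \<Sum>c\<in>C. a c * X c z)"
    using C by (intro ext sum.mono_neutral_left) (auto simp: C'_def)
  ultimately have "distr P lborel (\<lambda>z. \<Sum>c\<in>C. a c * X c z) = density lborel (normal_density 0 s)"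
    using sum' s(1) by (simp add: distributed_def)
  moreover have "distr P borel f = distr P lborel f" for f :: "_ \<Rightarrow> real"
    by (rule distr_cong) auto
  ultimately show ?thesis by simp
qed

lemma distr_gauss_linear_form:
  assumes C: "finite C" and s: "0 < s" "(\<Sum>c\<in>C. (a c)\<^sup>2) = s\<^sup>2"
  shows "distr (gauss C) borel (\<lambda>z. \<Sum>c\<in>C. a c * z c) = density lborel (normal_density 0 s)"
  by (rule distr_indep_normal_sum[OF prob_space_gauss C _ _ s])
    (auto intro!: indep_vars_PiM_coordinates distr_PiM_component prob_space_std_normal)

text \<open>A nonzero form has a density, hence gives no mass to the point 0. This keeps the ramp
  off its kink almost surely.\<close>

lemma AE_gauss_linear_form_neq_0:
  assumes C: "finite C" and a: "c0 \<in> C" "a c0 \<noteq> 0"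
  shows "AE z in gauss C. (\<Sum>c\<in>C. a c * z c) \<noteq> 0"
proof -
  define s where "s = sqrt (\<Sum>c\<in>C. (a c)\<^sup>2)"
  have "0 < (\<Sum>c\<in>C. (a c)\<^sup>2)" using C a by (intro sum_pos2[of C c0]) auto
  then have s: "0 < s" "(\<Sum>c\<in>C. (a c)\<^sup>2) = s\<^sup>2" by (auto simp: s_def)
  have "AE x in density lborel (normal_density 0 s). x \<noteq> 0"
    by (subst AE_density) (auto intro: AE_mp[OF AE_lborel_singleton[of 0]])
  then show ?thesis
    unfolding distr_gauss_linear_form[OF C s, symmetric]
    by (subst (asm) AE_distr_iff) auto
qed

section \<open>Gaussian smoothing of the ramp function\<close>

text \<open>The ramp is a second antiderivative of the point mass at 0, so its smoothing differs from an
  affine function by a second antiderivative of the Gaussian density.\<close>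

lemma std_normal_ramp_powser:
  obtains p :: "nat \<Rightarrow> real"
  where "\<And>k. even k \<Longrightarrow> 2 \<le> k \<Longrightarrow> p k \<noteq> 0"
    and "\<And>t. (\<lambda>k. p k * t ^ k) sums (LINT x|std_normal. max 0 (t + x))"
    and "\<And>t. summable (\<lambda>k. \<bar>p k\<bar> * \<bar>t\<bar> ^ k)"
proof -
  \<comment> \<open>\<open>d\<close> holds the Taylor coefficients of the Gaussian density.
    \<open>q\<close> integrates this series twice with both constants of integration 0, so that
    \<open>diffs (diffs q) = d\<close>.\<close>
  define d :: "nat \<Rightarrow> real" where
    "d k = (if even k then (- 1 / 2) ^ (k div 2) / fact (k div 2) / sqrt (2 * pi) else 0)" for k
  define q :: "nat \<Rightarrow> real" where
    "q k = (if k < 2 then 0 else d (k - 2) / (real k * real (k - 1)))" for k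
  have dsums: "(\<lambda>k. d k * t ^ k) sums std_normal_density t" for t
  proof -
    have "(\<lambda>m. (- t\<^sup>2 / 2) ^ m /\<^sub>R fact m) sums exp (- t\<^sup>2 / 2)" by (rule exp_converges)
    then have "(\<lambda>m. (1 / sqrt (2 * pi)) * ((- t\<^sup>2 / 2) ^ m /\<^sub>R fact m)) sums std_normal_density t"
      unfolding std_normal_density_def by (rule sums_mult)
    also have "(\<lambda>m. (1 / sqrt (2 * pi)) * ((- t\<^sup>2 / 2) ^ m /\<^sub>R fact m)) = (\<lambda>m. d (2 * m) * t ^ (2 * m))"
    proof
      fix m
      have "(- t\<^sup>2 / 2) ^ m = (- 1 / 2) ^ m * t ^ (2 * m)"
        by (simp add: power_mult flip: power_mult_distrib)
      then show "(1 / sqrt (2 * pi)) * ((- t\<^sup>2 / 2) ^ m /\<^sub>R fact m) = d (2 * m) * t ^ (2 * m)"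
        by (simp add: d_def field_simps)
    qed
    finally have "(\<lambda>m. d (2 * m) * t ^ (2 * m)) sums std_normal_density t" .
    then show ?thesis
      by (subst (asm) sums_mono_reindex[of "\<lambda>m. 2 * m" "\<lambda>k. d k * t ^ k"])
        (auto simp: strict_mono_def d_def)
  qed
  have dq: "diffs (diffs q) = d"
  proof
    fix k
    have "diffs (diffs q) k = (real (k + 1) * real (k + 2)) * q (k + 2)"
      by (simp add: diffs_def)
    also have "\<dots> = d k"
      by (simp add: q_def del: of_nat_add)
    finally show "diffs (diffs q) k = d k" .
  qed
  have d_le: "\<bar>q (k + 2)\<bar> \<le> \<bar>d k\<bar>" for k
  proof -
    have "1 * 1 \<le> real (k + 2) * real (k + 1)"
      by (intro mult_mono) auto
    then have "\<bar>d k\<bar> / (real (k + 2) * real (k + 1)) \<le> \<bar>d k\<bar> / 1"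
      by (intro divide_left_mono) simp_all
    moreover have "q (k + 2) = d k / (real (k + 2) * real (k + 1))"
      by (simp add: q_def)
    ultimately show ?thesis by (simp del: of_nat_add)
  qed
  have dabs: "summable (\<lambda>k. \<bar>d k\<bar> * \<bar>t\<bar> ^ k)" for t
  proof -
    have "summable (\<lambda>k. norm (d k * \<bar>t\<bar> ^ k))"
      by (rule powser_insidea[of d "\<bar>t\<bar> + 1"]) (use dsums sums_summable in auto)
    then show ?thesis by (simp add: abs_mult)
  qed
  have qabs: "summable (\<lambda>k. \<bar>q k\<bar> * \<bar>t\<bar> ^ k)" for t
  proof -
    have "summable (\<lambda>k. \<bar>q (k + 2)\<bar> * \<bar>t\<bar> ^ (k + 2))"
    proof (rule summable_comparison_test')
      show "summable (\<lambda>k. (\<bar>t\<bar> * \<bar>t\<bar>) * (\<bar>d k\<bar> * \<bar>t\<bar> ^ k))" by (intro summable_mult dabs)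
      show "norm (\<bar>q (k + 2)\<bar> * \<bar>t\<bar> ^ (k + 2)) \<le> (\<bar>t\<bar> * \<bar>t\<bar>) * (\<bar>d k\<bar> * \<bar>t\<bar> ^ k)" for k
        using mult_right_mono[OF d_le[of k], of "\<bar>t\<bar> ^ (k + 2)"]
        by (simp add: mult_ac del: abs_mult_self_eq)
    qed
    then show ?thesis by (rule iffD1[OF summable_iff_shift[of "\<lambda>k. \<bar>q k\<bar> * \<bar>t\<bar> ^ k" 2]])
  qed
  have qsm: "summable (\<lambda>k. q k * t ^ k)" for t
    by (rule summable_norm_cancel) (use qabs[of t] in \<open>simp add: abs_mult power_abs\<close>)
  define P where "P t = (\<Sum>k. q k * t ^ k)" for t
  define P' where "P' t = (\<Sum>k. diffs q k * t ^ k)" for t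
  have dP: "(P has_real_derivative P' t) (at t)" for t
    unfolding P_def P'_def by (rule termdiffs_strong_converges_everywhere[OF qsm])
  have dP': "(P' has_real_derivative std_normal_density t) (at t)" for t
    using termdiffs_strong_converges_everywhere[OF termdiff_converges_all[OF qsm], of t]
      dsums[of t] by (simp add: dq sums_iff P'_def[abs_def])
  have P0: "P 0 = 0" "P' 0 = 0" by (simp_all add: P_def P'_def q_def diffs_def)
  have q_odd: "q k = 0" if "odd k" for k using that by (auto simp: q_def d_def)
  have P_even: "P (- t) = P t" for t
    unfolding P_def by (rule suminf_cong) (metis q_odd power_minus_even mult_zero_left)
  define h where "h t = (LINT x|std_normal. max 0 (t + x))" for t
  have intx: "integrable std_normal (\<lambda>x. x)" using integrable_std_normal_power[of 1] by simp
  have int_max: "integrable std_normal (\<lambda>x. max 0 (t + x))" for t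
    by (rule integrable_max[OF _ Bochner_Integration.integrable_add[OF _ intx]]) simp_all
  have int_ind: "integrable std_normal (\<lambda>x. t * indicator {0<..} x)" for t :: real
    by (rule integrable_mult_right, rule integrable_real_indicator)
      (simp_all add: std_normal.emeasure_eq_measure)
  have h_eq: "h t = h 0 + t * measure std_normal {0<..} + P t" for t
  proof -
    \<comment> \<open>\<open>R\<close> is the increment of the ramp minus its first-order part in
      \<open>t\<close>. It vanishes off the interval between \<open>- t\<close> and 0 (up to null
      sets), where integration by parts turns its mean into \<open>P t\<close>.\<close>
    define R where "R x = max 0 (t + x) - max 0 x - t * indicator {0<..} x" for x
    have "(LINT x|std_normal. R x) = h t - h 0 - t * measure std_normal {0<..}"
      unfolding R_def h_def using int_max[of t] int_max[of 0] int_ind[of t]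
      by simp
    moreover have "(LINT x|std_normal. R x) = (LINT x|lborel. std_normal_density x * R x)"
      unfolding std_normal_def by (subst integral_density) (auto simp: R_def[abs_def])
    moreover have "(LINT x|lborel. std_normal_density x * R x) = P t"
    proof (cases "0 \<le> t")
      case True
      have "R x = (t + x) * indicator {-t..0} x" for x
        using True by (cases "x \<le> 0"; cases "- t \<le> x") (auto simp: R_def)
      then have "(LINT x|lborel. std_normal_density x * R x)
          = (LINT x|lborel. ((t + x) * std_normal_density x) * indicator {-t..0} x)"
        by (simp only: mult_ac)
      \<comment> \<open>Since the second derivative of \<open>P\<close> is the density,
        \<open>(t + x) * P' x - P x\<close> is an antiderivative of the integrand; the terms at 0
        vanish and evenness of \<open>P\<close> does the rest.\<close>
      also have "\<dots> = ((t + 0) * P' 0 - P 0) - ((t + - t) * P' (- t) - P (- t))"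
      proof (rule integral_FTC_Icc_real)
        show "((\<lambda>x. (t + x) * P' x - P x) has_real_derivative (t + x) * std_normal_density x) (at x)" for x
          by (auto intro!: derivative_eq_intros dP dP')
        show "isCont (\<lambda>x. (t + x) * std_normal_density x) x" for x
          unfolding std_normal_density_def by (intro continuous_intros) auto
      qed (use True in auto)
      finally show ?thesis by (simp add: P0 P_even)
    next
      case False
      have "(LINT x|lborel. std_normal_density x * R x)
          = (LINT x|lborel. ((- t - x) * std_normal_density x) * indicator {0..-t} x)"
      \<comment> \<open>At \<open>x = 0\<close> the two integrands differ, because the indicator
        \<open>{0<..}\<close> excludes 0 and the closed interval contains it; hence equality only
        almost everywhere.\<close>
      proof (intro integral_cong_AE)
        have "R x = (- t - x) * indicator {0..-t} x" if "x \<noteq> 0" for x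
          using False that by (cases "x \<le> 0"; cases "x \<le> - t") (auto simp: R_def)
        then have "std_normal_density x * R x
            = ((- t - x) * std_normal_density x) * indicator {0..-t} x" if "x \<noteq> 0" for x
          using that by (metis mult.assoc mult.commute)
        then show "AE x in lborel. std_normal_density x * R x
            = ((- t - x) * std_normal_density x) * indicator {0..-t} x"
          by (rule eventually_mono[OF AE_lborel_singleton])
      qed (auto simp: R_def[abs_def])
      also have "\<dots> = ((- t - - t) * P' (- t) + P (- t)) - ((- t - 0) * P' 0 + P 0)"
      proof (rule integral_FTC_Icc_real)
        show "((\<lambda>x. (- t - x) * P' x + P x) has_real_derivative (- t - x) * std_normal_density x) (at x)" for x
          by (auto intro!: derivative_eq_intros dP dP')
        show "isCont (\<lambda>x. (- t - x) * std_normal_density x) x" for x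
          unfolding std_normal_density_def by (intro continuous_intros) auto
      qed (use False in auto)
      finally show ?thesis by (simp add: P0 P_even)
    qed
    ultimately show ?thesis by simp
  qed
  define l where "l k = (if k = 0 then h 0 else if k = 1 then measure std_normal {0<..} else 0)" for k :: nat
  have l: "(\<lambda>k. l k * t ^ k) sums (h 0 + t * measure std_normal {0<..})" for t
  proof -
    have "(\<lambda>k. l k * t ^ k) sums (\<Sum>k\<in>{0, 1}. l k * t ^ k)"
      by (rule sums_finite) (auto simp: l_def)
    then show ?thesis by (simp add: l_def mult.commute)
  qed
  show thesis
  \<comment> \<open>The affine part \<open>l\<close> lives in degrees 0 and 1 and \<open>q\<close>
    in degrees from 2 on. In even degree \<open>k \<ge> 2\<close> the coefficient is therefore
    \<open>q k\<close>, and \<open>d\<close> vanishes at no even index.\<close>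
  proof (rule that[of "\<lambda>k. l k + q k"])
    show "l k + q k \<noteq> 0" if "even k" "2 \<le> k" for k
      using that by (auto simp: l_def q_def d_def)
    show "(\<lambda>k. (l k + q k) * t ^ k) sums (LINT x|std_normal. max 0 (t + x))" for t
      using sums_add[OF l[of t] summable_sums[OF qsm[of t]]] h_eq[of t]
      by (simp add: h_def P_def distrib_right)
    show "summable (\<lambda>k. \<bar>l k + q k\<bar> * \<bar>t\<bar> ^ k)" for t
    proof (rule summable_comparison_test')
      have "summable (\<lambda>k. \<bar>l k\<bar> * \<bar>t\<bar> ^ k)"
        by (rule summable_finite[of "{0, 1}"]) (auto simp: l_def)
      then show "summable (\<lambda>k. \<bar>l k\<bar> * \<bar>t\<bar> ^ k + \<bar>q k\<bar> * \<bar>t\<bar> ^ k)"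
        by (intro summable_add qabs)
      show "norm (\<bar>l k + q k\<bar> * \<bar>t\<bar> ^ k) \<le> \<bar>l k\<bar> * \<bar>t\<bar> ^ k + \<bar>q k\<bar> * \<bar>t\<bar> ^ k" for k
        using mult_right_mono[OF abs_triangle_ineq[of "l k" "q k"], of "\<bar>t\<bar> ^ k"]
        by (simp add: algebra_simps)
    qed
  qed
qed

section \<open>The ramp transform on the sphere\<close>

lemma emeasure_std_normal_Icc_pos:
  assumes "a < b"
  shows "emeasure std_normal {a..b} \<noteq> 0"
proof
  assume "emeasure std_normal {a..b} = 0"
  then have "AE x in lborel. ennreal (std_normal_density x) * indicator {a..b} x = 0"
    unfolding std_normal_def by (subst (asm) emeasure_density) (auto simp: nn_integral_0_iff_AE)
  then have "AE x in lborel. x \<notin> {a..b}"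
    by eventually_elim (auto simp: indicator_def std_normal_density_def split: if_splits)
  moreover have "{x \<in> space lborel. \<not> x \<notin> {a..b}} = {a..b}" by auto
  ultimately have "emeasure lborel {a..b} = 0"
    by (subst (asm) AE_iff_measurable[of "{a..b}"]) auto
  then show False using assms by simp
qed

text \<open>A nonzero value persists on a box around \<open>z\<close>, and a box has positive
  measure as a product of intervals. The Lipschitz bound sees the coordinates in \<open>C\<close>
  only, so \<open>z\<close> need not be extensional.\<close>

lemma AE_gauss_eq_0_imp_eq_0:
  assumes C: "finite C" and K: "0 \<le> K"
    and lip: "\<And>z z'. \<bar>f z - f z'\<bar> \<le> K * (\<Sum>c\<in>C. \<bar>z c - z' c\<bar>)"
    and ae: "AE z in gauss C. f z = (0 :: real)"
  shows "f z = 0"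
proof (rule ccontr)
  assume nz: "f z \<noteq> 0"
  \<comment> \<open>Chosen so that \<open>f\<close> varies by at most half of
    \<open>\<bar>f z\<bar>\<close> on the box; the added ones keep the denominator positive when
    \<open>K = 0\<close> or \<open>C\<close> is empty.\<close>
  define \<delta> where "\<delta> = \<bar>f z\<bar> / (2 * (K + 1) * (real (card C) + 1))"
  have \<delta>: "0 < \<delta>" using nz K by (auto simp: \<delta>_def)
  define B where "B = (\<Pi>\<^sub>E c\<in>C. {z c - \<delta>..z c + \<delta>})"
  have B: "B \<in> sets (gauss C)" unfolding B_def using C by (intro sets_PiM_I_finite) auto
  have "f y \<noteq> 0" if "y \<in> B" for y
  proof -
    have "\<bar>f z - f y\<bar> \<le> K * (\<Sum>c\<in>C. \<bar>z c - y c\<bar>)" by (rule lip)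
    also have "\<dots> \<le> K * (\<Sum>c\<in>C. \<delta>)"
      using that K by (intro mult_left_mono sum_mono) (auto simp: B_def PiE_iff abs_le_iff algebra_simps)
    also have "\<dots> \<le> (K + 1) * ((real (card C) + 1) * \<delta>)"
      using K \<delta> by (intro mult_mono) (auto simp: algebra_simps)
    also have "\<dots> = \<bar>f z\<bar> / 2"
    proof -
      have "x * (y * (w / (2 * x * y))) = w / 2" if "0 < x" "0 < y" for x y w :: real
        using that by (simp add: field_simps)
      from this[of "K + 1" "real (card C) + 1" "\<bar>f z\<bar>"] show ?thesis
        using K unfolding \<delta>_def by auto
    qed
    finally show ?thesis using nz by auto
  qed
  then have "AE y in gauss C. y \<notin> B" using ae by (auto elim!: eventually_mono)
  then have "emeasure (gauss C) B = 0"
    using B by (subst (asm) AE_iff_measurable[OF _ refl])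
      (auto dest: sets.sets_into_space simp: Int_absorb2 Int_def[symmetric] Collect_conj_eq)
  moreover have "emeasure (gauss C) B = (\<Prod>c\<in>C. emeasure std_normal {z c - \<delta>..z c + \<delta>})"
  proof -
    interpret finite_product_sigma_finite "\<lambda>_. std_normal" C
      using C by unfold_locales auto
    show ?thesis unfolding B_def by (rule measure_times) auto
  qed
  moreover have "(\<Prod>c\<in>C. emeasure std_normal {z c - \<delta>..z c + \<delta>}) \<noteq> 0"
    using emeasure_std_normal_Icc_pos \<delta> C by (simp add: prod_zero_iff)
  ultimately show False by simp
qed

lemma (in pair_sigma_finite) integrable_mult_prod:
  fixes f :: "_ \<Rightarrow> real"
  assumes f: "integrable M1 f" and g: "integrable M2 g"
  shows "integrable (M1 \<Otimes>\<^sub>M M2) (\<lambda>(x, y). f x * g y)"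
proof (rule Fubini_integrable)
  show "(\<lambda>(x, y). f x * g y) \<in> borel_measurable (M1 \<Otimes>\<^sub>M M2)"
    using f g by measurable
  have "integrable M1 (\<lambda>x. norm (f x) * (\<integral>y. norm (g y) \<partial>M2))"
    using f by (intro integrable_mult_left integrable_norm)
  then show "integrable M1 (\<lambda>x. \<integral>y. norm (case (x, y) of (x, y) \<Rightarrow> f x * g y) \<partial>M2)"
    by (simp add: abs_mult)
  show "AE x in M1. integrable M2 (\<lambda>y. case (x, y) of (x, y) \<Rightarrow> f x * g y)"
    using g by simp
qed

lemma abs_sum_mult_le:
  fixes a z :: "'c \<Rightarrow> real"
  assumes "\<And>c. c \<in> C \<Longrightarrow> \<bar>a c\<bar> \<le> B"
  shows "\<bar>\<Sum>c\<in>C. a c * z c\<bar> \<le> B * (\<Sum>c\<in>C. \<bar>z c\<bar>)"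
proof -
  have "\<bar>\<Sum>c\<in>C. a c * z c\<bar> \<le> (\<Sum>c\<in>C. B * \<bar>z c\<bar>)"
    by (intro order_trans[OF sum_abs] sum_mono) (auto simp: abs_mult intro: mult_right_mono assms)
  then show ?thesis by (simp add: sum_distrib_left)
qed

lemma abs_le_1_of_sum_squares:
  fixes a :: "'c \<Rightarrow> real"
  assumes "finite C" "(\<Sum>c\<in>C. (a c)\<^sup>2) = 1" "c \<in> C"
  shows "\<bar>a c\<bar> \<le> 1"
proof -
  have "(a c)\<^sup>2 \<le> (\<Sum>c\<in>C. (a c)\<^sup>2)" using assms by (intro member_le_sum) auto
  then show ?thesis using assms by (simp add: abs_square_le_1)
qed

lemma integrable_ramp_linear_form:
  assumes "integrable M (e :: 'a \<Rightarrow> real)" and C: "finite C"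
    and [measurable]: "\<And>c. c \<in> C \<Longrightarrow> (\<lambda>x. a x c) \<in> borel_measurable M"
    and bd: "\<And>x c. x \<in> space M \<Longrightarrow> c \<in> C \<Longrightarrow> \<bar>a x c\<bar> \<le> B"
  shows "integrable M (\<lambda>x. e x * max 0 (\<Sum>c\<in>C. a x c * z c))"
proof (rule Bochner_Integration.integrable_bound)
  show "integrable M (\<lambda>x. e x * (B * (\<Sum>c\<in>C. \<bar>z c\<bar>)))"
    using assms by (intro integrable_mult_left)
  have [measurable]: "e \<in> borel_measurable M" using assms by auto
  show "(\<lambda>x. e x * max 0 (\<Sum>c\<in>C. a x c * z c)) \<in> borel_measurable M" by measurable
  show "AE x in M. norm (e x * max 0 (\<Sum>c\<in>C. a x c * z c)) \<le> norm (e x * (B * (\<Sum>c\<in>C. \<bar>z c\<bar>)))"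
  proof (rule AE_I2)
    fix x assume "x \<in> space M"
    then have "\<bar>\<Sum>c\<in>C. a x c * z c\<bar> \<le> B * (\<Sum>c\<in>C. \<bar>z c\<bar>)"
      by (intro abs_sum_mult_le bd)
    then have "\<bar>max 0 (\<Sum>c\<in>C. a x c * z c)\<bar> \<le> \<bar>B * (\<Sum>c\<in>C. \<bar>z c\<bar>)\<bar>" by auto
    then show "norm (e x * max 0 (\<Sum>c\<in>C. a x c * z c)) \<le> norm (e x * (B * (\<Sum>c\<in>C. \<bar>z c\<bar>)))"
      by (simp add: abs_mult[of "e x"] mult_left_mono)
  qed
qed

text \<open>Shift \<open>z\<close> by \<open>s * v\<close> and average over \<open>z\<close>: the
  ramp becomes \<open>h (s * u x)\<close>. The scalar \<open>s\<close> reduces the matter to a power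
  series in one variable that vanishes identically; its coefficients are those of \<open>h\<close>
  times the wanted integrals.\<close>

lemma ramp_transform_eq_0_imp_even_power_eq_0:
  fixes b :: "'a \<Rightarrow> 'c \<Rightarrow> real"
  assumes "sigma_finite_measure M" and C: "finite C" and e: "integrable M (e :: 'a \<Rightarrow> real)"
    and b[measurable]: "\<And>c. c \<in> C \<Longrightarrow> (\<lambda>x. b x c) \<in> borel_measurable M"
    and unit: "\<And>x. x \<in> space M \<Longrightarrow> (\<Sum>c\<in>C. (b x c)\<^sup>2) = 1"
    and zero: "\<And>z. (LINT x|M. e x * max 0 (\<Sum>c\<in>C. b x c * z c)) = 0"
    and k: "even k" "2 \<le> k"
  shows "(LINT x|M. e x * (\<Sum>c\<in>C. b x c * v c) ^ k) = 0"
proof -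
  interpret M: sigma_finite_measure M by fact
  interpret G: prob_space "gauss C" by (rule prob_space_gauss)
  interpret MG: pair_sigma_finite M "gauss C" ..
  have [measurable]: "e \<in> borel_measurable M" using e by auto
  have b1: "\<bar>b x c\<bar> \<le> 1" if "x \<in> space M" "c \<in> C" for x c
    using abs_le_1_of_sum_squares[OF C unit] that by blast
  obtain p :: "nat \<Rightarrow> real" where p: "\<And>k. even k \<Longrightarrow> 2 \<le> k \<Longrightarrow> p k \<noteq> 0"
    "\<And>t. (\<lambda>k. p k * t ^ k) sums (LINT x|std_normal. max 0 (t + x))"
    "\<And>t. summable (\<lambda>k. \<bar>p k\<bar> * \<bar>t\<bar> ^ k)"
    using std_normal_ramp_powser by blast
  define h where "h t = (LINT x|std_normal. max 0 (t + x))" for t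
  define u where "u x = (\<Sum>c\<in>C. b x c * v c)" for x
  have [measurable]: "u \<in> borel_measurable M" unfolding u_def by measurable
  define V where "V = (\<Sum>c\<in>C. \<bar>v c\<bar>)"
  have uV: "\<bar>u x\<bar> \<le> V" if "x \<in> space M" for x
    using abs_sum_mult_le[of C "b x" 1 v] b1 that by (simp add: u_def V_def)
  have V0: "0 \<le> V" by (auto simp: V_def intro: sum_nonneg)
  \<comment> \<open>Unit length makes the form standard normal at every \<open>x\<close>, so the
    smoothed ramp is the same function \<open>h\<close> everywhere.\<close>
  have h_gauss: "h t = (LINT z|gauss C. max 0 (t + (\<Sum>c\<in>C. b x c * z c)))" if "x \<in> space M" for t x
  proof -
    have "h t = (LINT y|density lborel (normal_density 0 1). max 0 (t + y))"
      by (simp add: h_def std_normal_def)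
    also have "density lborel (normal_density 0 1) = distr (gauss C) borel (\<lambda>z. \<Sum>c\<in>C. b x c * z c)"
      using unit[OF that] by (intro distr_gauss_linear_form[OF C, symmetric]) auto
    also have "(LINT y|\<dots>. max 0 (t + y)) = (LINT z|gauss C. max 0 (t + (\<Sum>c\<in>C. b x c * z c)))"
      by (subst integral_distr) auto
    finally show ?thesis .
  qed
  have smoothed: "(LINT x|M. e x * h (s * u x)) = 0" for s
  proof -
    define \<Phi> where "\<Phi> x z = e x * max 0 (\<Sum>c\<in>C. b x c * (s * v c + z c))" for x z
    have shift: "(\<Sum>c\<in>C. b x c * (s * v c + z c)) = s * u x + (\<Sum>c\<in>C. b x c * z c)" for x z
      by (simp add: u_def sum_distrib_left distrib_left sum.distrib mult_ac)
    define g where "g z = (\<Sum>c\<in>C. \<bar>s * v c\<bar> + \<bar>z c\<bar>)" for z :: "'c \<Rightarrow> real"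
    have g: "integrable (gauss C) g"
      unfolding g_def using integrable_std_normal_abs_power[of 1]
      by (intro Bochner_Integration.integrable_sum Bochner_Integration.integrable_add
          integrable_gauss_coord[where f = abs]) auto
    have "integrable (M \<Otimes>\<^sub>M gauss C) (case_prod \<Phi>)"
    proof (rule Bochner_Integration.integrable_bound)
      show "integrable (M \<Otimes>\<^sub>M gauss C) (\<lambda>(x, z). e x * g z)"
        by (rule MG.integrable_mult_prod[OF e g])
      show "case_prod \<Phi> \<in> borel_measurable (M \<Otimes>\<^sub>M gauss C)"
        unfolding \<Phi>_def by measurable
      show "AE w in M \<Otimes>\<^sub>M gauss C. norm (case w of (x, z) \<Rightarrow> \<Phi> x z) \<le> norm (case w of (x, z) \<Rightarrow> e x * g z)"
      proof (rule AE_I2, clarsimp simp: space_pair_measure)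
        fix x z assume "x \<in> space M"
        then have "\<bar>\<Sum>c\<in>C. b x c * (s * v c + z c)\<bar> \<le> 1 * (\<Sum>c\<in>C. \<bar>s * v c + z c\<bar>)"
          by (intro abs_sum_mult_le b1)
        also have "\<dots> \<le> g z" unfolding g_def by (auto intro!: sum_mono)
        finally have "\<bar>max 0 (\<Sum>c\<in>C. b x c * (s * v c + z c))\<bar> \<le> \<bar>g z\<bar>" by auto
        then show "\<bar>\<Phi> x z\<bar> \<le> \<bar>e x * g z\<bar>"
          by (simp add: \<Phi>_def abs_mult mult_left_mono)
      qed
    qed
    then have "(LINT z|gauss C. LINT x|M. \<Phi> x z) = (LINT x|M. LINT z|gauss C. \<Phi> x z)"
      by (rule MG.Fubini_integral)
    moreover have "(LINT x|M. \<Phi> x z) = 0" for z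
      unfolding \<Phi>_def by (rule zero)
    moreover have "(LINT x|M. LINT z|gauss C. \<Phi> x z) = (LINT x|M. e x * h (s * u x))"
      by (intro Bochner_Integration.integral_cong)
        (simp_all add: \<Phi>_def shift h_gauss)
    ultimately show ?thesis by simp
  qed
  \<comment> \<open>The expansion of \<open>h\<close> may be integrated term by term:
    \<open>V\<close> bounds \<open>u\<close> uniformly, and the series of \<open>p\<close> converges
    absolutely at \<open>s * V\<close>.\<close>
  have "(\<lambda>j. (p j * (LINT x|M. e x * u x ^ j)) * s ^ j) sums 0" for s
  proof -
    define f where "f j x = e x * (p j * (s * u x) ^ j)" for j x
    have eu: "integrable M (\<lambda>x. e x * u x ^ j)" for j
    proof (rule Bochner_Integration.integrable_bound)
      show "integrable M (\<lambda>x. e x * V ^ j)" using e by simp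
      show "AE x in M. norm (e x * u x ^ j) \<le> norm (e x * V ^ j)"
        using uV V0 by (auto simp: abs_mult power_abs intro!: AE_I2 mult_left_mono power_mono)
    qed measurable
    have f_eq: "f j x = (p j * s ^ j) * (e x * u x ^ j)" for j x
      by (simp add: f_def power_mult_distrib mult_ac)
    have fi: "integrable M (f j)" for j
      unfolding f_eq[abs_def] using eu by simp
    have bd: "norm (f j x) \<le> \<bar>e x\<bar> * (\<bar>p j\<bar> * \<bar>s * V\<bar> ^ j)" if "x \<in> space M" for j x
      using uV[OF that] V0
      by (auto simp: f_def abs_mult power_abs intro!: mult_left_mono power_mono mult_mono)
    have "(\<lambda>j. integral\<^sup>L M (f j)) sums (LINT x|M. (\<Sum>j. f j x))"
    proof (rule sums_integral[OF fi])
      show "AE x in M. summable (\<lambda>j. norm (f j x))"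
        by (intro AE_I2 summable_comparison_test'[OF summable_mult[OF p(3)[of "s * V"]]])
          (use bd in auto)
      show "summable (\<lambda>j. LINT x|M. norm (f j x))"
      proof (rule summable_comparison_test')
        show "summable (\<lambda>j. (LINT x|M. \<bar>e x\<bar>) * (\<bar>p j\<bar> * \<bar>s * V\<bar> ^ j))"
          by (intro summable_mult p)
        fix j
        have "(LINT x|M. norm (f j x)) \<le> (LINT x|M. \<bar>e x\<bar> * (\<bar>p j\<bar> * \<bar>s * V\<bar> ^ j))"
          using fi e bd by (intro integral_mono) auto
        then show "norm (LINT x|M. norm (f j x)) \<le> (LINT x|M. \<bar>e x\<bar>) * (\<bar>p j\<bar> * \<bar>s * V\<bar> ^ j)"
          by simp
      qed
    qed
    moreover have "(\<Sum>j. f j x) = e x * h (s * u x)" for x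
      using sums_mult[OF p(2)[of "s * u x"], of "e x"] by (simp add: f_def h_def sums_iff)
    moreover have "integral\<^sup>L M (f j) = (p j * (LINT x|M. e x * u x ^ j)) * s ^ j" for j
      unfolding f_eq by simp
    ultimately show ?thesis using smoothed[of s] by simp
  qed
  from powser_eq_0_imp_coeff_0[OF this, of k] p(1)[OF k] show ?thesis
    by (simp add: u_def)
qed

lemma integrable_gauss_sum_abs_squared:
  assumes C: "finite C"
  shows "integrable (gauss C) (\<lambda>z. (B * (1 + (\<Sum>c\<in>C. \<bar>z c\<bar>)))\<^sup>2)"
proof (rule Bochner_Integration.integrable_bound)
  interpret G: prob_space "gauss C" by (rule prob_space_gauss)
  have "integrable (gauss C) (\<lambda>z. (z c)\<^sup>2)" if "c \<in> C" for c
    by (rule integrable_gauss_coord[OF that integrable_std_normal_power])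
  then show "integrable (gauss C) (\<lambda>z. B\<^sup>2 * (2 + 2 * (real (card C) * (\<Sum>c\<in>C. (z c)\<^sup>2))))"
    by (intro integrable_mult_right Bochner_Integration.integrable_add
        Bochner_Integration.integrable_sum) auto
  show "AE z in gauss C. norm ((B * (1 + (\<Sum>c\<in>C. \<bar>z c\<bar>)))\<^sup>2)
      \<le> norm (B\<^sup>2 * (2 + 2 * (real (card C) * (\<Sum>c\<in>C. (z c)\<^sup>2))))"
  proof (rule AE_I2)
    fix z :: "'a \<Rightarrow> real"
    define S where "S = (\<Sum>c\<in>C. \<bar>z c\<bar>)"
    have S: "S\<^sup>2 \<le> real (card C) * (\<Sum>c\<in>C. (z c)\<^sup>2)"
      using sum_squared_le_sum_of_squares[of "\<lambda>c. \<bar>z c\<bar>" C] by (simp add: S_def mult.commute)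
    have "0 \<le> (1 - S)\<^sup>2" by simp
    then have "(1 + S)\<^sup>2 \<le> 2 + 2 * S\<^sup>2" by (simp add: power2_eq_square algebra_simps)
    also have "\<dots> \<le> 2 + 2 * (real (card C) * (\<Sum>c\<in>C. (z c)\<^sup>2))" using S by simp
    finally have "B\<^sup>2 * (1 + S)\<^sup>2 \<le> B\<^sup>2 * (2 + 2 * (real (card C) * (\<Sum>c\<in>C. (z c)\<^sup>2)))"
      by (rule mult_left_mono) simp
    then show "norm ((B * (1 + (\<Sum>c\<in>C. \<bar>z c\<bar>)))\<^sup>2)
      \<le> norm (B\<^sup>2 * (2 + 2 * (real (card C) * (\<Sum>c\<in>C. (z c)\<^sup>2))))"
      unfolding S_def[symmetric] by (simp add: power_mult_distrib)
  qed
qed measurable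

section \<open>Gram kernels and their quadratic forms\<close>

text \<open>Fubini twice: first in \<open>x'\<close> with \<open>x\<close> fixed, then in
  \<open>x\<close>. The bound by \<open>\<bar>e x\<bar> * G z\<close> with \<open>G\<close> square
  integrable makes both products integrable. The second conclusion is what allows passing from a
  vanishing integral to squares that vanish almost everywhere.\<close>

lemma integral_gram_kernel:
  fixes g :: "'i \<Rightarrow> 'a \<Rightarrow> 'b \<Rightarrow> real"
  assumes "sigma_finite_measure M" "sigma_finite_measure Q" and I: "finite I"
    and g[measurable]: "\<And>i. i \<in> I \<Longrightarrow> (\<lambda>(x, z). g i x z) \<in> borel_measurable (M \<Otimes>\<^sub>M Q)"
    and bd: "\<And>i x z. i \<in> I \<Longrightarrow> x \<in> space M \<Longrightarrow> z \<in> space Q \<Longrightarrow> \<bar>g i x z\<bar> \<le> \<bar>e x\<bar> * G z"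
    and e: "integrable M (e :: 'a \<Rightarrow> real)"
    and [measurable]: "G \<in> borel_measurable Q" and G: "integrable Q (\<lambda>z. (G z)\<^sup>2)"
    and G0: "\<And>z. 0 \<le> G z"
  shows "(LINT x|M. LINT x'|M. LINT z|Q. (\<Sum>i\<in>I. g i x z * g i x' z))
       = (LINT z|Q. (\<Sum>i\<in>I. (LINT x|M. g i x z)\<^sup>2))" (is ?eq)
    and "integrable Q (\<lambda>z. \<Sum>i\<in>I. (LINT x|M. g i x z)\<^sup>2)" (is ?int)
proof -
  interpret M: sigma_finite_measure M by fact
  interpret Q: sigma_finite_measure Q by fact
  interpret MQ: pair_sigma_finite M Q ..
  have [measurable]: "e \<in> borel_measurable M" using e by auto
  define F where "F i z = (LINT x|M. g i x z)" for i z
  have F_meas[measurable]: "F i \<in> borel_measurable Q" if "i \<in> I" for i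
  proof -
    have "(\<lambda>(z, x). g i x z) \<in> borel_measurable (Q \<Otimes>\<^sub>M M)" using that by measurable
    then show ?thesis unfolding F_def by (rule M.borel_measurable_lebesgue_integral)
  qed
  have g_int: "integrable M (\<lambda>x. g i x z)" if "i \<in> I" "z \<in> space Q" for i z
  proof (rule Bochner_Integration.integrable_bound)
    show "integrable M (\<lambda>x. e x * G z)" using e by simp
    show "(\<lambda>x. g i x z) \<in> borel_measurable M" using that by measurable
    show "AE x in M. norm (g i x z) \<le> norm (e x * G z)"
      using bd[OF that(1) _ that(2)] G0 by (auto simp: abs_mult intro!: AE_I2)
  qed
  define E where "E = (LINT x|M. \<bar>e x\<bar>)"
  have F_bd: "\<bar>F i z\<bar> \<le> E * G z" if "i \<in> I" "z \<in> space Q" for i z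
  proof -
    have "\<bar>F i z\<bar> \<le> (LINT x|M. \<bar>g i x z\<bar>)"
      unfolding F_def using integral_norm_bound[of M "\<lambda>x. g i x z"] by simp
    also have "\<dots> \<le> (LINT x|M. \<bar>e x\<bar> * G z)"
      using g_int[OF that] e bd[OF that(1) _ that(2)] by (intro integral_mono) auto
    finally show ?thesis by (simp add: E_def)
  qed
  have E0: "0 \<le> E" by (simp add: E_def)
  have inner: "(LINT x'|M. LINT z|Q. (\<Sum>i\<in>I. g i x z * g i x' z))
      = (LINT z|Q. (\<Sum>i\<in>I. g i x z * F i z))" if x: "x \<in> space M" for x
  proof -
    have "integrable (M \<Otimes>\<^sub>M Q) (\<lambda>(x', z). g i x z * g i x' z)" if i: "i \<in> I" for i
    proof (rule Bochner_Integration.integrable_bound)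
      show "integrable (M \<Otimes>\<^sub>M Q) (\<lambda>(x', z). (\<bar>e x\<bar> * e x') * (G z)\<^sup>2)"
        by (rule MQ.integrable_mult_prod[OF _ G]) (use e in simp)
      show "(\<lambda>(x', z). g i x z * g i x' z) \<in> borel_measurable (M \<Otimes>\<^sub>M Q)"
        using i x by measurable
      show "AE w in M \<Otimes>\<^sub>M Q. norm (case w of (x', z) \<Rightarrow> g i x z * g i x' z)
          \<le> norm (case w of (x', z) \<Rightarrow> (\<bar>e x\<bar> * e x') * (G z)\<^sup>2)"
      proof (rule AE_I2, clarsimp simp: space_pair_measure)
        fix x' z assume xz: "x' \<in> space M" "z \<in> space Q"
        have "\<bar>g i x z\<bar> * \<bar>g i x' z\<bar> \<le> (\<bar>e x\<bar> * G z) * (\<bar>e x'\<bar> * G z)"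
          using xz x i by (intro mult_mono bd) (auto simp: G0)
        then show "\<bar>g i x z * g i x' z\<bar> \<le> \<bar>\<bar>e x\<bar> * e x' * (G z)\<^sup>2\<bar>"
          by (simp add: abs_mult power2_eq_square mult_ac G0)
      qed
    qed
    then have "integrable (M \<Otimes>\<^sub>M Q) (\<lambda>w. \<Sum>i\<in>I. case w of (x', z) \<Rightarrow> g i x z * g i x' z)"
      by (rule Bochner_Integration.integrable_sum)
    then have "integrable (M \<Otimes>\<^sub>M Q) (case_prod (\<lambda>x' z. \<Sum>i\<in>I. g i x z * g i x' z))"
      by (simp add: case_prod_beta')
    then have "(LINT z|Q. LINT x'|M. (\<Sum>i\<in>I. g i x z * g i x' z))
        = (LINT x'|M. LINT z|Q. (\<Sum>i\<in>I. g i x z * g i x' z))"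
      by (rule MQ.Fubini_integral)
    moreover have "(LINT x'|M. (\<Sum>i\<in>I. g i x z * g i x' z)) = (\<Sum>i\<in>I. g i x z * F i z)"
      if "z \<in> space Q" for z
      using g_int that by (subst Bochner_Integration.integral_sum) (auto simp: F_def)
    ultimately show ?thesis
      by (metis (no_types, lifting) Bochner_Integration.integral_cong)
  qed
  have "integrable (M \<Otimes>\<^sub>M Q) (\<lambda>(x, z). g i x z * F i z)" if i: "i \<in> I" for i
  proof (rule Bochner_Integration.integrable_bound)
    show "integrable (M \<Otimes>\<^sub>M Q) (\<lambda>(x, z). (e x * E) * (G z)\<^sup>2)"
      by (rule MQ.integrable_mult_prod[OF _ G]) (use e in simp)
    show "(\<lambda>(x, z). g i x z * F i z) \<in> borel_measurable (M \<Otimes>\<^sub>M Q)"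
      using i by measurable
    show "AE w in M \<Otimes>\<^sub>M Q. norm (case w of (x, z) \<Rightarrow> g i x z * F i z)
        \<le> norm (case w of (x, z) \<Rightarrow> (e x * E) * (G z)\<^sup>2)"
    proof (rule AE_I2, clarsimp simp: space_pair_measure)
      fix x z assume xz: "x \<in> space M" "z \<in> space Q"
      have "\<bar>g i x z\<bar> * \<bar>F i z\<bar> \<le> (\<bar>e x\<bar> * G z) * (E * G z)"
        using xz i by (intro mult_mono bd F_bd) (auto simp: G0 E0)
      then show "\<bar>g i x z * F i z\<bar> \<le> \<bar>e x * E * (G z)\<^sup>2\<bar>"
        by (simp add: abs_mult power2_eq_square mult_ac G0 E0)
    qed
  qed
  then have "integrable (M \<Otimes>\<^sub>M Q) (\<lambda>w. \<Sum>i\<in>I. case w of (x, z) \<Rightarrow> g i x z * F i z)"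
    by (rule Bochner_Integration.integrable_sum)
  then have int2: "integrable (M \<Otimes>\<^sub>M Q) (case_prod (\<lambda>x z. \<Sum>i\<in>I. g i x z * F i z))"
    by (simp add: case_prod_beta')
  have "(LINT x|M. LINT x'|M. LINT z|Q. (\<Sum>i\<in>I. g i x z * g i x' z))
      = (LINT x|M. LINT z|Q. (\<Sum>i\<in>I. g i x z * F i z))"
    using inner by (rule Bochner_Integration.integral_cong[OF refl])
  also have "\<dots> = (LINT z|Q. LINT x|M. (\<Sum>i\<in>I. g i x z * F i z))"
    by (rule MQ.Fubini_integral[OF int2, symmetric])
  also have "\<dots> = (LINT z|Q. (\<Sum>i\<in>I. (F i z)\<^sup>2))"
  proof (rule Bochner_Integration.integral_cong[OF refl])
    fix z assume "z \<in> space Q"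
    then show "(LINT x|M. (\<Sum>i\<in>I. g i x z * F i z)) = (\<Sum>i\<in>I. (F i z)\<^sup>2)"
      using g_int by (subst Bochner_Integration.integral_sum) (auto simp: F_def power2_eq_square)
  qed
  finally show ?eq by (simp add: F_def)
  show ?int
    unfolding F_def[symmetric]
  proof (rule Bochner_Integration.integrable_sum, rule Bochner_Integration.integrable_bound)
    show "integrable Q (\<lambda>z. E\<^sup>2 * (G z)\<^sup>2)" using G by simp
    fix i assume i: "i \<in> I"
    show "(\<lambda>z. (F i z)\<^sup>2) \<in> borel_measurable Q" using i by measurable
    show "AE z in Q. norm ((F i z)\<^sup>2) \<le> norm (E\<^sup>2 * (G z)\<^sup>2)"
    proof (rule AE_I2)
      fix z assume "z \<in> space Q"
      from power_mono[OF F_bd[OF i this], of 2]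
      show "norm ((F i z)\<^sup>2) \<le> norm (E\<^sup>2 * (G z)\<^sup>2)" by (simp add: power_mult_distrib)
    qed
  qed
qed

text \<open>The first summand comes from the derivatives in the outer weights, the second from those
  in the inner coordinates; there the square of the outer weight is already replaced by its mean
  1.\<close>

definition ntk_integrand :: "'c set \<Rightarrow> ('c \<Rightarrow> real) \<Rightarrow> ('c \<Rightarrow> real) \<Rightarrow> ('c \<Rightarrow> real) \<Rightarrow> real" where
  "ntk_integrand C a a' z =
     max 0 (\<Sum>c\<in>C. a c * z c) * max 0 (\<Sum>c\<in>C. a' c * z c) +
     (\<Sum>c\<in>C. a c * a' c) * (of_bool (0 < (\<Sum>c\<in>C. a c * z c)) * of_bool (0 < (\<Sum>c\<in>C. a' c * z c)))"

definition ntk_limit :: "'c set \<Rightarrow> ('c \<Rightarrow> real) \<Rightarrow> ('c \<Rightarrow> real) \<Rightarrow> real" where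
  "ntk_limit C a a' = (LINT z|gauss C. ntk_integrand C a a' z)"

text \<open>The kernel is the mean of a finite sum of products in separated variables, so the form
  is the mean of a sum of squares, each of which must vanish for almost every
  \<open>z\<close>.\<close>

lemma ntk_form_eq_0_imp_ramp_transform_eq_0:
  fixes a :: "'a \<Rightarrow> 'c \<Rightarrow> real"
  assumes "sigma_finite_measure M" and C: "finite C" and e: "integrable M (e :: 'a \<Rightarrow> real)"
    and a[measurable]: "\<And>c. c \<in> C \<Longrightarrow> (\<lambda>x. a x c) \<in> borel_measurable M"
    and B: "\<And>x c. x \<in> space M \<Longrightarrow> c \<in> C \<Longrightarrow> \<bar>a x c\<bar> \<le> B"
    and zero: "(LINT x|M. LINT x'|M. e x * ntk_limit C (a x) (a x') * e x') = 0"
  shows "(LINT x|M. e x * max 0 (\<Sum>c\<in>C. a x c * z c)) = 0"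
proof -
  interpret M: sigma_finite_measure M by fact
  interpret G: prob_space "gauss C" by (rule prob_space_gauss)
  have [measurable]: "e \<in> borel_measurable M" using e by auto
  define B' where "B' = \<bar>B\<bar>"
  have B': "\<bar>a x c\<bar> \<le> B'" if "x \<in> space M" "c \<in> C" for x c
    using B[OF that] by (auto simp: B'_def)
  have B'0: "0 \<le> B'" by (simp add: B'_def)
  define u where "u x z = (\<Sum>c\<in>C. a x c * z c)" for x z
  \<comment> \<open>Index \<open>None\<close> stands for the ramp. Index \<open>Some c\<close>
    carries the \<open>c\<close>-th term of the inner product together with the derivative of the
    ramp, so the sum over \<open>I\<close> rebuilds both summands of the kernel.\<close>
  define g where "g i x z = e x * (case i of None \<Rightarrow> max 0 (u x z) | Some c \<Rightarrow> a x c * of_bool (0 < u x z))"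
    for i x z
  define I where "I = insert None (Some ` C)"
  define G where "G z = B' * (1 + (\<Sum>c\<in>C. \<bar>z c\<bar>))" for z :: "'c \<Rightarrow> real"
  have G0: "0 \<le> G z" for z by (auto simp: G_def B'0 intro!: mult_nonneg_nonneg add_nonneg_nonneg sum_nonneg)
  have I: "finite I" using C by (simp add: I_def)
  have sum_I: "(\<Sum>i\<in>I. f i) = f None + (\<Sum>c\<in>C. f (Some c))" for f :: "'c option \<Rightarrow> real"
    using C by (simp add: I_def sum.reindex)
  have u_meas[measurable]: "(\<lambda>(x, z). u x z) \<in> borel_measurable (M \<Otimes>\<^sub>M gauss C)"
    unfolding u_def by measurable
  have g_meas: "(\<lambda>(x, z). g i x z) \<in> borel_measurable (M \<Otimes>\<^sub>M gauss C)" if "i \<in> I" for i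
    using that unfolding g_def I_def by (auto split: option.splits)
  have g_bd: "\<bar>g i x z\<bar> \<le> \<bar>e x\<bar> * G z" if i: "i \<in> I" and x: "x \<in> space M" for i x z
  proof -
    have s: "0 \<le> B' * (\<Sum>c\<in>C. \<bar>z c\<bar>)" by (auto simp: B'0 intro!: mult_nonneg_nonneg sum_nonneg)
    have "\<bar>case i of None \<Rightarrow> max 0 (u x z) | Some c \<Rightarrow> a x c * of_bool (0 < u x z)\<bar> \<le> G z"
    proof (cases i)
      case None
      have "\<bar>u x z\<bar> \<le> B' * (\<Sum>c\<in>C. \<bar>z c\<bar>)"
        unfolding u_def by (intro abs_sum_mult_le B' x)
      then show ?thesis using None B'0 by (auto simp: G_def algebra_simps)
    next
      case (Some c)
      then have "c \<in> C" using i by (auto simp: I_def)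
      then show ?thesis using Some B'[OF x] B'0 s by (auto simp: G_def algebra_simps intro: add_increasing2)
    qed
    then show ?thesis by (simp add: g_def abs_mult mult_left_mono)
  qed
  have kernel: "(LINT z|gauss C. (\<Sum>i\<in>I. g i x z * g i x' z)) = e x * ntk_limit C (a x) (a x') * e x'" for x x'
  proof -
    have "(\<Sum>i\<in>I. g i x z * g i x' z) = (e x * e x') * ntk_integrand C (a x) (a x') z" for z
    proof -
      have "(\<Sum>c\<in>C. (e x * (a x c * H)) * (e x' * (a x' c * H')))
          = (e x * e x') * ((\<Sum>c\<in>C. a x c * a x' c) * (H * H'))" for H H'
        by (simp add: sum_distrib_left sum_distrib_right mult_ac)
      then show ?thesis
        by (simp add: sum_I g_def ntk_integrand_def distrib_left u_def del: of_bool_eq_iff)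
    qed
    then show ?thesis by (simp add: ntk_limit_def)
  qed
  have [measurable]: "G \<in> borel_measurable (gauss C)" unfolding G_def by measurable
  have G2: "integrable (gauss C) (\<lambda>z. (G z)\<^sup>2)"
    unfolding G_def by (rule integrable_gauss_sum_abs_squared[OF C])
  note gram = integral_gram_kernel[where g = g and e = e and G = G and I = I and Q = "gauss C",
      OF \<open>sigma_finite_measure M\<close> G.sigma_finite_measure_axioms I g_meas g_bd e _ G2 G0]
  have "(LINT z|gauss C. (\<Sum>i\<in>I. (LINT x|M. g i x z)\<^sup>2)) = 0"
    using gram(1) zero by (simp add: kernel)
  then have "AE z in gauss C. (\<Sum>i\<in>I. (LINT x|M. g i x z)\<^sup>2) = 0"
    using gram(2) by (subst (asm) integral_nonneg_eq_0_iff_AE) (auto intro!: AE_I2 sum_nonneg)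
  then have ae: "AE z in gauss C. (LINT x|M. e x * max 0 (\<Sum>c\<in>C. a x c * z c)) = 0"
  proof eventually_elim
    case (elim z)
    then have "(LINT x|M. g None x z)\<^sup>2 = 0"
      using I by (subst (asm) sum_nonneg_eq_0_iff) (auto simp: I_def)
    then show ?case by (simp add: g_def u_def)
  qed
  \<comment> \<open>The ramp is 1-Lipschitz, so its transform is Lipschitz in \<open>z\<close>, and
    vanishing almost everywhere improves to vanishing everywhere.\<close>
  show ?thesis
  proof (rule AE_gauss_eq_0_imp_eq_0[OF C _ _ ae])
    show "0 \<le> (LINT x|M. \<bar>e x\<bar>) * B'" using B'0 by simp
    fix z z' :: "'c \<Rightarrow> real"
    define S where "S = (\<Sum>c\<in>C. \<bar>z c - z' c\<bar>)"
    have int: "integrable M (\<lambda>x. e x * max 0 (u x z))" for z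
      unfolding u_def by (rule integrable_ramp_linear_form[OF e C a B])
    have "\<bar>(LINT x|M. e x * max 0 (u x z)) - (LINT x|M. e x * max 0 (u x z'))\<bar>
        = \<bar>LINT x|M. e x * max 0 (u x z) - e x * max 0 (u x z')\<bar>"
      by (simp add: int)
    also have "\<dots> \<le> (LINT x|M. \<bar>e x * max 0 (u x z) - e x * max 0 (u x z')\<bar>)"
      using integral_norm_bound[of M "\<lambda>x. e x * max 0 (u x z) - e x * max 0 (u x z')"] by simp
    also have "\<dots> \<le> (LINT x|M. \<bar>e x\<bar> * (B' * S))"
    proof (rule integral_mono)
      show "integrable M (\<lambda>x. \<bar>e x * max 0 (u x z) - e x * max 0 (u x z')\<bar>)"
        by (intro integrable_abs Bochner_Integration.integrable_diff int)
      show "integrable M (\<lambda>x. \<bar>e x\<bar> * (B' * S))" using e by simp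
      fix x assume x: "x \<in> space M"
      have "\<bar>max 0 (u x z) - max 0 (u x z')\<bar> \<le> \<bar>u x z - u x z'\<bar>" by auto
      also have "u x z - u x z' = (\<Sum>c\<in>C. a x c * (z c - z' c))"
        by (simp add: u_def right_diff_distrib sum_subtractf)
      also have "\<bar>\<dots>\<bar> \<le> B' * S"
        unfolding S_def by (intro abs_sum_mult_le B' x)
      finally have "\<bar>e x\<bar> * \<bar>max 0 (u x z) - max 0 (u x z')\<bar> \<le> \<bar>e x\<bar> * (B' * S)"
        by (rule mult_left_mono) simp
      then show "\<bar>e x * max 0 (u x z) - e x * max 0 (u x z')\<bar> \<le> \<bar>e x\<bar> * (B' * S)"
        by (simp add: abs_mult flip: right_diff_distrib)
    qed
    finally show "\<bar>(LINT x|M. e x * max 0 (\<Sum>c\<in>C. a x c * z c)) -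
        (LINT x|M. e x * max 0 (\<Sum>c\<in>C. a x c * z' c))\<bar>
        \<le> (LINT x|M. \<bar>e x\<bar>) * B' * (\<Sum>c\<in>C. \<bar>z c - z' c\<bar>)"
      by (simp add: u_def S_def mult_ac)
  qed
qed

section \<open>Polarization of integrals of powers\<close>

text \<open>An algebra of functions that multiply integrable functions into integrable ones; with
  its closure rules, integrability of products of linear forms becomes automatic.\<close>

definition bounded_measurable :: "'a measure \<Rightarrow> ('a \<Rightarrow> 'b::{real_normed_field, second_countable_topology}) \<Rightarrow> bool" where
  "bounded_measurable M f \<longleftrightarrow> f \<in> borel_measurable M \<and> (\<exists>K. \<forall>x\<in>space M. norm (f x) \<le> K)"

lemma bounded_measurable_mult:
  assumes "bounded_measurable M f" "bounded_measurable M g"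
  shows "bounded_measurable M (\<lambda>x. f x * g x)"
proof -
  obtain K K' where "\<forall>x\<in>space M. norm (f x) \<le> K" "\<forall>x\<in>space M. norm (g x) \<le> K'"
    using assms by (auto simp: bounded_measurable_def)
  then have "\<forall>x\<in>space M. norm (f x * g x) \<le> K * K'"
    by (auto simp: norm_mult intro!: mult_mono order_trans[OF norm_ge_zero])
  then show ?thesis using assms by (auto simp: bounded_measurable_def)
qed

lemma bounded_measurable_add:
  assumes "bounded_measurable M f" "bounded_measurable M g"
  shows "bounded_measurable M (\<lambda>x. f x + g x)"
proof -
  obtain K K' where "\<forall>x\<in>space M. norm (f x) \<le> K" "\<forall>x\<in>space M. norm (g x) \<le> K'"
    using assms by (auto simp: bounded_measurable_def)
  then have "\<forall>x\<in>space M. norm (f x + g x) \<le> K + K'"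
    by (auto intro!: norm_triangle_le add_mono)
  then show ?thesis using assms by (auto simp: bounded_measurable_def)
qed

lemma bounded_measurable_const: "bounded_measurable M (\<lambda>x. k)"
  by (auto simp: bounded_measurable_def)

lemma bounded_measurable_power:
  "bounded_measurable M f \<Longrightarrow> bounded_measurable M (\<lambda>x. f x ^ n)"
  by (induction n) (auto intro: bounded_measurable_const bounded_measurable_mult)

lemma bounded_measurable_sum:
  "(\<And>c. c \<in> C \<Longrightarrow> bounded_measurable M (f c)) \<Longrightarrow> bounded_measurable M (\<lambda>x. \<Sum>c\<in>C. f c x)"
  by (induction C rule: infinite_finite_induct)
    (auto intro: bounded_measurable_const bounded_measurable_add)

lemma bounded_measurable_prod_list:
  "(\<And>w. w \<in> set ws \<Longrightarrow> bounded_measurable M (f w)) \<Longrightarrow>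
    bounded_measurable M (\<lambda>x. prod_list (map (\<lambda>w. f w x) ws))"
  by (induction ws) (auto intro: bounded_measurable_const bounded_measurable_mult)

lemma bounded_measurable_of_real:
  "bounded_measurable M f \<Longrightarrow> bounded_measurable M (\<lambda>x. complex_of_real (f x))"
  by (auto simp: bounded_measurable_def)

lemmas bounded_measurable_intros =
  bounded_measurable_const bounded_measurable_mult bounded_measurable_add bounded_measurable_power
  bounded_measurable_sum bounded_measurable_prod_list bounded_measurable_of_real

lemma integrable_mult_bounded_measurable:
  fixes e :: "'a \<Rightarrow> 'b::{real_normed_field, second_countable_topology, banach}"
  assumes e: "integrable M e" and g: "bounded_measurable M g"
  shows "integrable M (\<lambda>x. e x * g x)"
proof -
  obtain K where K: "\<And>x. x \<in> space M \<Longrightarrow> norm (g x) \<le> K"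
    using g by (auto simp: bounded_measurable_def)
  show ?thesis
  proof (rule Bochner_Integration.integrable_bound)
    show "integrable M (\<lambda>x. K * norm (e x))" using e by simp
    show "(\<lambda>x. e x * g x) \<in> borel_measurable M"
      using e g by (auto simp: bounded_measurable_def)
    show "AE x in M. norm (e x * g x) \<le> norm (K * norm (e x))"
    proof (rule AE_I2)
      fix x assume "x \<in> space M"
      then have "norm (g x) \<le> \<bar>K\<bar>" using K[of x] by simp
      from mult_left_mono[OF this, of "norm (e x)"]
      show "norm (e x * g x) \<le> norm (K * norm (e x))"
        by (simp add: norm_mult abs_mult mult.commute)
    qed
  qed
qed

text \<open>One power at a time is traded for a new factor: in the power of the form of
  \<open>v + t * w\<close>, the integral is a polynomial in \<open>t\<close> that vanishes for all
  \<open>t\<close>, and its linear coefficient is a positive multiple of the integral with the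
  factor \<open>w\<close> split off.\<close>

lemma power_integral_polarization:
  fixes b :: "'a \<Rightarrow> 'c \<Rightarrow> real"
  assumes e: "integrable M (e :: 'a \<Rightarrow> real)"
    and b: "\<And>c. c \<in> C \<Longrightarrow> bounded_measurable M (\<lambda>x. b x c)"
    and zero: "\<And>v. (LINT x|M. e x * (\<Sum>c\<in>C. b x c * v c) ^ k) = 0"
    and "length vs + m = k"
  shows "(LINT x|M. e x * (prod_list (map (\<lambda>w. \<Sum>c\<in>C. b x c * w c) vs) * (\<Sum>c\<in>C. b x c * v c) ^ m)) = 0"
  using \<open>length vs + m = k\<close>
proof (induction vs arbitrary: m v)
  case Nil
  then show ?case using zero by simp
next
  case (Cons w vs)
  define F where "F v x = (\<Sum>c\<in>C. b x c * v c)" for v x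
  define PV where "PV x = prod_list (map (\<lambda>w. F w x) vs)" for x
  have F: "bounded_measurable M (F v)" for v
    unfolding F_def by (intro bounded_measurable_intros b)
  have PV: "bounded_measurable M PV"
    unfolding PV_def by (intro bounded_measurable_intros F)
  define J where "J i = (LINT x|M. e x * (PV x * (F w x ^ i * F v x ^ (Suc m - i))))" for i
  \<comment> \<open>The polynomial in \<open>t\<close>, read as a power series that stops at degree
    \<open>Suc m\<close>; degree 1 has the factor \<open>Suc m\<close>, which can be
    cancelled.\<close>
  define q where "q i = (if i \<le> Suc m then real (Suc m choose i) * J i else 0)" for i
  have int: "integrable M (\<lambda>x. e x * (PV x * (F w x ^ i * F v x ^ n)))" for i n
    by (intro integrable_mult_bounded_measurable[OF e] bounded_measurable_intros F PV)
  have "(\<lambda>i. q i * t ^ i) sums 0" for t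
  proof -
    have "F (\<lambda>c. t * w c + v c) x = t * F w x + F v x" for x
      by (simp add: F_def distrib_left sum.distrib sum_distrib_left mult_ac)
    then have "e x * (PV x * F (\<lambda>c. t * w c + v c) x ^ Suc m)
        = (\<Sum>i\<le>Suc m. (real (Suc m choose i) * t ^ i) * (e x * (PV x * (F w x ^ i * F v x ^ (Suc m - i)))))" for x
      by (simp only: binomial_ring sum_distrib_left power_mult_distrib mult_ac)
    moreover have "(LINT x|M. e x * (PV x * F (\<lambda>c. t * w c + v c) x ^ Suc m)) = 0"
      using Cons.IH[of "Suc m"] Cons.prems by (simp add: PV_def F_def)
    ultimately have "(LINT x|M. (\<Sum>i\<le>Suc m. (real (Suc m choose i) * t ^ i) *
        (e x * (PV x * (F w x ^ i * F v x ^ (Suc m - i)))))) = 0"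
      by simp
    then have "(\<Sum>i\<le>Suc m. (real (Suc m choose i) * t ^ i) * J i) = 0"
      unfolding J_def using int by (subst (asm) Bochner_Integration.integral_sum) auto
    moreover have "(\<lambda>i. q i * t ^ i) sums (\<Sum>i\<le>Suc m. q i * t ^ i)"
      by (rule sums_finite) (auto simp: q_def)
    moreover have "(\<Sum>i\<le>Suc m. q i * t ^ i) = (\<Sum>i\<le>Suc m. (real (Suc m choose i) * t ^ i) * J i)"
      by (rule sum.cong) (auto simp: q_def)
    ultimately show ?thesis by simp
  qed
  from powser_eq_0_imp_coeff_0[OF this, of 1] have "J 1 = 0" by (simp add: q_def)
  then show ?case by (simp add: J_def PV_def F_def mult_ac)
qed

text \<open>Each complex coefficient vector is split into real and imaginary part, and each part
  moves to the real list \<open>vs\<close>; linearity of the integral then removes one complex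
  factor. Complex coefficients are what turns real coordinates back into plane waves.\<close>

lemma power_integral_polarization_complex:
  fixes b :: "'a \<Rightarrow> 'c \<Rightarrow> real"
  assumes e: "integrable M (e :: 'a \<Rightarrow> real)"
    and b: "\<And>c. c \<in> C \<Longrightarrow> bounded_measurable M (\<lambda>x. b x c)"
    and zero: "\<And>v. (LINT x|M. e x * (\<Sum>c\<in>C. b x c * v c) ^ k) = 0"
    and "length vs + length ws = k"
  shows "(LINT x|M. complex_of_real (e x * prod_list (map (\<lambda>w. \<Sum>c\<in>C. b x c * w c) vs)) *
           prod_list (map (\<lambda>w. \<Sum>c\<in>C. complex_of_real (b x c) * w c) ws)) = 0"
  using \<open>length vs + length ws = k\<close>
proof (induction ws arbitrary: vs)
  case Nil
  then have "(LINT x|M. e x * prod_list (map (\<lambda>w. \<Sum>c\<in>C. b x c * w c) vs)) = 0"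
    using power_integral_polarization[OF e b zero, of vs 0] by simp
  then show ?case by (simp only: list.map prod_list.Nil mult_1_right integral_complex_of_real of_real_0)
next
  case (Cons w ws)
  define F where "F v x = (\<Sum>c\<in>C. b x c * v c)" for v x
  define G where "G v x = (\<Sum>c\<in>C. complex_of_real (b x c) * v c)" for v x
  define PV where "PV x = prod_list (map (\<lambda>w. F w x) vs)" for x
  define PW where "PW x = prod_list (map (\<lambda>w. G w x) ws)" for x
  have F: "bounded_measurable M (F v)" for v
    unfolding F_def by (intro bounded_measurable_intros b)
  have G: "bounded_measurable M (G v)" for v
    unfolding G_def by (intro bounded_measurable_intros b)
  have P: "bounded_measurable M PV" "bounded_measurable M PW"
    unfolding PV_def PW_def by (intro bounded_measurable_intros F G)+
  have ec: "integrable M (\<lambda>x. complex_of_real (e x))" using e by simp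
  have int: "integrable M (\<lambda>x. complex_of_real (e x) * (complex_of_real (F v x * PV x) * PW x))" for v
    by (intro integrable_mult_bounded_measurable[OF ec] bounded_measurable_intros F P)
  have z: "(LINT x|M. complex_of_real (e x) * (complex_of_real (F v x * PV x) * PW x)) = 0" for v
    using Cons.IH[of "v # vs"] Cons.prems
    by (simp add: PV_def PW_def F_def G_def mult_ac)
  have "G w x = of_real (F (\<lambda>c. Re (w c)) x) + \<i> * of_real (F (\<lambda>c. Im (w c)) x)" for x
    unfolding F_def G_def of_real_sum sum_distrib_left sum.distrib[symmetric]
    by (intro sum.cong refl) (simp add: complex_eq_iff)
  then have "complex_of_real (e x * PV x) * (G w x * PW x) =
      complex_of_real (e x) * (complex_of_real (F (\<lambda>c. Re (w c)) x * PV x) * PW x) +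
      \<i> * (complex_of_real (e x) * (complex_of_real (F (\<lambda>c. Im (w c)) x * PV x) * PW x))" for x
    by (simp add: algebra_simps)
  then have "(LINT x|M. complex_of_real (e x * PV x) * (G w x * PW x)) = 0"
    by (simp only: Bochner_Integration.integral_add[OF int integrable_mult_right[OF int]]
        integral_mult_right_zero z)
      simp
  then show ?case by (simp add: PV_def PW_def F_def G_def)
qed

section \<open>Coordinates of a network\<close>

text \<open>\<open>l\<close> is the neuron and \<open>j\<close> the summation index inside it.
  Separating them from the kind of coordinate writes the inner coordinates as \<open>L * L\<close>
  copies of a finite set that does not depend on \<open>L\<close>.\<close>

primrec place :: "nat \<Rightarrow> nat \<Rightarrow> coord \<Rightarrow> coord" where
  "place l j (Outer _) = Outer l"
| "place l j (Inner1 _ _ \<nu> p) = Inner1 l j \<nu> p"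
| "place l j (Inner2 _ _ km p) = Inner2 l j km p"

text \<open>The kinds of inner coordinates, represented by those with neuron and copy number 0.\<close>

definition templates :: "setup_data \<Rightarrow> coord set" where
  "templates D =
     {Inner1 0 0 \<nu> p | \<nu> p. \<nu> \<in> S_all D \<and> arg2 \<nu> < pi} \<union>
     {Inner2 0 0 km p | km p. km \<in> cell_indices D \<and> 0 < fst km}"

lemma place_templates_inject:
  "c \<in> templates D \<Longrightarrow> c' \<in> templates D \<Longrightarrow>
    place l j c = place l' j' c' \<longleftrightarrow> l = l' \<and> j = j' \<and> c = c'"
  by (auto simp: templates_def)

lemma place_templates_neq_Outer: "c \<in> templates D \<Longrightarrow> place l j c \<noteq> Outer l'"
  by (auto simp: templates_def)

lemma Outer_notin_templates: "Outer l \<notin> templates D"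
  by (auto simp: templates_def)

lemma coords_eq:
  "coords D L = Outer ` {..<L} \<union> (\<lambda>(l, j, c). place l j c) ` ({..<L} \<times> {..<L} \<times> templates D)"
proof (rule equalityI; rule subsetI)
  fix k assume "k \<in> coords D L"
  then consider l where "k = Outer l" "l < L"
    | l j \<nu> p where "k = Inner1 l j \<nu> p" "l < L" "j < L" "\<nu> \<in> S_all D" "arg2 \<nu> < pi"
    | l j km p where "k = Inner2 l j km p" "l < L" "j < L" "km \<in> cell_indices D" "0 < fst km"
    unfolding coords_def by blast
  then show "k \<in> Outer ` {..<L} \<union> (\<lambda>(l, j, c). place l j c) ` ({..<L} \<times> {..<L} \<times> templates D)"
  proof cases
    case 1
    then show ?thesis by auto
  next
    case (2 l j \<nu> p)
    then show ?thesis
      by (intro UnI2 image_eqI[where x = "(l, j, Inner1 0 0 \<nu> p)"]) (auto simp: templates_def)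
  next
    case (3 l j km p)
    moreover obtain k m where "km = (k, m)" by (cases km)
    ultimately show ?thesis
      by (intro UnI2 image_eqI[where x = "(l, j, Inner2 0 0 km p)"]) (auto simp: templates_def)
  qed
qed (auto simp: coords_def templates_def)

lemma finite_coords: "finite (templates D) \<Longrightarrow> finite (coords D L)"
  unfolding coords_eq by auto

lemma sum_coords:
  assumes "finite (templates D)"
  shows "(\<Sum>k\<in>coords D L. f k) =
    (\<Sum>l<L. f (Outer l)) + (\<Sum>l<L. \<Sum>j<L. \<Sum>c\<in>templates D. (f (place l j c) :: real))"
proof -
  have inj: "inj_on (\<lambda>(l, j, c). place l j c) ({..<L} \<times> {..<L} \<times> templates D)"
    by (auto simp: inj_on_def place_templates_inject)
  have "(\<Sum>k\<in>coords D L. f k) = (\<Sum>k\<in>Outer ` {..<L}. f k) +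
      (\<Sum>k\<in>(\<lambda>(l, j, c). place l j c) ` ({..<L} \<times> {..<L} \<times> templates D). f k)"
    unfolding coords_eq using assms place_templates_neq_Outer[of _ D]
    by (intro sum.union_disjoint) (auto, metis)
  also have "(\<Sum>k\<in>Outer ` {..<L}. f k) = (\<Sum>l<L. f (Outer l))"
    by (subst sum.reindex) (auto simp: inj_on_def)
  also have "(\<Sum>k\<in>(\<lambda>(l, j, c). place l j c) ` ({..<L} \<times> {..<L} \<times> templates D). f k)
      = (\<Sum>l<L. \<Sum>j<L. \<Sum>c\<in>templates D. f (place l j c))"
    by (subst sum.reindex[OF inj]) (simp add: sum.cartesian_product case_prod_beta')
  finally show ?thesis .
qed

text \<open>All inner coordinates of one kind in neuron \<open>l\<close>, over which the
  pre-activation sums. The kind \<open>Outer 0\<close> occurs once per neuron, so its block is a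
  singleton and \<open>aggregate\<close> returns the outer weight itself.\<close>

definition block :: "nat \<Rightarrow> nat \<Rightarrow> coord \<Rightarrow> coord set" where
  "block L l c = (\<lambda>j. place l j c) ` (if c = Outer 0 then {0} else {..<L})"

text \<open>The normalization is that of the pre-activation, and it makes the sum of a block
  standard normal again, whatever \<open>L\<close> is.\<close>

definition aggregate :: "nat \<Rightarrow> nat \<Rightarrow> coord \<Rightarrow> params \<Rightarrow> real" where
  "aggregate L l c \<Theta> = (\<Sum>k\<in>block L l c. \<Theta> k) / sqrt (real (card (block L l c)))"

lemma block_Outer: "block L l (Outer 0) = {Outer l}"
  by (auto simp: block_def)

lemma aggregate_Outer: "aggregate L l (Outer 0) \<Theta> = \<Theta> (Outer l)"
  by (simp add: aggregate_def block_Outer)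

lemma finite_block: "finite (block L l c)"
  by (simp add: block_def)

lemma block_template: "c \<in> templates D \<Longrightarrow> block L l c = (\<lambda>j. place l j c) ` {..<L}"
  by (auto simp: block_def templates_def)

lemma aggregate_template:
  assumes "c \<in> templates D"
  shows "aggregate L l c \<Theta> = (\<Sum>j<L. \<Theta> (place l j c)) / sqrt (real L)"
proof -
  have "inj_on (\<lambda>j. place l j c) {..<L}"
    using assms by (auto simp: inj_on_def place_templates_inject)
  then show ?thesis
    by (simp add: aggregate_def block_template[OF assms] sum.reindex card_image)
qed

lemma block_subset_coords:
  assumes "c \<in> insert (Outer 0) (templates D)" "l < L"
  shows "block L l c \<subseteq> coords D L"
proof (cases "c = Outer 0")
  case True
  then show ?thesis using assms by (auto simp: block_Outer coords_eq)
next
  case False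
  then have "c \<in> templates D" using assms by auto
  then show ?thesis using assms unfolding block_template[OF \<open>c \<in> templates D\<close>] coords_eq by force
qed

lemma block_nonempty: "0 < L \<Longrightarrow> block L l c \<noteq> {}"
  by (auto simp: block_def)

text \<open>Distinct neurons, and distinct kinds within one neuron, draw on disjoint sets of
  coordinates; the independence statements on neurons come from this.\<close>

lemma block_disjoint:
  assumes "c \<in> insert (Outer 0) (templates D)" "c' \<in> insert (Outer 0) (templates D)"
    and "(l, c) \<noteq> (l', c')"
  shows "block L l c \<inter> block L l' c' = {}"
  using assms place_templates_neq_Outer[of _ D] place_templates_inject[of _ D]
  unfolding block_def by (auto split: if_splits) metis+

section \<open>Law of large numbers for the neurons\<close>

lemma init_law_eq: "init_law D L = gauss (coords D L)"
  by (simp add: init_law_def std_normal_def)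

lemma prob_space_init_law: "prob_space (init_law D L)"
  unfolding init_law_eq by (rule prob_space_gauss)

lemma distr_aggregate:
  assumes c: "c \<in> insert (Outer 0) (templates D)" and l: "l < L"
  shows "distr (init_law D L) std_normal (aggregate L l c) = std_normal"
proof -
  interpret prob_space "gauss (coords D L)" by (rule prob_space_gauss)
  have sub: "block L l c \<subseteq> coords D L" by (rule block_subset_coords[OF c l])
  have ne: "block L l c \<noteq> {}" using l by (intro block_nonempty) simp
  have card: "0 < card (block L l c)" using ne finite_block by (simp add: card_gt_0_iff)
  define a where "a = 1 / sqrt (real (card (block L l c)))"
  have "distr (gauss (coords D L)) borel (\<lambda>\<Theta>. \<Sum>k\<in>block L l c. a * \<Theta> k)
      = density lborel (normal_density 0 1)"
  proof (rule distr_indep_normal_sum[OF prob_space_gauss finite_block])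
    show "indep_vars (\<lambda>_. std_normal) (\<lambda>k \<Theta>. \<Theta> k) (block L l c)"
      by (rule indep_vars_subset[OF indep_vars_PiM_coordinates sub]) (rule prob_space_std_normal)
    show "distr (gauss (coords D L)) std_normal (\<lambda>\<Theta>. \<Theta> k) = std_normal" if "k \<in> block L l c" for k
      using sub that by (intro distr_PiM_component prob_space_std_normal) auto
    show "(\<Sum>k\<in>block L l c. a\<^sup>2) = 1\<^sup>2" using card by (simp add: a_def power_divide)
  qed simp
  moreover have "(\<lambda>\<Theta>. \<Sum>k\<in>block L l c. a * \<Theta> k) = aggregate L l c"
    by (auto simp: a_def aggregate_def sum_divide_distrib fun_eq_iff)
  moreover have "distr (gauss (coords D L)) borel f = distr (gauss (coords D L)) std_normal f" for f
    by (rule distr_cong) auto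
  ultimately show ?thesis by (simp add: init_law_eq std_normal_def)
qed

lemma aggregate_measurable:
  assumes "block L l c \<subseteq> K"
  shows "aggregate L l c \<in> borel_measurable (gauss K)"
proof -
  have "(\<lambda>\<Theta>. \<Theta> k) \<in> borel_measurable (gauss K)" if "k \<in> block L l c" for k
    using measurable_component_singleton[of k K "\<lambda>_. std_normal"] that assms by auto
  then show ?thesis unfolding aggregate_def[abs_def] by measurable
qed

text \<open>All that the network sees of neuron \<open>l\<close>, as a point of a product space that
  is the same for all \<open>l\<close> and \<open>L\<close>.\<close>

definition neuron :: "setup_data \<Rightarrow> nat \<Rightarrow> nat \<Rightarrow> params \<Rightarrow> params" where
  "neuron D L l \<Theta> = (\<lambda>c\<in>insert (Outer 0) (templates D). aggregate L l c \<Theta>)"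

lemma neuron_measurable:
  assumes "\<And>c. c \<in> insert (Outer 0) (templates D) \<Longrightarrow> block L l c \<subseteq> K"
  shows "neuron D L l \<in> measurable (gauss K) (gauss (insert (Outer 0) (templates D)))"
  unfolding neuron_def[abs_def]
  using aggregate_measurable[OF assms] by (intro measurable_restrict) auto

lemma aggregate_restrict:
  "block L l c \<subseteq> K \<Longrightarrow> aggregate L l c (restrict \<Theta> K) = aggregate L l c \<Theta>"
  unfolding aggregate_def by (auto intro!: arg_cong2[where f = "(/)"] sum.cong)

text \<open>The aggregates of one neuron are functions of disjoint blocks, hence independent, and
  each is standard normal. The resulting law does not involve \<open>L\<close>.\<close>

lemma distr_neuron:
  assumes l: "l < L"
  shows "distr (init_law D L) (gauss (insert (Outer 0) (templates D))) (neuron D L l)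
    = gauss (insert (Outer 0) (templates D))"
proof -
  let ?C = "insert (Outer 0) (templates D)"
  interpret prob_space "gauss (coords D L)" by (rule prob_space_gauss)
  have sub: "block L l c \<subseteq> coords D L" if "c \<in> ?C" for c by (rule block_subset_coords[OF that l])
  have "indep_vars (\<lambda>c. gauss (block L l c)) (\<lambda>c \<Theta>. restrict (\<lambda>k. \<Theta> k) (block L l c)) ?C"
  proof (rule indep_vars_restrict)
    show "indep_vars (\<lambda>_. std_normal) (\<lambda>k \<Theta>. \<Theta> k) (coords D L)"
      by (rule indep_vars_PiM_coordinates) (rule prob_space_std_normal)
    show "disjoint_family_on (block L l) ?C"
      using block_disjoint[of _ D _ l l L] by (auto simp: disjoint_family_on_def)
  qed (rule sub)
  from indep_vars_compose2[OF this, of "aggregate L l" "\<lambda>_. std_normal"]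
  have ind: "indep_vars (\<lambda>_. std_normal) (aggregate L l) ?C"
    using aggregate_measurable[of L l, OF order_refl]
    by (simp add: aggregate_restrict[OF order_refl] measurable_cong_sets[OF refl sets_std_normal])
  have "distr (gauss (coords D L)) (gauss ?C) (\<lambda>\<Theta>. \<lambda>c\<in>?C. aggregate L l c \<Theta>)
      = (\<Pi>\<^sub>M c\<in>?C. distr (gauss (coords D L)) std_normal (aggregate L l c))"
    by (rule indep_vars_iff_distr_eq_PiM'[THEN iffD1, OF _ _ ind])
      (use aggregate_measurable[OF sub] in auto)
  also have "\<dots> = gauss ?C"
    using distr_aggregate[OF _ l, of _ D] by (intro PiM_cong) (auto simp: init_law_eq)
  finally show ?thesis by (simp add: init_law_eq neuron_def[abs_def])
qed

text \<open>Neuron \<open>l\<close> is a function of the union of its blocks, and these unions are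
  disjoint for different \<open>l\<close>.\<close>

lemma indep_vars_neuron_functions:
  assumes f: "f \<in> borel_measurable (gauss (insert (Outer 0) (templates D)))"
  shows "prob_space.indep_vars (init_law D L) (\<lambda>_. borel) (\<lambda>l \<Theta>. f (neuron D L l \<Theta>) :: real) {..<L}"
proof -
  let ?C = "insert (Outer 0) (templates D)"
  interpret prob_space "gauss (coords D L)" by (rule prob_space_gauss)
  define K where "K l = (\<Union>c\<in>?C. block L l c)" for l
  have "indep_vars (\<lambda>l. gauss (K l)) (\<lambda>l \<Theta>. restrict (\<lambda>k. \<Theta> k) (K l)) {..<L}"
  proof (rule indep_vars_restrict)
    show "indep_vars (\<lambda>_. std_normal) (\<lambda>k \<Theta>. \<Theta> k) (coords D L)"
      by (rule indep_vars_PiM_coordinates) (rule prob_space_std_normal)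
    show "K l \<subseteq> coords D L" if "l \<in> {..<L}" for l
      using block_subset_coords[of _ D l L] that by (auto simp: K_def)
    show "disjoint_family_on K {..<L}"
      unfolding disjoint_family_on_def
    proof (intro ballI impI)
      fix l l' :: nat assume "l \<noteq> l'"
      then have "block L l c \<inter> block L l' c' = {}" if "c \<in> ?C" "c' \<in> ?C" for c c'
        using block_disjoint[OF that] by simp
      then show "K l \<inter> K l' = {}" unfolding K_def by (intro equals0I) (elim IntE UN_E, blast)
    qed
  qed
  moreover have "(\<lambda>y. f (neuron D L l y)) \<in> borel_measurable (gauss (K l))" for l
    by (rule measurable_compose[OF neuron_measurable f]) (auto simp: K_def)
  ultimately have "indep_vars (\<lambda>_. borel) (\<lambda>l \<Theta>. f (neuron D L l (restrict \<Theta> (K l)))) {..<L}"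
    by (rule indep_vars_compose2)
  moreover have "neuron D L l (restrict \<Theta> (K l)) = neuron D L l \<Theta>" for l \<Theta>
    unfolding neuron_def by (intro restrict_ext aggregate_restrict) (auto simp: K_def)
  ultimately show ?thesis by (simp add: init_law_eq)
qed

text \<open>Chebyshev with the second moment as a bound for the variance; the mixed products of
  centred variables have mean 0. An explicit estimate for one fixed \<open>L\<close> is needed
  because the probability space itself changes with the width.\<close>

lemma (in prob_space) weak_law_of_large_numbers:
  assumes ind: "indep_vars (\<lambda>_. borel) X {..<L}" and L: "0 < L"
    and sq: "\<And>l. l < L \<Longrightarrow> integrable M (\<lambda>\<omega>. (X l \<omega>)\<^sup>2)"
    and mean: "\<And>l. l < L \<Longrightarrow> expectation (X l) = \<mu>"
    and bound: "\<And>l. l < L \<Longrightarrow> expectation (\<lambda>\<omega>. (X l \<omega>)\<^sup>2) \<le> B"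
    and \<epsilon>: "0 < \<epsilon>"
  shows "prob {\<omega> \<in> space M. \<epsilon> < \<bar>(\<Sum>l<L. X l \<omega>) / real L - \<mu>\<bar>} \<le> B / (real L * \<epsilon>\<^sup>2)"
proof -
  have rv[measurable]: "random_variable borel (X l)" if "l < L" for l
    using ind that by (auto simp: indep_vars_def)
  have X: "integrable M (X l)" if "l < L" for l
    using square_integrable_imp_integrable[OF rv sq] that by auto
  define Y where "Y l \<omega> = X l \<omega> - \<mu>" for l \<omega>
  have Y_rv[measurable]: "random_variable borel (Y l)" if "l < L" for l
    using rv[OF that] unfolding Y_def[abs_def] by measurable
  have Y_int: "integrable M (Y l)" and Y_mean: "expectation (Y l) = 0" if "l < L" for l
    using X[OF that] mean[OF that] by (auto simp: Y_def[abs_def] prob_space)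
  have Y_sq: "integrable M (\<lambda>\<omega>. Y l \<omega> * Y l \<omega>)"
    and Y_var: "expectation (\<lambda>\<omega>. Y l \<omega> * Y l \<omega>) \<le> B" if "l < L" for l
  proof -
    have eq: "Y l \<omega> * Y l \<omega> = (X l \<omega>)\<^sup>2 - 2 * \<mu> * X l \<omega> + \<mu>\<^sup>2" for \<omega>
      by (simp add: Y_def power2_eq_square algebra_simps)
    show "integrable M (\<lambda>\<omega>. Y l \<omega> * Y l \<omega>)"
      unfolding eq using X[OF that] sq[OF that] by auto
    have "expectation (\<lambda>\<omega>. Y l \<omega> * Y l \<omega>) = expectation (\<lambda>\<omega>. (X l \<omega>)\<^sup>2) - \<mu>\<^sup>2"
      unfolding eq using X[OF that] sq[OF that] mean[OF that]
      by (simp add: prob_space power2_eq_square)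
    then show "expectation (\<lambda>\<omega>. Y l \<omega> * Y l \<omega>) \<le> B"
      using bound[OF that] zero_le_power2[of \<mu>] by linarith
  qed
  have cross: "integrable M (\<lambda>\<omega>. Y l \<omega> * Y l' \<omega>) \<and> expectation (\<lambda>\<omega>. Y l \<omega> * Y l' \<omega>) = 0"
    if "l < L" "l' < L" "l \<noteq> l'" for l l'
  proof -
    have "indep_vars (\<lambda>_. borel) X {l, l'}"
      by (rule indep_vars_subset[OF ind]) (use that in auto)
    then have i: "indep_vars (\<lambda>_. borel) Y {l, l'}"
      unfolding Y_def[abs_def] by (rule indep_vars_compose2) auto
    have int: "integrable M (Y k)" if "k \<in> {l, l'}" for k using Y_int that \<open>l < L\<close> \<open>l' < L\<close> by auto
    show ?thesis
      using indep_vars_lebesgue_integral[OF _ i int] indep_vars_integrable[OF _ i int] that Y_mean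
      by simp
  qed
  have prod_int: "integrable M (\<lambda>\<omega>. Y l \<omega> * Y l' \<omega>)" if "l < L" "l' < L" for l l'
    using cross Y_sq that by (cases "l = l'") auto
  define S where "S \<omega> = (\<Sum>l<L. Y l \<omega>)" for \<omega>
  have S_sq: "(S \<omega>)\<^sup>2 = (\<Sum>l<L. \<Sum>l'<L. Y l \<omega> * Y l' \<omega>)" for \<omega>
    by (simp add: S_def power2_eq_square sum_product)
  have S_int: "integrable M (\<lambda>\<omega>. (S \<omega>)\<^sup>2)"
    unfolding S_sq using prod_int by (intro Bochner_Integration.integrable_sum) auto
  have "expectation (\<lambda>\<omega>. (S \<omega>)\<^sup>2) = (\<Sum>l<L. \<Sum>l'<L. expectation (\<lambda>\<omega>. Y l \<omega> * Y l' \<omega>))"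
    unfolding S_sq using prod_int
    by (subst Bochner_Integration.integral_sum, force)
      (auto intro!: sum.cong Bochner_Integration.integral_sum)
  also have "\<dots> = (\<Sum>l<L. expectation (\<lambda>\<omega>. Y l \<omega> * Y l \<omega>))"
  proof (rule sum.cong[OF refl])
    fix l assume l: "l \<in> {..<L}"
    have "(\<Sum>l'<L. expectation (\<lambda>\<omega>. Y l \<omega> * Y l' \<omega>))
        = (\<Sum>l'\<in>{l}. expectation (\<lambda>\<omega>. Y l \<omega> * Y l' \<omega>))"
      using l cross by (intro sum.mono_neutral_right) auto
    then show "(\<Sum>l'<L. expectation (\<lambda>\<omega>. Y l \<omega> * Y l' \<omega>)) = expectation (\<lambda>\<omega>. Y l \<omega> * Y l \<omega>)"
      by simp
  qed
  also have "\<dots> \<le> real L * B"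
    using sum_bounded_above[of "{..<L}" "\<lambda>l. expectation (\<lambda>\<omega>. Y l \<omega> * Y l \<omega>)" B] Y_var by simp
  finally have S_var: "expectation (\<lambda>\<omega>. (S \<omega>)\<^sup>2) \<le> real L * B" .
  have S_mean: "expectation S = 0"
    unfolding S_def[abs_def] using Y_int Y_mean by (subst Bochner_Integration.integral_sum) auto
  have S_rv[measurable]: "random_variable borel S" unfolding S_def[abs_def] by measurable
  have dev: "(\<Sum>l<L. X l \<omega>) / real L - \<mu> = S \<omega> / real L" for \<omega>
    using L by (simp add: S_def Y_def sum_subtractf field_simps)
  have "prob {\<omega> \<in> space M. \<epsilon> < \<bar>(\<Sum>l<L. X l \<omega>) / real L - \<mu>\<bar>}
      \<le> prob {\<omega> \<in> space M. \<bar>S \<omega> - expectation S\<bar> \<ge> real L * \<epsilon>}"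
    unfolding dev S_mean using L by (intro finite_measure_mono) (auto simp: field_simps)
  also have "\<dots> \<le> variance S / (real L * \<epsilon>)\<^sup>2"
    using L \<epsilon> by (intro Chebyshev_inequality S_rv S_int) auto
  also have "\<dots> \<le> real L * B / (real L * \<epsilon>)\<^sup>2"
    using S_var by (intro divide_right_mono) (auto simp: S_mean)
  also have "\<dots> = B / (real L * \<epsilon>\<^sup>2)"
    using L by (simp add: power2_eq_square field_simps)
  finally show ?thesis .
qed

text \<open>The coordinate \<open>Outer 0\<close> of \<open>y\<close> is the outer weight of the neuron.\<close>

definition neuron_ntk :: "coord set \<Rightarrow> (coord \<Rightarrow> real) \<Rightarrow> (coord \<Rightarrow> real) \<Rightarrow> params \<Rightarrow> real" where
  "neuron_ntk C a a' y =
     max 0 (\<Sum>c\<in>C. a c * y c) * max 0 (\<Sum>c\<in>C. a' c * y c) +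
     (y (Outer 0))\<^sup>2 * ((\<Sum>c\<in>C. a c * a' c) *
       (of_bool (0 < (\<Sum>c\<in>C. a c * y c)) * of_bool (0 < (\<Sum>c\<in>C. a' c * y c))))"

lemma neuron_ntk_measurable:
  "neuron_ntk C a a' \<in> borel_measurable (gauss (insert (Outer 0) C))"
  unfolding neuron_ntk_def[abs_def] by measurable

text \<open>The kernel of a neuron grows at most quadratically in its coordinates, so its square is
  controlled by Gaussian moments of order 4.\<close>

lemma integrable_neuron_ntk_squared:
  assumes C: "finite C"
  shows "integrable (gauss (insert (Outer 0) C)) (\<lambda>y. (neuron_ntk C a a' y)\<^sup>2)"
proof (rule Bochner_Integration.integrable_bound)
  let ?C = "insert (Outer 0) C"
  have y4: "integrable (gauss ?C) (\<lambda>y. (y c) ^ 4)" if "c \<in> ?C" for c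
    by (rule integrable_gauss_coord[OF that integrable_std_normal_power])
  \<comment> \<open>The inserted 0 keeps the maximum defined for empty \<open>C\<close> and makes
    \<open>A\<close> nonnegative.\<close>
  define A where "A = Max (insert 0 ((\<lambda>c. \<bar>a c\<bar>) ` C \<union> (\<lambda>c. \<bar>a' c\<bar>) ` C))"
  have A: "\<bar>a c\<bar> \<le> A" "\<bar>a' c\<bar> \<le> A" if "c \<in> C" for c
    using that C by (auto simp: A_def intro!: Max_ge)
  have A0: "0 \<le> A" using C by (auto simp: A_def intro!: Max_ge)
  define d where "d = (\<Sum>c\<in>C. a c * a' c)"
  define N where "N = real (card C)"
  \<comment> \<open>The factors 2 come from bounding the square of a sum of two terms, and
    \<open>N ^ 3\<close> from Cauchy-Schwarz applied twice to the fourth power of the sum of the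
    \<open>\<bar>y c\<bar>\<close>.\<close>
  define bnd where "bnd y = 2 * (A ^ 4 * (N ^ 3 * (\<Sum>c\<in>C. (y c) ^ 4))) + 2 * (d\<^sup>2 * (y (Outer 0)) ^ 4)"
    for y :: params
  show "integrable (gauss ?C) bnd"
    unfolding bnd_def[abs_def] using y4
    by (intro Bochner_Integration.integrable_add integrable_mult_right
        Bochner_Integration.integrable_sum) auto
  show "(\<lambda>y. (neuron_ntk C a a' y)\<^sup>2) \<in> borel_measurable (gauss ?C)"
    using neuron_ntk_measurable[of C a a'] by measurable
  show "AE y in gauss ?C. norm ((neuron_ntk C a a' y)\<^sup>2) \<le> norm (bnd y)"
  proof (rule AE_I2)
    fix y :: params
    define S where "S = (\<Sum>c\<in>C. \<bar>y c\<bar>)"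
    have S0: "0 \<le> S" by (simp add: S_def sum_nonneg)
    have "S\<^sup>2 \<le> N * (\<Sum>c\<in>C. (y c)\<^sup>2)"
      using sum_squared_le_sum_of_squares[of "\<lambda>c. \<bar>y c\<bar>" C] by (simp add: S_def N_def mult.commute)
    then have "(S\<^sup>2)\<^sup>2 \<le> (N * (\<Sum>c\<in>C. (y c)\<^sup>2))\<^sup>2" by (rule power_mono) simp
    also have "\<dots> = N\<^sup>2 * (\<Sum>c\<in>C. (y c)\<^sup>2)\<^sup>2" by (simp add: power_mult_distrib)
    also have "\<dots> \<le> N\<^sup>2 * (N * (\<Sum>c\<in>C. (y c) ^ 4))"
      using sum_squared_le_sum_of_squares[of "\<lambda>c. (y c)\<^sup>2" C]
      by (intro mult_left_mono) (simp_all add: N_def mult.commute flip: power_mult)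
    finally have S4: "(S\<^sup>2)\<^sup>2 \<le> N ^ 3 * (\<Sum>c\<in>C. (y c) ^ 4)"
      by (simp add: power3_eq_cube power2_eq_square mult_ac)
    have u: "\<bar>\<Sum>c\<in>C. a c * y c\<bar> \<le> A * S" "\<bar>\<Sum>c\<in>C. a' c * y c\<bar> \<le> A * S"
      unfolding S_def by (intro abs_sum_mult_le A; assumption)+
    define p where "p = max 0 (\<Sum>c\<in>C. a c * y c) * max 0 (\<Sum>c\<in>C. a' c * y c)"
    define q where "q = (y (Outer 0))\<^sup>2 * (d *
       (of_bool (0 < (\<Sum>c\<in>C. a c * y c)) * of_bool (0 < (\<Sum>c\<in>C. a' c * y c))))"
    have "\<bar>p\<bar> \<le> (A * S) * (A * S)"
      unfolding p_def abs_mult using u A0 S0 by (intro mult_mono) auto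
    then have "p\<^sup>2 \<le> ((A * S) * (A * S))\<^sup>2"
      using power_mono[of "\<bar>p\<bar>" _ 2] by simp
    also have "\<dots> = A ^ 4 * (S\<^sup>2)\<^sup>2" by (simp add: power2_eq_square power4_eq_xxxx mult_ac)
    also have "\<dots> \<le> A ^ 4 * (N ^ 3 * (\<Sum>c\<in>C. (y c) ^ 4))"
      using S4 A0 by (intro mult_left_mono) auto
    finally have p: "p\<^sup>2 \<le> A ^ 4 * (N ^ 3 * (\<Sum>c\<in>C. (y c) ^ 4))" .
    have "q = (y (Outer 0))\<^sup>2 * d \<or> q = 0" by (auto simp: q_def)
    then have "q\<^sup>2 \<le> d\<^sup>2 * (y (Outer 0)) ^ 4"
      by (auto simp: power_mult_distrib mult.commute simp flip: power_mult)
    moreover have "(p + q)\<^sup>2 \<le> 2 * p\<^sup>2 + 2 * q\<^sup>2"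
      using zero_le_power2[of "p - q"] by (simp add: power2_eq_square algebra_simps)
    ultimately have "(p + q)\<^sup>2 \<le> bnd y" using p by (simp add: bnd_def)
    then show "norm ((neuron_ntk C a a' y)\<^sup>2) \<le> norm (bnd y)"
      by (simp add: neuron_ntk_def p_def q_def d_def)
  qed
qed

text \<open>The pre-activations do not contain the outer weight, so it can be integrated out first;
  only its second moment 1 remains.\<close>

lemma integral_neuron_ntk:
  assumes C: "finite C" "Outer 0 \<notin> C"
  shows "(LINT y|gauss (insert (Outer 0) C). neuron_ntk C a a' y) = ntk_limit C a a'"
proof -
  interpret G: prob_space "gauss (insert (Outer 0) C)" by (rule prob_space_gauss)
  interpret product_sigma_finite "\<lambda>_ :: coord. std_normal" by unfold_locales
  have int: "integrable (gauss (insert (Outer 0) C)) (neuron_ntk C a a')"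
    by (rule G.square_integrable_imp_integrable[OF neuron_ntk_measurable
          integrable_neuron_ntk_squared[OF C(1)]])
  have upd: "(\<Sum>c\<in>C. f c * (x(Outer 0 := w)) c) = (\<Sum>c\<in>C. f c * x c)" for f x w
    using C by (intro sum.cong) auto
  have "(LINT w|std_normal. neuron_ntk C a a' (x(Outer 0 := w))) = ntk_integrand C a a' x" for x
    unfolding neuron_ntk_def upd ntk_integrand_def
    using integrable_std_normal_power[of 2]
    by (simp add: std_normal_second_moment std_normal.prob_space[simplified])
  then show ?thesis
    using product_integral_insert[OF C int] by (simp add: ntk_limit_def)
qed

section \<open>The gradient of the network\<close>

text \<open>Tested on an increment in the single coordinate \<open>c\<close>: with a third of the
  difference as tolerance, two linear approximations would differ by at most two thirds of
  it.\<close>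

lemma has_gradient_unique:
  assumes P: "finite P" and G: "has_gradient P F \<Theta> G" and G': "has_gradient P F \<Theta> G'"
    and c: "c \<in> P"
  shows "G c = G' c"
proof (rule ccontr)
  assume ne: "G c \<noteq> G' c"
  define \<epsilon> where "\<epsilon> = \<bar>G c - G' c\<bar> / 3"
  have \<epsilon>: "0 < \<epsilon>" using ne by (simp add: \<epsilon>_def)
  obtain \<delta> where \<delta>: "0 < \<delta>" "\<And>\<Theta>'. (\<forall>c. c \<notin> P \<longrightarrow> \<Theta>' c = \<Theta> c) \<and> L2_set (\<lambda>c. \<Theta>' c - \<Theta> c) P < \<delta> \<Longrightarrow>
      \<bar>F \<Theta>' - F \<Theta> - (\<Sum>c\<in>P. G c * (\<Theta>' c - \<Theta> c))\<bar> \<le> \<epsilon> * L2_set (\<lambda>c. \<Theta>' c - \<Theta> c) P"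
    using G \<epsilon> unfolding has_gradient_def by blast
  obtain \<delta>' where \<delta>': "0 < \<delta>'" "\<And>\<Theta>'. (\<forall>c. c \<notin> P \<longrightarrow> \<Theta>' c = \<Theta> c) \<and> L2_set (\<lambda>c. \<Theta>' c - \<Theta> c) P < \<delta>' \<Longrightarrow>
      \<bar>F \<Theta>' - F \<Theta> - (\<Sum>c\<in>P. G' c * (\<Theta>' c - \<Theta> c))\<bar> \<le> \<epsilon> * L2_set (\<lambda>c. \<Theta>' c - \<Theta> c) P"
    using G' \<epsilon> unfolding has_gradient_def by blast
  define t where "t = min \<delta> \<delta>' / 2"
  have t: "0 < t" "t < \<delta>" "t < \<delta>'" using \<delta>(1) \<delta>'(1) by (auto simp: t_def)
  define \<Theta>' where "\<Theta>' = fun_upd \<Theta> c (\<Theta> c + t)"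
  have out: "\<forall>c. c \<notin> P \<longrightarrow> \<Theta>' c = \<Theta> c" using c by (auto simp: \<Theta>'_def)
  have single: "(\<Sum>k\<in>P. f k * (\<Theta>' k - \<Theta> k)) = f c * t" for f
  proof -
    have "(\<Sum>k\<in>P. f k * (\<Theta>' k - \<Theta> k)) = (\<Sum>k\<in>{c}. f k * (\<Theta>' k - \<Theta> k))"
      using P c by (intro sum.mono_neutral_right) (auto simp: \<Theta>'_def)
    then show ?thesis by (simp add: \<Theta>'_def)
  qed
  have "L2_set (\<lambda>c. \<Theta>' c - \<Theta> c) P = sqrt (\<Sum>k\<in>P. (\<Theta>' k - \<Theta> k) * (\<Theta>' k - \<Theta> k))"
    by (simp add: L2_set_def power2_eq_square)
  also have "\<dots> = sqrt ((\<Theta>' c - \<Theta> c) * t)"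
    by (simp only: single)
  finally have n: "L2_set (\<lambda>c. \<Theta>' c - \<Theta> c) P = t" using t(1) by (simp add: \<Theta>'_def)
  have "\<bar>F \<Theta>' - F \<Theta> - G c * t\<bar> \<le> \<epsilon> * t" "\<bar>F \<Theta>' - F \<Theta> - G' c * t\<bar> \<le> \<epsilon> * t"
    using \<delta>(2)[of \<Theta>'] \<delta>'(2)[of \<Theta>'] out t by (simp_all add: n single)
  then have "\<bar>(G c - G' c) * t\<bar> \<le> 2 * \<epsilon> * t" by (simp add: left_diff_distrib)
  then have "\<bar>G c - G' c\<bar> \<le> 2 * \<epsilon>" using t(1) by (simp add: abs_mult)
  then show False using ne by (simp add: \<epsilon>_def)
qed

lemma gradient_eqI:
  assumes "finite P" "has_gradient P F \<Theta> G" "\<And>c. c \<notin> P \<Longrightarrow> G c = 0"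
  shows "gradient P F \<Theta> = G"
  unfolding gradient_def
proof (rule the_equality)
  fix G' assume "has_gradient P F \<Theta> G' \<and> (\<forall>c. c \<notin> P \<longrightarrow> G' c = 0)"
  then show "G' = G"
    using has_gradient_unique[OF assms(1), of F \<Theta> G' G] assms by (intro ext) metis
qed (use assms in auto)

lemma neuron_Outer: "neuron D L l \<Theta> (Outer 0) = \<Theta> (Outer l)"
  by (simp add: neuron_def aggregate_Outer)

definition preact :: "coord set \<Rightarrow> nat \<Rightarrow> (coord \<Rightarrow> real) \<Rightarrow> nat \<Rightarrow> params \<Rightarrow> real" where
  "preact C L a l \<Theta> = (\<Sum>c\<in>C. a c * aggregate L l c \<Theta>)"

text \<open>The network at one input and one point of the plane. Both enter only through the vector
  \<open>a\<close>, so every statement about gradients and limits is one about linear forms.\<close>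

definition net :: "coord set \<Rightarrow> nat \<Rightarrow> (coord \<Rightarrow> real) \<Rightarrow> params \<Rightarrow> real" where
  "net C L a \<Theta> = 1 / sqrt (real L) * (\<Sum>l<L. \<Theta> (Outer l) * max 0 (preact C L a l \<Theta>))"

text \<open>The factor \<open>1 / real L\<close> at inner coordinates combines the outer
  normalization with that of the pre-activation.\<close>

primrec net_gradient :: "coord set \<Rightarrow> nat \<Rightarrow> (coord \<Rightarrow> real) \<Rightarrow> params \<Rightarrow> coord \<Rightarrow> real" where
  "net_gradient C L a \<Theta> (Outer l) = max 0 (preact C L a l \<Theta>) / sqrt (real L)"
| "net_gradient C L a \<Theta> (Inner1 l j \<nu> p) =
    \<Theta> (Outer l) * of_bool (0 < preact C L a l \<Theta>) * a (Inner1 0 0 \<nu> p) / real L"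
| "net_gradient C L a \<Theta> (Inner2 l j km p) =
    \<Theta> (Outer l) * of_bool (0 < preact C L a l \<Theta>) * a (Inner2 0 0 km p) / real L"

lemma net_gradient_place:
  "c \<in> templates D \<Longrightarrow> net_gradient C L a \<Theta> (place l j c) =
    \<Theta> (Outer l) * of_bool (0 < preact C L a l \<Theta>) * a c / real L"
  by (auto simp: templates_def)

lemma preact_eq_sum:
  "preact (templates D) L a l \<Theta> = (\<Sum>j<L. \<Sum>c\<in>templates D. a c * \<Theta> (place l j c)) / sqrt (real L)"
proof -
  have "preact (templates D) L a l \<Theta> = (\<Sum>c\<in>templates D. (\<Sum>j<L. a c * \<Theta> (place l j c)) / sqrt (real L))"
    unfolding preact_def by (intro sum.cong refl) (simp add: aggregate_template sum_distrib_left)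
  then show ?thesis by (subst sum.swap) (simp add: sum_divide_distrib)
qed

lemma preact_diff:
  "preact C L a l \<Theta>' - preact C L a l \<Theta> = preact C L a l (\<lambda>k. \<Theta>' k - \<Theta> k)"
  by (simp add: preact_def aggregate_def sum_subtractf diff_divide_distrib right_diff_distrib)

text \<open>Away from the kinks, a small increment changes the sign of no pre-activation, so every
  ramp is affine there. What is left is the product of the increments of an outer weight and a
  pre-activation, which is of second order.\<close>

lemma has_gradient_net:
  assumes fin: "finite (templates D)" and L: "0 < L"
    and nz: "\<And>l. l < L \<Longrightarrow> preact (templates D) L a l \<Theta> \<noteq> 0"
  shows "has_gradient (coords D L) (net (templates D) L a) \<Theta> (net_gradient (templates D) L a \<Theta>)"
  unfolding has_gradient_def
proof (intro allI impI)
  let ?C = "templates D" and ?P = "coords D L"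
  let ?u = "preact (templates D) L a"
  fix \<epsilon> :: real assume \<epsilon>: "0 < \<epsilon>"
  define A where "A = real L * (\<Sum>c\<in>?C. \<bar>a c\<bar>)"
  have A0: "0 \<le> A" by (simp add: A_def sum_nonneg)
  define m where "m = Min ((\<lambda>l. \<bar>?u l \<Theta>\<bar>) ` {..<L})"
  have m0: "0 < m" unfolding m_def using nz L by (subst Min_gr_iff) auto
  have m_le: "m \<le> \<bar>?u l \<Theta>\<bar>" if "l < L" for l using that by (auto simp: m_def)
  \<comment> \<open>The first bound keeps the change \<open>A * d\<close> of every pre-activation
    below the smallest modulus \<open>m\<close>; the second turns the remainder
    \<open>real L * A * d * d\<close> into at most \<open>\<epsilon> * d\<close>.\<close>
  define \<delta> where "\<delta> = min (m / (A + 1)) (\<epsilon> / (real L * A + 1))"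
  have \<delta>0: "0 < \<delta>" using m0 \<epsilon> A0 by (auto simp: \<delta>_def intro!: divide_pos_pos add_nonneg_pos)
  show "\<exists>\<delta>>0. \<forall>\<Theta>'. (\<forall>c. c \<notin> ?P \<longrightarrow> \<Theta>' c = \<Theta> c) \<and> L2_set (\<lambda>c. \<Theta>' c - \<Theta> c) ?P < \<delta> \<longrightarrow>
      \<bar>net ?C L a \<Theta>' - net ?C L a \<Theta> - (\<Sum>c\<in>?P. net_gradient ?C L a \<Theta> c * (\<Theta>' c - \<Theta> c))\<bar>
        \<le> \<epsilon> * L2_set (\<lambda>c. \<Theta>' c - \<Theta> c) ?P"
  proof (intro exI conjI allI impI, rule \<delta>0, elim conjE)
    fix \<Theta>' assume small: "L2_set (\<lambda>c. \<Theta>' c - \<Theta> c) ?P < \<delta>"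
    define h where "h k = \<Theta>' k - \<Theta> k" for k
    define d where "d = L2_set h ?P"
    have d: "0 \<le> d" "d < \<delta>" using small by (simp_all add: d_def h_def[abs_def])
    have coord_le: "\<bar>h k\<bar> \<le> d" if "k \<in> ?P" for k
      using member_le_L2_set[OF finite_coords[OF fin] that, of "\<lambda>k. \<bar>h k\<bar>"]
      by (simp add: d_def L2_set_def)
    have sqrtL: "1 \<le> sqrt (real L)" using L by simp
    have u_le: "\<bar>?u l h\<bar> \<le> A * d" if l: "l < L" for l
    proof -
      have "\<bar>\<Sum>j<L. \<Sum>c\<in>?C. a c * h (place l j c)\<bar> \<le> (\<Sum>j<L. \<Sum>c\<in>?C. \<bar>a c\<bar> * d)"
      proof (intro order_trans[OF sum_abs] sum_mono)
        fix j c assume "j \<in> {..<L}" "c \<in> ?C"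
        then have "place l j c \<in> ?P" using l by (force simp: coords_eq)
        then show "\<bar>a c * h (place l j c)\<bar> \<le> \<bar>a c\<bar> * d"
          by (simp add: abs_mult coord_le mult_left_mono)
      qed
      also have "\<dots> = A * d" by (simp add: A_def sum_distrib_right)
      finally have "\<bar>\<Sum>j<L. \<Sum>c\<in>?C. a c * h (place l j c)\<bar> \<le> A * d" .
      moreover have "\<bar>?u l h\<bar> \<le> \<bar>\<Sum>j<L. \<Sum>c\<in>?C. a c * h (place l j c)\<bar>"
        unfolding preact_eq_sum abs_divide
        using divide_left_mono[of 1 "sqrt (real L)" "\<bar>\<Sum>j<L. \<Sum>c\<in>?C. a c * h (place l j c)\<bar>"] sqrtL
        by simp
      ultimately show ?thesis by linarith
    qed
    define H where "H l = (of_bool (0 < ?u l \<Theta>) :: real)" for l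
    have ramp: "max 0 (?u l \<Theta>') = max 0 (?u l \<Theta>) + H l * ?u l h" if l: "l < L" for l
    proof -
      have u': "?u l \<Theta>' = ?u l \<Theta> + ?u l h"
        using preact_diff[of ?C L a l \<Theta>' \<Theta>] by (simp add: h_def[abs_def])
      have "A * d \<le> (A + 1) * d" using d by (simp add: distrib_right)
      also have "\<dots> \<le> (A + 1) * \<delta>" using d A0 by (intro mult_left_mono) auto
      also have "(A + 1) * \<delta> \<le> (A + 1) * (m / (A + 1))"
        using A0 by (intro mult_left_mono) (auto simp: \<delta>_def)
      also have "\<dots> = m" using A0 by simp
      finally have "\<bar>?u l h\<bar> \<le> \<bar>?u l \<Theta>\<bar>" using u_le[OF l] m_le[OF l] by linarith
      then show ?thesis using nz[OF l] by (auto simp: u' H_def max_def)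
    qed
    have inner: "(\<Sum>j<L. \<Sum>c\<in>?C. net_gradient ?C L a \<Theta> (place l j c) * h (place l j c))
        = \<Theta> (Outer l) * H l * ?u l h / sqrt (real L)" for l
    proof -
      have "(\<Sum>j<L. \<Sum>c\<in>?C. net_gradient ?C L a \<Theta> (place l j c) * h (place l j c))
          = (\<Sum>j<L. \<Sum>c\<in>?C. (\<Theta> (Outer l) * H l / real L) * (a c * h (place l j c)))"
        by (intro sum.cong refl) (simp add: net_gradient_place H_def)
      also have "\<dots> = (\<Theta> (Outer l) * H l / real L) * (?u l h * sqrt (real L))"
        using L by (simp add: preact_eq_sum sum_distrib_left)
      also have "\<dots> = \<Theta> (Outer l) * H l * ?u l h / sqrt (real L)"
        using L by (simp add: field_simps flip: real_sqrt_mult)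
      finally show ?thesis .
    qed
    have "net ?C L a \<Theta>' - net ?C L a \<Theta> - (\<Sum>c\<in>?P. net_gradient ?C L a \<Theta> c * h c)
        = (\<Sum>l<L. \<Theta>' (Outer l) * max 0 (?u l \<Theta>') / sqrt (real L) - \<Theta> (Outer l) * max 0 (?u l \<Theta>) / sqrt (real L)
            - (max 0 (?u l \<Theta>) / sqrt (real L) * h (Outer l) + \<Theta> (Outer l) * H l * ?u l h / sqrt (real L)))"
      by (simp add: sum_coords[OF fin] inner net_def sum_subtractf sum.distrib sum_divide_distrib)
    \<comment> \<open>All terms of first order cancel against the gradient; a product of two
      increments survives.\<close>
    also have "\<dots> = (\<Sum>l<L. h (Outer l) * H l * ?u l h / sqrt (real L))"
      by (intro sum.cong refl) (simp add: ramp h_def algebra_simps flip: add_divide_distrib diff_divide_distrib)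
    also have "\<bar>\<dots>\<bar> \<le> (\<Sum>l<L. d * (A * d))"
    proof (intro order_trans[OF sum_abs] sum_mono)
      fix l assume "l \<in> {..<L}"
      then have l: "l < L" by simp
      then have "Outer l \<in> ?P" by (auto simp: coords_eq)
      then have *: "\<bar>h (Outer l)\<bar> * \<bar>?u l h\<bar> \<le> d * (A * d)"
        using u_le[OF l] d by (intro mult_mono coord_le) auto
      have "\<bar>h (Outer l) * H l * ?u l h / sqrt (real L)\<bar> \<le> \<bar>h (Outer l) * H l * ?u l h\<bar> / 1"
        unfolding abs_divide using sqrtL by (intro divide_left_mono) auto
      also have "\<dots> \<le> \<bar>h (Outer l)\<bar> * \<bar>?u l h\<bar>" by (simp add: H_def abs_mult)
      finally show "\<bar>h (Outer l) * H l * ?u l h / sqrt (real L)\<bar> \<le> d * (A * d)" using * by linarith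
    qed
    also have "\<dots> = (real L * A * d) * d" by (simp add: mult_ac)
    also have "\<dots> \<le> \<epsilon> * d"
    proof (rule mult_right_mono[OF _ d(1)])
      have "real L * A * d \<le> (real L * A + 1) * d" using d by (simp add: distrib_right)
      also have "\<dots> \<le> (real L * A + 1) * \<delta>" using d A0 by (intro mult_left_mono) auto
      also have "\<dots> \<le> (real L * A + 1) * (\<epsilon> / (real L * A + 1))"
        using A0 by (intro mult_left_mono) (auto simp: \<delta>_def)
      also have "\<dots> = \<epsilon>" using mult_nonneg_nonneg[OF of_nat_0_le_iff[of L] A0] by auto
      finally show "real L * A * d \<le> \<epsilon>" .
    qed
    finally show "\<bar>net ?C L a \<Theta>' - net ?C L a \<Theta> - (\<Sum>c\<in>?P. net_gradient ?C L a \<Theta> c * (\<Theta>' c - \<Theta> c))\<bar>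
        \<le> \<epsilon> * L2_set (\<lambda>c. \<Theta>' c - \<Theta> c) ?P"
      by (simp add: h_def[abs_def] d_def)
  qed
qed

text \<open>Each of the \<open>L\<close> inner copies contributes with weight
  \<open>1 / (real L * real L)\<close>, so a whole neuron has weight \<open>1 / real L\<close> and
  the empirical kernel is an average over the neurons.\<close>

lemma sum_gradient_net_eq:
  assumes fin: "finite (templates D)" and L: "0 < L"
    and nz: "\<And>l. l < L \<Longrightarrow> preact (templates D) L a l \<Theta> \<noteq> 0"
      "\<And>l. l < L \<Longrightarrow> preact (templates D) L a' l \<Theta> \<noteq> 0"
  shows "(\<Sum>c\<in>coords D L. gradient (coords D L) (net (templates D) L a) \<Theta> c *
      gradient (coords D L) (net (templates D) L a') \<Theta> c)
    = (\<Sum>l<L. neuron_ntk (templates D) a a' (neuron D L l \<Theta>)) / real L"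
proof -
  let ?C = "templates D" and ?P = "coords D L"
  have grad: "gradient ?P (net ?C L a) \<Theta> k = net_gradient ?C L a \<Theta> k"
    if "k \<in> ?P" "\<And>l. l < L \<Longrightarrow> preact ?C L a l \<Theta> \<noteq> 0" for k a
  proof -
    \<comment> \<open>\<open>gradient\<close> selects the representative that vanishes outside the
      coordinate set, hence the truncation.\<close>
    define G where "G k = (if k \<in> ?P then net_gradient ?C L a \<Theta> k else 0)" for k
    have "has_gradient ?P (net ?C L a) \<Theta> G"
      using has_gradient_net[OF fin L that(2)] unfolding has_gradient_def G_def by simp
    then have "gradient ?P (net ?C L a) \<Theta> = G"
      by (rule gradient_eqI[OF finite_coords[OF fin]]) (simp add: G_def)
    then show ?thesis using that(1) by (simp add: G_def)
  qed
  have pre: "(\<Sum>c\<in>?C. a c * neuron D L l \<Theta> c) = preact ?C L a l \<Theta>" for a l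
    unfolding preact_def neuron_def by (intro sum.cong) auto
  have "(\<Sum>c\<in>?P. gradient ?P (net ?C L a) \<Theta> c * gradient ?P (net ?C L a') \<Theta> c)
      = (\<Sum>c\<in>?P. net_gradient ?C L a \<Theta> c * net_gradient ?C L a' \<Theta> c)"
    using grad nz by (intro sum.cong) auto
  also have "\<dots> = (\<Sum>l<L. neuron_ntk ?C a a' (neuron D L l \<Theta>) / real L)"
    unfolding sum_coords[OF fin] sum.distrib[symmetric]
  proof (rule sum.cong[OF refl])
    fix l
    define H where "H = (of_bool (0 < preact ?C L a l \<Theta>) * of_bool (0 < preact ?C L a' l \<Theta>) :: real)"
    have "(\<Sum>j<L. \<Sum>c\<in>?C. net_gradient ?C L a \<Theta> (place l j c) * net_gradient ?C L a' \<Theta> (place l j c))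
        = (\<Sum>j<L. \<Sum>c\<in>?C. ((\<Theta> (Outer l))\<^sup>2 * H / (real L * real L)) * (a c * a' c))"
      by (intro sum.cong refl) (simp add: net_gradient_place H_def power2_eq_square)
    also have "\<dots> = (\<Theta> (Outer l))\<^sup>2 * ((\<Sum>c\<in>?C. a c * a' c) * H) / real L"
      using L by (simp only: sum_distrib_left[symmetric] sum_constant card_lessThan) (simp add: field_simps)
    finally show "net_gradient ?C L a \<Theta> (Outer l) * net_gradient ?C L a' \<Theta> (Outer l) +
        (\<Sum>j<L. \<Sum>c\<in>?C. net_gradient ?C L a \<Theta> (place l j c) * net_gradient ?C L a' \<Theta> (place l j c))
        = neuron_ntk ?C a a' (neuron D L l \<Theta>) / real L"
      by (simp add: neuron_ntk_def pre H_def add_divide_distrib neuron_Outer)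
  qed
  finally show ?thesis by (simp add: sum_divide_distrib)
qed

section \<open>The limiting kernel\<close>

lemma AE_preact_neq_0:
  assumes fin: "finite (templates D)" and l: "l < L" and a: "c0 \<in> templates D" "a c0 \<noteq> 0"
  shows "AE \<Theta> in init_law D L. preact (templates D) L a l \<Theta> \<noteq> 0"
proof -
  let ?C = "insert (Outer 0) (templates D)"
  \<comment> \<open>The law of a neuron lives on the inner kinds together with
    \<open>Outer 0\<close>, so the form is extended by 0 to the outer weight.\<close>
  define b where "b c = (if c \<in> templates D then a c else 0)" for c
  have "AE y in gauss ?C. (\<Sum>c\<in>?C. b c * y c) \<noteq> 0"
    by (rule AE_gauss_linear_form_neq_0[of ?C c0 b]) (use fin a in \<open>auto simp: b_def\<close>)
  then have "AE y in distr (init_law D L) (gauss ?C) (neuron D L l). (\<Sum>c\<in>?C. b c * y c) \<noteq> 0"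
    by (subst distr_neuron[OF l])
  moreover have "neuron D L l \<in> measurable (init_law D L) (gauss ?C)"
    unfolding init_law_eq by (rule neuron_measurable) (rule block_subset_coords[OF _ l])
  ultimately have "AE \<Theta> in init_law D L. (\<Sum>c\<in>?C. b c * neuron D L l \<Theta> c) \<noteq> 0"
    by (rule AE_distrD[rotated])
  moreover have "(\<Sum>c\<in>?C. b c * neuron D L l \<Theta> c) = preact (templates D) L a l \<Theta>" for \<Theta>
    using fin Outer_notin_templates[of 0 D]
    by (auto simp: b_def preact_def neuron_def intro!: sum.cong)
  ultimately show ?thesis by simp
qed

text \<open>With a third of the distance as tolerance, the two deviation events cover the space,
  although each fits into an event of probability below one half. This uniqueness gives the definite
  description in \<open>limit_ntk\<close> its value.\<close>

lemma tendsto_in_prob_unique: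
  assumes P: "\<And>L. prob_space (P L)"
    and k: "tendsto_in_prob P X k" and k': "tendsto_in_prob P X k'"
  shows "k = k'"
proof (rule ccontr)
  assume "k \<noteq> k'"
  define \<epsilon> where "\<epsilon> = \<bar>k - k'\<bar> / 3"
  have \<epsilon>: "0 < \<epsilon>" using \<open>k \<noteq> k'\<close> by (simp add: \<epsilon>_def)
  have half: "(0 :: real) < 1 / 2" by simp
  have "\<forall>\<^sub>F L in sequentially. \<exists>A\<in>sets (P L). {\<omega>\<in>space (P L). \<epsilon> < \<bar>X L \<omega> - k\<bar>} \<subseteq> A \<and> measure (P L) A < 1 / 2"
    "\<forall>\<^sub>F L in sequentially. \<exists>A\<in>sets (P L). {\<omega>\<in>space (P L). \<epsilon> < \<bar>X L \<omega> - k'\<bar>} \<subseteq> A \<and> measure (P L) A < 1 / 2"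
    using k k' \<epsilon> half unfolding tendsto_in_prob_def by blast+
  then have "\<forall>\<^sub>F L in sequentially. False"
  proof eventually_elim
    case (elim L)
    interpret prob_space "P L" by (rule P)
    obtain A A' where A: "A \<in> sets (P L)" "{\<omega>\<in>space (P L). \<epsilon> < \<bar>X L \<omega> - k\<bar>} \<subseteq> A" "prob A < 1 / 2"
      and A': "A' \<in> sets (P L)" "{\<omega>\<in>space (P L). \<epsilon> < \<bar>X L \<omega> - k'\<bar>} \<subseteq> A'" "prob A' < 1 / 2"
      using elim by blast
    have "space (P L) \<subseteq> A \<union> A'"
    proof
      fix \<omega> assume \<omega>: "\<omega> \<in> space (P L)"
      have "\<epsilon> < \<bar>X L \<omega> - k\<bar> \<or> \<epsilon> < \<bar>X L \<omega> - k'\<bar>"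
      proof -
        have "\<bar>k - k'\<bar> \<le> \<bar>X L \<omega> - k\<bar> + \<bar>X L \<omega> - k'\<bar>" by arith
        moreover have "d / 3 < x \<or> d / 3 < y" if "d \<le> x + y" "0 < d / 3" for d x y :: real
          using that by auto
        ultimately show ?thesis using \<epsilon> unfolding \<epsilon>_def by blast
      qed
      then show "\<omega> \<in> A \<union> A'" using \<omega> A(2) A'(2) by blast
    qed
    then have "1 \<le> prob (A \<union> A')"
      using A(1) A'(1) by (metis finite_measure_mono prob_space sets.Un)
    also have "\<dots> \<le> prob A + prob A'" using A(1) A'(1) by (rule measure_Un_le)
    finally show False using A(3) A'(3) by simp
  qed
  then show False by simp
qed

text \<open>Outside the null set where some pre-activation vanishes, the empirical kernel is the
  mean of \<open>L\<close> independent copies of \<open>neuron_ntk\<close>, and the weak law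
  applies. A nonzero entry in each vector makes that set null.\<close>

lemma tendsto_in_prob_empirical_ntk:
  assumes fin: "finite (templates D)"
    and a: "c0 \<in> templates D" "a c0 \<noteq> 0" and a': "c1 \<in> templates D" "a' c1 \<noteq> 0"
  shows "tendsto_in_prob (init_law D)
    (\<lambda>L \<Theta>. \<Sum>c\<in>coords D L. gradient (coords D L) (net (templates D) L a) \<Theta> c *
      gradient (coords D L) (net (templates D) L a') \<Theta> c)
    (ntk_limit (templates D) a a')"
  unfolding tendsto_in_prob_def
proof (intro allI impI)
  let ?C = "templates D" and ?C' = "insert (Outer 0) (templates D)"
  fix \<epsilon> \<delta> :: real assume \<epsilon>: "0 < \<epsilon>" and \<delta>: "0 < \<delta>"
  define f where "f = neuron_ntk ?C a a'"
  define B where "B = (LINT y|gauss ?C'. (f y)\<^sup>2)"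
  have f_meas: "f \<in> borel_measurable (gauss ?C')" unfolding f_def by (rule neuron_ntk_measurable)
  have f_sq: "integrable (gauss ?C') (\<lambda>y. (f y)\<^sup>2)"
    unfolding f_def by (rule integrable_neuron_ntk_squared[OF fin])
  have f_mean: "(LINT y|gauss ?C'. f y) = ntk_limit ?C a a'"
    unfolding f_def by (rule integral_neuron_ntk[OF fin Outer_notin_templates])
  \<comment> \<open>From this width on, the Chebyshev bound
    \<open>B / (real L * \<epsilon>\<^sup>2)\<close> is below \<open>\<delta>\<close>.\<close>
  obtain L0 :: nat where L0: "B / (\<delta> * \<epsilon>\<^sup>2) < real L0" using reals_Archimedean2 by blast
  show "\<forall>\<^sub>F L in sequentially. \<exists>A\<in>sets (init_law D L).
      {\<Theta> \<in> space (init_law D L). \<epsilon> < \<bar>(\<Sum>c\<in>coords D L. gradient (coords D L) (net ?C L a) \<Theta> c *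
        gradient (coords D L) (net ?C L a') \<Theta> c) - ntk_limit ?C a a'\<bar>} \<subseteq> A \<and>
      measure (init_law D L) A < \<delta>"
    using eventually_ge_at_top[of "max 1 L0"]
  proof eventually_elim
    case (elim L)
    then have L: "0 < L" "L0 \<le> L" by auto
    interpret prob_space "init_law D L" by (rule prob_space_init_law)
    have nm: "neuron D L l \<in> measurable (init_law D L) (gauss ?C')" if "l < L" for l
      unfolding init_law_eq by (rule neuron_measurable) (rule block_subset_coords[OF _ that])
    have transfer: "integral\<^sup>L (init_law D L) (\<lambda>\<Theta>. g (neuron D L l \<Theta>)) = integral\<^sup>L (gauss ?C') g"
      if "l < L" "g \<in> borel_measurable (gauss ?C')" for l and g :: "params \<Rightarrow> real"
      using integral_distr[OF nm[OF that(1)] that(2)] distr_neuron[OF that(1), of D] by simp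
    define dev where "dev = {\<Theta> \<in> space (init_law D L).
      \<epsilon> < \<bar>(\<Sum>l<L. f (neuron D L l \<Theta>)) / real L - ntk_limit ?C a a'\<bar>}"
    have fn[measurable]: "(\<lambda>\<Theta>. f (neuron D L l \<Theta>)) \<in> borel_measurable (init_law D L)" if "l < L" for l
      by (rule measurable_compose[OF nm[OF that] f_meas])
    have dev_sets: "dev \<in> sets (init_law D L)" unfolding dev_def by measurable
    have "prob dev \<le> B / (real L * \<epsilon>\<^sup>2)"
      unfolding dev_def
    proof (rule weak_law_of_large_numbers[OF _ L(1)])
      show "indep_vars (\<lambda>_. borel) (\<lambda>l \<Theta>. f (neuron D L l \<Theta>)) {..<L}"
        by (rule indep_vars_neuron_functions[OF f_meas])
      fix l assume l: "l < L"
      have "integrable (distr (init_law D L) (gauss ?C') (neuron D L l)) (\<lambda>y. (f y)\<^sup>2)"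
        using f_sq by (simp add: distr_neuron[OF l])
      then show "integrable (init_law D L) (\<lambda>\<Theta>. (f (neuron D L l \<Theta>))\<^sup>2)"
        by (subst (asm) integrable_distr_eq[OF nm[OF l]]) (use f_meas in auto)
      show "expectation (\<lambda>\<Theta>. f (neuron D L l \<Theta>)) = ntk_limit ?C a a'"
        using transfer[OF l f_meas] f_mean by simp
      show "expectation (\<lambda>\<Theta>. (f (neuron D L l \<Theta>))\<^sup>2) \<le> B"
        using transfer[OF l, of "\<lambda>y. (f y)\<^sup>2"] f_meas by (simp add: B_def)
    qed (rule \<epsilon>)
    also have "\<dots> < \<delta>"
    proof -
      have "B / (\<delta> * \<epsilon>\<^sup>2) < real L" using L0 L(2) by simp
      then show ?thesis using L(1) \<epsilon> \<delta> by (simp add: field_simps)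
    qed
    finally have dev_small: "prob dev < \<delta>" .
    have "AE \<Theta> in init_law D L. \<forall>l\<in>{..<L}. preact ?C L a l \<Theta> \<noteq> 0 \<and> preact ?C L a' l \<Theta> \<noteq> 0"
      using AE_preact_neq_0[where a = a, OF fin _ a] AE_preact_neq_0[where a = a', OF fin _ a']
      by (intro AE_finite_allI AE_conjI) auto
    then obtain N where N: "N \<in> null_sets (init_law D L)"
      "{\<Theta> \<in> space (init_law D L). \<not> (\<forall>l\<in>{..<L}. preact ?C L a l \<Theta> \<noteq> 0 \<and> preact ?C L a' l \<Theta> \<noteq> 0)} \<subseteq> N"
      unfolding eventually_ae_filter by blast
    \<comment> \<open>The gradients are uncontrolled on \<open>N\<close>, so the deviation event is
      enclosed in a measurable one: the deviation of the average together with
      \<open>N\<close>.\<close>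
    show ?case
    proof (intro bexI[of _ "dev \<union> N"] conjI)
      show "dev \<union> N \<in> sets (init_law D L)" using dev_sets N(1) by auto
      show "prob (dev \<union> N) < \<delta>" using dev_small dev_sets N(1) by (simp add: measure_Un_null_set)
      show "{\<Theta> \<in> space (init_law D L). \<epsilon> < \<bar>(\<Sum>c\<in>coords D L. gradient (coords D L) (net ?C L a) \<Theta> c *
          gradient (coords D L) (net ?C L a') \<Theta> c) - ntk_limit ?C a a'\<bar>} \<subseteq> dev \<union> N"
      proof
        fix \<Theta> assume \<Theta>: "\<Theta> \<in> {\<Theta> \<in> space (init_law D L). \<epsilon> < \<bar>(\<Sum>c\<in>coords D L.
          gradient (coords D L) (net ?C L a) \<Theta> c * gradient (coords D L) (net ?C L a') \<Theta> c) -
          ntk_limit ?C a a'\<bar>}"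
        show "\<Theta> \<in> dev \<union> N"
        proof (cases "\<Theta> \<in> N")
          case False
          then have nz: "preact ?C L a l \<Theta> \<noteq> 0" "preact ?C L a' l \<Theta> \<noteq> 0" if "l < L" for l
            using N(2) \<Theta> that by auto
          show ?thesis
            using \<Theta> sum_gradient_net_eq[OF fin L(1) nz] by (simp add: dev_def f_def)
        qed simp
      qed
    qed
  qed
qed

section \<open>Plane waves and Fourier transforms\<close>

lemma wave_add_left: "wave (\<nu> + \<mu>) r = wave \<nu> r * wave \<mu> r"
  by (simp add: wave_def inner_add_left distrib_left distrib_right exp_add flip: exp_add)

lemma wave_add_right: "wave \<nu> (r + s) = wave \<nu> r * wave \<nu> s"
  by (simp add: wave_def inner_add_right distrib_left distrib_right exp_add flip: exp_add)

lemma wave_0 [simp]: "wave 0 r = 1" "wave \<nu> 0 = 1"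
  by (simp_all add: wave_def)

lemma wave_minus_left: "wave (- \<nu>) r = cnj (wave \<nu> r)"
  by (simp add: wave_def exp_cnj)

lemma wave_minus_right: "wave \<nu> (- r) = wave (- \<nu>) r"
  by (simp add: wave_def)

lemma norm_wave [simp]: "cmod (wave \<nu> r) = 1"
  by (simp add: wave_def norm_exp_eq_Re)

lemma continuous_on_wave: "continuous_on A (wave \<nu>)"
  unfolding wave_def[abs_def] by (intro continuous_intros)

lemma wave_measurable [measurable]: "wave \<nu> \<in> borel_measurable borel"
  by (rule borel_measurable_continuous_onI[OF continuous_on_wave])

lemma bounded_measurable_wave: "bounded_measurable lborel (wave \<nu>)"
  unfolding bounded_measurable_def by (auto intro: exI[of _ 1])

lemma fourier_eq: "fourier h \<nu> = (LINT r|lborel. complex_of_real (h r) * wave (- \<nu>) r)"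
  by (simp add: fourier_def wave_def)

lemma integrable_mult_wave:
  assumes "integrable lborel h"
  shows "integrable lborel (\<lambda>r. complex_of_real (h r) * wave \<nu> r)"
  by (rule integrable_mult_bounded_measurable[OF _ bounded_measurable_wave]) (use assms in simp)

lemma fourier_minus: "fourier h (- \<nu>) = cnj (fourier h \<nu>)"
proof -
  have "fourier h (- \<nu>) = (LINT r|lborel. cnj (complex_of_real (h r) * wave (- \<nu>) r))"
    by (simp add: fourier_eq wave_minus_left)
  also have "\<dots> = cnj (fourier h \<nu>)"
    unfolding fourier_eq[of h \<nu>] by (rule Bochner_Integration.integral_cnj)
  finally show ?thesis .
qed

lemma fourier_diff:
  assumes "integrable lborel f" "integrable lborel g"
  shows "fourier (\<lambda>r. f r - g r) \<nu> = fourier f \<nu> - fourier g \<nu>"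
  using integrable_mult_wave[OF assms(1)] integrable_mult_wave[OF assms(2)]
  by (simp add: fourier_eq left_diff_distrib)

text \<open>On the disc \<open>\<bar>h r\<bar>\<close> is at most 1 plus its square, and the disc
  has finite area.\<close>

lemma sq_integrable_supported_imp_integrable:
  assumes h: "sq_integrable h" and supp: "supported_in (Omega D) h"
  shows "integrable lborel h"
proof (rule Bochner_Integration.integrable_bound)
  have "Omega D = ball 0 (radius D)" by (auto simp: Omega_def)
  then have O: "emeasure lborel (Omega D) < \<infinity>" "Omega D \<in> sets lborel"
    using emeasure_bounded_finite[of "Omega D"] by auto
  show "integrable lborel (\<lambda>r. indicator (Omega D) r + (h r)\<^sup>2)"
    using O h by (intro Bochner_Integration.integrable_add integrable_real_indicator)
      (auto simp: sq_integrable_def)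
  show "h \<in> borel_measurable lborel" using h by (simp add: sq_integrable_def)
  have le: "\<bar>x\<bar> \<le> 1 + x\<^sup>2" for x :: real
    using zero_le_power2[of "\<bar>x\<bar> - 1"] by (simp add: power2_diff)
  show "AE r in lborel. norm (h r) \<le> norm (indicator (Omega D) r + (h r)\<^sup>2)"
    using supp unfolding supported_in_def
  proof eventually_elim
    case (elim r)
    then show ?case using le[of "h r"] by (cases "r \<in> Omega D") auto
  qed
qed

text \<open>Independence of characters: translating the relation by \<open>s\<close> and subtracting
  \<open>wave \<mu> s\<close> times the original eliminates \<open>\<mu>\<close> and multiplies the
  other coefficients by a difference that a suitable \<open>s\<close> makes nonzero.\<close>

lemma wave_linear_independent:
  assumes "finite A" "\<And>r. (\<Sum>\<nu>\<in>A. a \<nu> * wave \<nu> r) = 0" "\<nu> \<in> A"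
  shows "a \<nu> = 0"
  using assms
proof (induction A arbitrary: a \<nu> rule: finite_induct)
  case (insert \<mu> A)
  have A: "a \<nu> = 0" if "\<nu> \<in> A" for \<nu>
  proof -
    have zero: "a \<nu> * (wave \<nu> s - wave \<mu> s) = 0" for s
    proof (rule insert.IH[OF _ that])
      fix r
      have "(\<Sum>\<nu>\<in>A. a \<nu> * (wave \<nu> s - wave \<mu> s) * wave \<nu> r)
          = (\<Sum>\<nu>\<in>insert \<mu> A. a \<nu> * (wave \<nu> s - wave \<mu> s) * wave \<nu> r)"
        using insert.hyps by simp
      also have "\<dots> = (\<Sum>\<nu>\<in>insert \<mu> A. a \<nu> * wave \<nu> (r + s)) -
          wave \<mu> s * (\<Sum>\<nu>\<in>insert \<mu> A. a \<nu> * wave \<nu> r)"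
        by (simp only: wave_add_right sum_distrib_left sum_subtractf[symmetric])
          (simp add: algebra_simps)
      finally show "(\<Sum>\<nu>\<in>A. a \<nu> * (wave \<nu> s - wave \<mu> s) * wave \<nu> r) = 0"
        using insert.prems(1) by simp
    qed
    have "\<nu> \<noteq> \<mu>" using that insert.hyps by auto
    \<comment> \<open>Half a period in the direction of \<open>\<nu> - \<mu>\<close>: there the
      quotient of the two waves is - 1.\<close>
    define s where "s = (1 / (2 * ((\<nu> - \<mu>) \<bullet> (\<nu> - \<mu>)))) *\<^sub>R (\<nu> - \<mu>)"
    have "(\<nu> - \<mu>) \<bullet> s = 1 / 2" using \<open>\<nu> \<noteq> \<mu>\<close> by (simp add: s_def)
    then have "wave (\<nu> - \<mu>) s = exp (- (\<i> * complex_of_real pi))"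
      unfolding wave_def by (simp only:) simp
    then have "wave (\<nu> - \<mu>) s = - 1" by (simp add: exp_minus)
    moreover have "wave \<mu> s \<noteq> 0" by (metis norm_wave norm_zero zero_neq_one)
    ultimately have "wave \<nu> s \<noteq> wave \<mu> s"
      using wave_add_left[of "\<nu> - \<mu>" \<mu> s] by auto
    with zero[of s] show ?thesis by auto
  qed
  then have "a \<mu> * wave \<mu> 0 = 0" using insert.prems(1)[of 0] insert.hyps by simp
  then show ?case using A insert.prems(2) by auto
qed simp

lemma wave_coeff_eq:
  assumes A: "finite A" and h: "\<And>r. complex_of_real (h r) = (\<Sum>\<nu>\<in>A. a \<nu> * wave \<nu> r)"
  shows "wave_coeff h = (\<lambda>\<nu>. if \<nu> \<in> A then a \<nu> else 0)"
  unfolding wave_coeff_def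
proof (rule the_equality)
  let ?a = "\<lambda>\<nu>. if \<nu> \<in> A then a \<nu> else 0"
  have fin: "finite {\<nu>. ?a \<nu> \<noteq> 0}" by (rule finite_subset[OF _ A]) auto
  have sum: "complex_of_real (h r) = (\<Sum>\<nu> | ?a \<nu> \<noteq> 0. ?a \<nu> * wave \<nu> r)" for r
    unfolding h using A by (intro sum.mono_neutral_cong_right) auto
  show "finite {\<nu>. ?a \<nu> \<noteq> 0} \<and> (\<forall>r. complex_of_real (h r) = (\<Sum>\<nu> | ?a \<nu> \<noteq> 0. ?a \<nu> * wave \<nu> r))"
    using fin sum by blast
  fix b assume b: "finite {\<nu>. b \<nu> \<noteq> 0} \<and> (\<forall>r. complex_of_real (h r) = (\<Sum>\<nu> | b \<nu> \<noteq> 0. b \<nu> * wave \<nu> r))"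
  define U where "U = A \<union> {\<nu>. b \<nu> \<noteq> 0}"
  have U: "finite U" using A b by (simp add: U_def)
  have "(\<Sum>\<nu>\<in>U. (b \<nu> - ?a \<nu>) * wave \<nu> r) = 0" for r
  proof -
    have "(\<Sum>\<nu>\<in>U. b \<nu> * wave \<nu> r) = complex_of_real (h r)"
      using b U by (auto simp: U_def intro!: sum.mono_neutral_cong_right)
    moreover have "(\<Sum>\<nu>\<in>U. ?a \<nu> * wave \<nu> r) = complex_of_real (h r)"
      unfolding h using U by (intro sum.mono_neutral_cong_right) (auto simp: U_def)
    ultimately show ?thesis by (simp add: left_diff_distrib sum_subtractf)
  qed
  have "b \<nu> = ?a \<nu>" for \<nu>
    using wave_linear_independent[OF U \<open>\<And>r. (\<Sum>\<nu>\<in>U. (b \<nu> - ?a \<nu>) * wave \<nu> r) = 0\<close>, of \<nu>]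
    by (cases "\<nu> \<in> U") (auto simp: U_def)
  then show "b = ?a" by blast
qed

section \<open>Geometry of the frequency sets\<close>

lemma norm_plane: "norm (\<nu> :: plane) = cmod (Complex (\<nu> $ 1) (\<nu> $ 2))"
  by (simp add: norm_vec_def L2_set_def sum_2 complex_norm)

lemma arg2_bounds: "0 \<le> arg2 \<nu>" "arg2 \<nu> < 2 * pi"
  using Arg2pi[of "Complex (\<nu> $ 1) (\<nu> $ 2)"] by (auto simp: arg2_def)

lemma arg2_minus:
  assumes "\<nu> \<noteq> 0"
  shows "arg2 (- \<nu>) = (if arg2 \<nu> < pi then arg2 \<nu> + pi else arg2 \<nu> - pi)"
proof -
  have "Complex (\<nu> $ 1) (\<nu> $ 2) \<noteq> 0"
    using assms norm_plane[of \<nu>] by (metis norm_eq_zero)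
  from Arg2pi_minus[OF this] show ?thesis
    by (simp add: arg2_def complex_minus)
qed

lemma polar_plane_inject:
  assumes "norm \<nu> = norm \<mu>" "arg2 \<nu> = arg2 \<mu>"
  shows "\<nu> = \<mu>"
proof -
  have "Complex (\<nu> $ 1) (\<nu> $ 2) = Complex (\<mu> $ 1) (\<mu> $ 2)"
    using assms unfolding norm_plane arg2_def
    by (metis Arg2pi_eq)
  then show ?thesis by (simp add: vec_eq_iff forall_2)
qed

lemma finite_S_level: "finite (S_level D n)"
proof (rule finite_imageD[of arg2])
  have "arg2 ` S_level D n \<subseteq> (\<lambda>j. real j * pi / real (nangles D)) ` {..<2 * nangles D}"
    by (auto simp: S_level_def)
  then show "finite (arg2 ` S_level D n)" by (rule finite_subset) simp
  show "inj_on arg2 (S_level D n)"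
    by (auto simp: inj_on_def S_level_def intro: polar_plane_inject)
qed

lemma finite_S_all: "finite (S_all D)"
  by (simp add: S_all_def finite_S_level)

lemma S_level_subset_S_all: "n \<in> {1..nlevels D} \<Longrightarrow> S_level D n \<subseteq> S_all D"
  by (auto simp: S_all_def)

lemma freq_pos:
  assumes D: "valid_setup D" and n: "n \<in> {1..nlevels D}"
  shows "0 < freq D n"
proof (cases "n = 1")
  case False
  then have "freq D 1 < freq D n"
    using D n by (intro strict_mono_onD[of "{1..nlevels D}" "freq D"]) (auto simp: valid_setup_def)
  then show ?thesis using D by (simp add: valid_setup_def)
qed (use D in \<open>simp add: valid_setup_def\<close>)

lemma S_level_nonzero:
  assumes "valid_setup D" "n \<in> {1..nlevels D}" "\<nu> \<in> S_level D n"
  shows "\<nu> \<noteq> 0"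
  using freq_pos[OF assms(1,2)] assms(3) by (auto simp: S_level_def)

lemma S_level_minus:
  assumes D: "valid_setup D" and n: "n \<in> {1..nlevels D}" and \<nu>: "\<nu> \<in> S_level D n"
  shows "- \<nu> \<in> S_level D n"
proof -
  have N: "0 < nangles D" using D by (auto simp: valid_setup_def)
  obtain j where j: "arg2 \<nu> = real j * pi / real (nangles D)" "j < 2 * nangles D"
    using \<nu> by (auto simp: S_level_def)
  have lt: "arg2 \<nu> < pi \<longleftrightarrow> j < nangles D" using N by (simp add: j(1) field_simps)
  have "\<exists>j'<2 * nangles D. arg2 (- \<nu>) = real j' * pi / real (nangles D)"
  proof (cases "j < nangles D")
    case True
    then show ?thesis
      using N j lt arg2_minus[OF S_level_nonzero[OF D n \<nu>]]
      by (intro exI[of _ "j + nangles D"]) (simp add: field_simps)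
  next
    case False
    then have "arg2 (- \<nu>) = real j * pi / real (nangles D) - pi"
      using lt arg2_minus[OF S_level_nonzero[OF D n \<nu>]] j by simp
    also have "\<dots> = real (j - nangles D) * pi / real (nangles D)"
      using False N by (simp add: of_nat_diff left_diff_distrib diff_divide_distrib)
    finally show ?thesis using j by (intro exI[of _ "j - nangles D"]) auto
  qed
  then show ?thesis using \<nu> by (auto simp: S_level_def)
qed

lemma S_all_minus:
  assumes "valid_setup D" "\<nu> \<in> S_all D"
  shows "- \<nu> \<in> S_all D"
  using assms unfolding S_all_def by (blast intro: S_level_minus)

lemma S_all_nonzero:
  assumes "valid_setup D" "\<nu> \<in> S_all D"
  shows "\<nu> \<noteq> 0"
  using assms unfolding S_all_def by (blast dest: S_level_nonzero)

text \<open>Exactly one of two opposite frequencies carries the coordinates of their conjugate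
  pair.\<close>

lemma minus_upper_iff:
  assumes "\<nu> \<noteq> 0"
  shows "arg2 (- \<nu>) < pi \<longleftrightarrow> \<not> arg2 \<nu> < pi"
  using arg2_minus[OF assms] arg2_bounds[of \<nu>] by auto

lemma S_level_in_upper_cell:
  assumes D: "valid_setup D" and n: "n \<in> {1..nlevels D}" and \<nu>: "\<nu> \<in> S_level D n" "arg2 \<nu> < pi"
  shows "\<exists>km\<in>cell_indices D. 0 < fst km \<and> \<nu> \<in> cell D km"
proof -
  have N: "0 < nangles D" using D by (auto simp: valid_setup_def)
  obtain j where j: "arg2 \<nu> = real j * pi / real (nangles D)"
    using \<nu> by (auto simp: S_level_def)
  have lt: "j < nangles D" using N \<nu>(2) by (simp add: j(1) field_simps)
  have "band D n \<le> freq D n" "freq D n < band D (n + 1)" using D n by (auto simp: valid_setup_def)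
  \<comment> \<open>Sectors are numbered from 1 and closed on the left, so the angle with number
    \<open>j\<close> is the left end of sector \<open>j + 1\<close>.\<close>
  then have "\<nu> \<in> cell D (int n, int j + 1)"
    using \<nu> n N by (simp add: cell_def cell_pos_def S_level_def j nat_add_distrib divide_strict_right_mono)
  moreover have "(int n, int j + 1) \<in> cell_indices D" using n lt by (auto simp: cell_indices_def)
  ultimately show ?thesis using n by (intro bexI[of _ "(int n, int j + 1)"]) auto
qed

text \<open>A half-open sector contains one multiple of its own width, so a cell meets the
  frequencies of a level at most once. This is what makes the length of the coefficient vector
  independent of the position.\<close>

lemma S_level_upper_cell_unique:
  assumes D: "valid_setup D" and km: "0 < fst km"
    and \<nu>: "\<nu> \<in> S_level D n" "\<nu> \<in> cell D km" and \<mu>: "\<mu> \<in> S_level D n" "\<mu> \<in> cell D km"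
  shows "\<nu> = \<mu>"
proof -
  have N: "0 < real (nangles D)" using D by (auto simp: valid_setup_def)
  obtain k m where km_eq: "km = (k, m)" by (cases km)
  have index: "int j = m - 1" if "\<xi> \<in> cell D km" "arg2 \<xi> = real j * pi / real (nangles D)" for \<xi> j
  proof -
    have "of_int (m - 1) * pi \<le> real j * pi" "real j * pi < of_int m * pi"
      using that km N by (auto simp: km_eq cell_def cell_pos_def field_simps)
    then have "of_int (m - 1) \<le> real j" "real j < of_int m" by (simp_all add: mult_le_cancel_right)
    then show ?thesis by linarith
  qed
  obtain j j' where "arg2 \<nu> = real j * pi / real (nangles D)" "arg2 \<mu> = real j' * pi / real (nangles D)"
    using \<nu>(1) \<mu>(1) by (auto simp: S_level_def)
  then have "arg2 \<nu> = arg2 \<mu>"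
    using index[OF \<nu>(2), of j] index[OF \<mu>(2), of j'] by simp
  then show ?thesis using \<nu>(1) \<mu>(1) by (intro polar_plane_inject) (auto simp: S_level_def)
qed

lemma cell_minus:
  assumes "k \<noteq> 0"
  shows "\<nu> \<in> cell D (- k, m) \<longleftrightarrow> - \<nu> \<in> cell D (k, m)"
  using assms by (auto simp: cell_def image_iff) (metis minus_minus)+

lemma finite_cell_indices: "finite (cell_indices D)"
proof (rule finite_subset)
  show "cell_indices D \<subseteq> {- int (nlevels D)..int (nlevels D)} \<times> {1..int (nangles D)}"
    by (auto simp: cell_indices_def)
qed simp

section \<open>Sums over conjugate pairs\<close>

abbreviation S_upper :: "setup_data \<Rightarrow> plane set" where
  "S_upper D \<equiv> {\<nu> \<in> S_all D. arg2 \<nu> < pi}"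

abbreviation cells_upper :: "setup_data \<Rightarrow> (int \<times> int) set" where
  "cells_upper D \<equiv> {km \<in> cell_indices D. 0 < fst km}"

lemma UNIV_part: "UNIV = {RePart, ImPart}"
  by (auto intro: part.exhaust)

lemma templates_eq:
  "templates D = (\<lambda>(\<nu>, p). Inner1 0 0 \<nu> p) ` (S_upper D \<times> UNIV) \<union>
    (\<lambda>(km, p). Inner2 0 0 km p) ` (cells_upper D \<times> UNIV)"
  unfolding templates_def by (auto simp: image_iff)

lemma finite_templates: "finite (templates D)"
  unfolding templates_eq UNIV_part
  by (intro finite_UnI finite_imageI finite_cartesian_product) (auto simp: finite_S_all finite_cell_indices)

lemma sum_templates:
  fixes f :: "coord \<Rightarrow> 'a :: comm_monoid_add"
  shows "(\<Sum>c\<in>templates D. f c) =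
    (\<Sum>\<nu>\<in>S_upper D. f (Inner1 0 0 \<nu> RePart) + f (Inner1 0 0 \<nu> ImPart)) +
    (\<Sum>km\<in>cells_upper D. f (Inner2 0 0 km RePart) + f (Inner2 0 0 km ImPart))"
proof -
  have "(\<Sum>c\<in>templates D. f c) = (\<Sum>c\<in>(\<lambda>(\<nu>, p). Inner1 0 0 \<nu> p) ` (S_upper D \<times> UNIV). f c) +
      (\<Sum>c\<in>(\<lambda>(km, p). Inner2 0 0 km p) ` (cells_upper D \<times> UNIV). f c)"
    unfolding templates_eq using finite_templates[of D]
    by (intro sum.union_disjoint) (auto simp: templates_eq)
  also have "(\<Sum>c\<in>(\<lambda>(\<nu>, p). Inner1 0 0 \<nu> p) ` (S_upper D \<times> UNIV). f c)
      = (\<Sum>\<nu>\<in>S_upper D. \<Sum>p\<in>UNIV. f (Inner1 0 0 \<nu> p))"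
    by (subst sum.reindex) (auto simp: inj_on_def sum.cartesian_product case_prod_beta')
  also have "(\<Sum>c\<in>(\<lambda>(km, p). Inner2 0 0 km p) ` (cells_upper D \<times> UNIV). f c)
      = (\<Sum>km\<in>cells_upper D. \<Sum>p\<in>UNIV. f (Inner2 0 0 km p))"
    by (subst sum.reindex) (auto simp: inj_on_def sum.cartesian_product case_prod_beta')
  finally show ?thesis by (simp add: UNIV_part)
qed

text \<open>The involution \<open>\<sigma>\<close> exchanges the two halves selected by
  \<open>p\<close> and conjugates the terms, so both halves have the same real part.\<close>

lemma Re_sum_conjugate_pairs:
  fixes z :: "'a \<Rightarrow> complex"
  assumes I: "finite I" and \<sigma>: "\<And>i. i \<in> I \<Longrightarrow> \<sigma> i \<in> I" "\<And>i. i \<in> I \<Longrightarrow> \<sigma> (\<sigma> i) = i"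
    and p: "\<And>i. i \<in> I \<Longrightarrow> p (\<sigma> i) \<longleftrightarrow> \<not> p i" and z: "\<And>i. i \<in> I \<Longrightarrow> z (\<sigma> i) = cnj (z i)"
  shows "Re (\<Sum>i\<in>I. z i) = 2 * (\<Sum>i | i \<in> I \<and> p i. Re (z i))"
proof -
  have "(\<Sum>i\<in>I. z i) = (\<Sum>i | i \<in> I \<and> p i. z i) + (\<Sum>i | i \<in> I \<and> \<not> p i. z i)"
    using I by (subst sum.union_disjoint[symmetric]) (auto intro: sum.cong)
  also have "(\<Sum>i | i \<in> I \<and> \<not> p i. z i) = (\<Sum>i | i \<in> I \<and> p i. cnj (z i))"
    by (rule sum.reindex_bij_witness[of _ \<sigma> \<sigma>]) (use \<sigma> p z in auto)
  finally show ?thesis by simp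
qed

section \<open>The pre-activations as linear forms\<close>

text \<open>The sign at \<open>ImPart\<close> is that of the second term in the real part of a
  product of complex numbers.\<close>

primrec part_of :: "part \<Rightarrow> complex \<Rightarrow> real" where
  "part_of RePart z = Re z"
| "part_of ImPart z = - Im z"

definition cell_part :: "setup_data \<Rightarrow> nat \<Rightarrow> nat \<Rightarrow> int \<times> int \<Rightarrow> plane \<Rightarrow> complex" where
  "cell_part D n i km r = (\<Sum>\<nu>\<in>S_level D n \<inter> cell D km. fourier (sample D i) \<nu> * wave \<nu> r)"

text \<open>The vector \<open>a\<close> of the overview, at the position \<open>r\<close>. The
  factor \<open>sqrt 2\<close> is the 2 of a conjugate pair divided by the \<open>sqrt 2\<close> in
  the real coordinates of \<open>Z\<close>.\<close>

primrec coeff_vec :: "setup_data \<Rightarrow> nat \<Rightarrow> nat \<Rightarrow> (plane \<Rightarrow> real) \<Rightarrow> plane \<Rightarrow> coord \<Rightarrow> real" where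
  "coeff_vec D n i g r (Outer l) = 0"
| "coeff_vec D n i g r (Inner1 l j \<nu> p) = sqrt 2 * amp D * part_of p (fourier g \<nu> * wave \<nu> r)"
| "coeff_vec D n i g r (Inner2 l j km p) = sqrt 2 * amp D * part_of p (cell_part D n i km r)"

lemma feature_eq:
  assumes D: "valid_setup D" and n: "n \<in> {1..nlevels D}"
  shows "complex_of_real (feature D n i r) = (\<Sum>\<nu>\<in>S_level D n. fourier (sample D i) \<nu> * wave \<nu> r)"
proof -
  have "cnj (\<Sum>\<nu>\<in>S_level D n. fourier (sample D i) \<nu> * wave \<nu> r)
      = (\<Sum>\<nu>\<in>S_level D n. fourier (sample D i) (- \<nu>) * wave (- \<nu>) r)"
    by (simp add: fourier_minus wave_minus_left)
  also have "\<dots> = (\<Sum>\<nu>\<in>S_level D n. fourier (sample D i) \<nu> * wave \<nu> r)"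
    by (rule sum.reindex_bij_witness[of _ uminus uminus]) (auto intro: S_level_minus[OF D n])
  finally have "(\<Sum>\<nu>\<in>S_level D n. fourier (sample D i) \<nu> * wave \<nu> r) \<in> \<real>"
    by (simp only: Reals_cnj_iff)
  then show ?thesis unfolding feature_def by (rule of_real_Re)
qed

lemma wave_coeff_feature:
  assumes D: "valid_setup D" and n: "n \<in> {1..nlevels D}"
  shows "wave_coeff (feature D n i) = (\<lambda>\<nu>. if \<nu> \<in> S_level D n then fourier (sample D i) \<nu> else 0)"
  by (rule wave_coeff_eq[OF finite_S_level feature_eq[OF D n]])

lemma conv2_feature:
  assumes D: "valid_setup D" and n: "n \<in> {1..nlevels D}"
  shows "conv2 D \<Theta> l j (feature D n i) r =
    Re (complex_of_real (amp D) * (\<Sum>km\<in>cell_indices D. Z2 \<Theta> l j km * cell_part D n i km r))"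
proof -
  have "(\<Sum>\<nu> | wave_coeff (feature D n i) \<nu> \<noteq> 0. wave_coeff (feature D n i) \<nu> * conv2_wave D \<Theta> l j \<nu> r)
      = (\<Sum>\<nu>\<in>S_level D n. fourier (sample D i) \<nu> * conv2_wave D \<Theta> l j \<nu> r)"
    unfolding wave_coeff_feature[OF D n]
    by (intro sum.mono_neutral_cong_left) (auto simp: finite_S_level)
  also have "\<dots> = complex_of_real (amp D) * (\<Sum>\<nu>\<in>S_level D n. \<Sum>km\<in>cell_indices D.
      Z2 \<Theta> l j km * (fourier (sample D i) \<nu> * indicator (cell D km) \<nu> * wave \<nu> r))"
    by (simp add: conv2_wave_def sum_distrib_left mult_ac)
  also have "(\<Sum>\<nu>\<in>S_level D n. \<Sum>km\<in>cell_indices D.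
      Z2 \<Theta> l j km * (fourier (sample D i) \<nu> * indicator (cell D km) \<nu> * wave \<nu> r))
      = (\<Sum>km\<in>cell_indices D. Z2 \<Theta> l j km *
          (\<Sum>\<nu>\<in>S_level D n. fourier (sample D i) \<nu> * indicator (cell D km) \<nu> * wave \<nu> r))"
    by (subst sum.swap) (simp add: sum_distrib_left)
  also have "\<dots> = (\<Sum>km\<in>cell_indices D. Z2 \<Theta> l j km * cell_part D n i km r)"
    unfolding cell_part_def sum.inter_restrict[OF finite_S_level]
    by (intro sum.cong refl arg_cong2[where f = "(*)"]) (auto simp: indicator_def)
  finally show ?thesis by (simp add: conv2_def)
qed

text \<open>Convolving a plane wave with \<open>g\<close> multiplies it by the transform of
  \<open>g\<close> at its frequency; the kernel is a finite sum of such waves.\<close>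

lemma conv1_eq:
  assumes g: "integrable lborel g"
  shows "conv1 D \<Theta> l j g r =
    Re (complex_of_real (amp D) * (\<Sum>\<nu>\<in>S_all D. Z1 \<Theta> l j \<nu> * (fourier g \<nu> * wave \<nu> r)))"
proof -
  let ?k = "\<lambda>\<nu>. complex_of_real (amp D) * Z1 \<Theta> l j \<nu> * wave \<nu> r"
  have int: "integrable lborel (\<lambda>s. ?k \<nu> * (complex_of_real (g s) * wave (- \<nu>) s))" for \<nu>
    by (intro integrable_mult_right integrable_mult_wave g)
  have split: "wave \<nu> (r - s) = wave \<nu> r * wave (- \<nu>) s" for \<nu> s
    using wave_add_right[of \<nu> r "- s"] by (simp add: wave_minus_right)
  have "kernel1 D \<Theta> l j (r - s) * g s = Re (\<Sum>\<nu>\<in>S_all D. ?k \<nu> * (complex_of_real (g s) * wave (- \<nu>) s))" for s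
  proof -
    have "(\<Sum>\<nu>\<in>S_all D. ?k \<nu> * (complex_of_real (g s) * wave (- \<nu>) s))
        = complex_of_real (g s) * (complex_of_real (amp D) * (\<Sum>\<nu>\<in>S_all D. Z1 \<Theta> l j \<nu> * wave \<nu> (r - s)))"
      by (simp add: split sum_distrib_left mult_ac)
    then show ?thesis by (simp add: kernel1_def mult_ac)
  qed
  then have "conv1 D \<Theta> l j g r = (LINT s|lborel. Re (\<Sum>\<nu>\<in>S_all D. ?k \<nu> * (complex_of_real (g s) * wave (- \<nu>) s)))"
    by (simp add: conv1_def)
  also have "\<dots> = Re (LINT s|lborel. (\<Sum>\<nu>\<in>S_all D. ?k \<nu> * (complex_of_real (g s) * wave (- \<nu>) s)))"
    by (rule integral_Re) (intro Bochner_Integration.integrable_sum int)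
  also have "(LINT s|lborel. (\<Sum>\<nu>\<in>S_all D. ?k \<nu> * (complex_of_real (g s) * wave (- \<nu>) s)))
      = (\<Sum>\<nu>\<in>S_all D. ?k \<nu> * fourier g \<nu>)"
    by (subst Bochner_Integration.integral_sum[OF int]) (simp add: fourier_eq)
  finally show ?thesis by (simp add: sum_distrib_left mult_ac)
qed

lemma Re_coordinate_mult:
  "2 * (A * Re (Complex x y / complex_of_real (sqrt 2) * w))
    = sqrt 2 * A * Re w * x + sqrt 2 * A * - Im w * y"
proof -
  have "Re (Complex x y / complex_of_real (sqrt 2) * w) = (x * Re w - y * Im w) / sqrt 2"
    by (simp add: diff_divide_distrib)
  moreover have "2 * (A * (t / sqrt 2)) = sqrt 2 * A * t" for t :: real
    by (simp add: field_simps)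
  ultimately have "2 * (A * Re (Complex x y / complex_of_real (sqrt 2) * w)) = sqrt 2 * A * (x * Re w - y * Im w)"
    by (simp only:)
  then show ?thesis by (simp only: algebra_simps)
qed

lemma Re_of_real_mult: "Re (complex_of_real a * z) = a * Re z"
  by simp

lemma cell_part_minus:
  assumes D: "valid_setup D" and n: "n \<in> {1..nlevels D}" and k: "k \<noteq> 0"
  shows "cell_part D n i (- k, m) r = cnj (cell_part D n i (k, m) r)"
  unfolding cell_part_def cnj_sum
  by (rule sum.reindex_bij_witness[of _ uminus uminus])
    (auto simp: cell_minus[OF k] fourier_minus wave_minus_left S_level_minus[OF D n])

text \<open>Both convolutions are sums over conjugate pairs, so each reduces to its upper half,
  where the coefficients are given directly by the real coordinates.\<close>

lemma conv_eq_linear_form: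
  assumes D: "valid_setup D" and n: "n \<in> {1..nlevels D}" and g: "integrable lborel g"
  shows "conv1 D \<Theta> l j g r + conv2 D \<Theta> l j (feature D n i) r
    = (\<Sum>c\<in>templates D. coeff_vec D n i g r c * \<Theta> (place l j c))"
proof -
  let ?A = "amp D"
  have "Re (\<Sum>\<nu>\<in>S_all D. Z1 \<Theta> l j \<nu> * (fourier g \<nu> * wave \<nu> r))
      = 2 * (\<Sum>\<nu>\<in>S_upper D. Re (Z1 \<Theta> l j \<nu> * (fourier g \<nu> * wave \<nu> r)))"
  proof (rule Re_sum_conjugate_pairs[where \<sigma> = uminus, OF finite_S_all])
    fix \<nu> assume \<nu>: "\<nu> \<in> S_all D"
    show "- \<nu> \<in> S_all D" by (rule S_all_minus[OF D \<nu>])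
    show up: "arg2 (- \<nu>) < pi \<longleftrightarrow> \<not> arg2 \<nu> < pi"
      by (rule minus_upper_iff[OF S_all_nonzero[OF D \<nu>]])
    have "Z1 \<Theta> l j (- \<nu>) = cnj (Z1 \<Theta> l j \<nu>)"
      using up by (cases "arg2 \<nu> < pi") (simp_all add: Z1_def Let_def)
    then show "Z1 \<Theta> l j (- \<nu>) * (fourier g (- \<nu>) * wave (- \<nu>) r)
        = cnj (Z1 \<Theta> l j \<nu> * (fourier g \<nu> * wave \<nu> r))"
      by (simp add: fourier_minus wave_minus_left)
  qed simp
  then have c1: "conv1 D \<Theta> l j g r = (\<Sum>\<nu>\<in>S_upper D. 2 * (?A * Re (Z1 \<Theta> l j \<nu> * (fourier g \<nu> * wave \<nu> r))))"
    unfolding conv1_eq[OF g] Re_of_real_mult by (simp only: sum_distrib_left mult_ac)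
  have "Re (\<Sum>km\<in>cell_indices D. Z2 \<Theta> l j km * cell_part D n i km r)
      = 2 * (\<Sum>km\<in>cells_upper D. Re (Z2 \<Theta> l j km * cell_part D n i km r))"
  proof (rule Re_sum_conjugate_pairs[where \<sigma> = "\<lambda>(k, m). (- k, m)", OF finite_cell_indices])
    fix km assume "km \<in> cell_indices D"
    moreover obtain k m where km: "km = (k, m)" by (cases km)
    ultimately have ci: "(k, m) \<in> cell_indices D" and k: "k \<noteq> 0" by (auto simp: cell_indices_def)
    show "(case km of (k, m) \<Rightarrow> (- k, m)) \<in> cell_indices D"
      using ci by (auto simp: km cell_indices_def)
    show "0 < fst (case km of (k, m) \<Rightarrow> (- k, m)) \<longleftrightarrow> \<not> 0 < fst km" using k by (auto simp: km)
    have "Z2 \<Theta> l j (- k, m) = cnj (Z2 \<Theta> l j (k, m))"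
      using k by (cases "0 < k") (simp_all add: Z2_def Let_def)
    then show "Z2 \<Theta> l j (case km of (k, m) \<Rightarrow> (- k, m)) * cell_part D n i (case km of (k, m) \<Rightarrow> (- k, m)) r
        = cnj (Z2 \<Theta> l j km * cell_part D n i km r)"
      by (simp add: km cell_part_minus[OF D n k])
  qed (auto split: prod.split)
  then have c2: "conv2 D \<Theta> l j (feature D n i) r =
      (\<Sum>km\<in>cells_upper D. 2 * (?A * Re (Z2 \<Theta> l j km * cell_part D n i km r)))"
    unfolding conv2_feature[OF D n] Re_of_real_mult by (simp only: sum_distrib_left mult_ac)
  have z1: "2 * (?A * Re (Z1 \<Theta> l j \<nu> * (fourier g \<nu> * wave \<nu> r))) =
      coeff_vec D n i g r (Inner1 0 0 \<nu> RePart) * \<Theta> (place l j (Inner1 0 0 \<nu> RePart)) +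
      coeff_vec D n i g r (Inner1 0 0 \<nu> ImPart) * \<Theta> (place l j (Inner1 0 0 \<nu> ImPart))"
    if "arg2 \<nu> < pi" for \<nu>
  proof -
    have "Z1 \<Theta> l j \<nu> = Complex (\<Theta> (Inner1 l j \<nu> RePart)) (\<Theta> (Inner1 l j \<nu> ImPart)) / complex_of_real (sqrt 2)"
      using that by (simp add: Z1_def Let_def)
    then show ?thesis by (simp only: Re_coordinate_mult coeff_vec.simps part_of.simps place.simps)
  qed
  have z2: "2 * (?A * Re (Z2 \<Theta> l j km * cell_part D n i km r)) =
      coeff_vec D n i g r (Inner2 0 0 km RePart) * \<Theta> (place l j (Inner2 0 0 km RePart)) +
      coeff_vec D n i g r (Inner2 0 0 km ImPart) * \<Theta> (place l j (Inner2 0 0 km ImPart))"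
    if "0 < fst km" for km
  proof -
    have "Z2 \<Theta> l j km = Complex (\<Theta> (Inner2 l j km RePart)) (\<Theta> (Inner2 l j km ImPart)) / complex_of_real (sqrt 2)"
      using that by (cases km) (simp add: Z2_def Let_def)
    then show ?thesis by (simp only: Re_coordinate_mult coeff_vec.simps part_of.simps place.simps)
  qed
  show ?thesis
    unfolding c1 c2 sum_templates
    by (intro arg_cong2[where f = "(+)"] sum.cong refl z1 z2) simp_all
qed

lemma network_eq_net:
  assumes D: "valid_setup D" and n: "n \<in> {1..nlevels D}" and g: "integrable lborel g"
  shows "network D L \<Theta> (g, feature D n i) r = net (templates D) L (coeff_vec D n i g r) \<Theta>"
proof -
  have "1 / sqrt (real L) * (\<Sum>j<L. conv1 D \<Theta> l j g r + conv2 D \<Theta> l j (feature D n i) r)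
      = preact (templates D) L (coeff_vec D n i g r) l \<Theta>" for l
    unfolding preact_eq_sum conv_eq_linear_form[OF D n g] by simp
  then show ?thesis by (simp only: network_def net_def fst_conv snd_conv)
qed

lemma S_level_Int_cell:
  assumes D: "valid_setup D" and km: "0 < fst km" and \<nu>: "\<nu> \<in> S_level D n" "\<nu> \<in> cell D km"
  shows "S_level D n \<inter> cell D km = {\<nu>}"
  using S_level_upper_cell_unique[OF D km _ _ \<nu>] \<nu> by blast

text \<open>The cell contributes at most one plane wave; a sum of several would have a modulus that
  varies with \<open>r\<close>.\<close>

lemma norm_cell_part:
  assumes D: "valid_setup D" and km: "0 < fst km"
  shows "cmod (cell_part D n i km r) = cmod (cell_part D n i km r')"
proof (cases "S_level D n \<inter> cell D km = {}")
  case False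
  then obtain \<nu> where "S_level D n \<inter> cell D km = {\<nu>}"
    using S_level_Int_cell[OF D km] by blast
  then show ?thesis by (simp add: cell_part_def norm_mult)
qed (simp add: cell_part_def)

text \<open>The squared length of the coefficient vector. The position 0 stands for all positions,
  by \<open>sum_squares_coeff_vec\<close>.\<close>

definition energy :: "setup_data \<Rightarrow> nat \<Rightarrow> nat \<Rightarrow> (plane \<Rightarrow> real) \<Rightarrow> real" where
  "energy D n i g = (\<Sum>c\<in>templates D. (coeff_vec D n i g 0 c)\<^sup>2)"

lemma sum_squares_coeff_vec:
  assumes D: "valid_setup D"
  shows "(\<Sum>c\<in>templates D. (coeff_vec D n i g r c)\<^sup>2) = energy D n i g"
proof -
  have "(\<Sum>c\<in>templates D. (coeff_vec D n i g r c)\<^sup>2) = 2 * (amp D)\<^sup>2 *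
      ((\<Sum>\<nu>\<in>S_upper D. (cmod (fourier g \<nu>))\<^sup>2) + (\<Sum>km\<in>cells_upper D. (cmod (cell_part D n i km r))\<^sup>2))"
    for r
  proof -
    have pair: "(sqrt 2 * amp D * Re z)\<^sup>2 + (sqrt 2 * amp D * - Im z)\<^sup>2 = 2 * (amp D)\<^sup>2 * (cmod z)\<^sup>2" for z
      unfolding cmod_power2 by (simp add: power_mult_distrib algebra_simps)
    show ?thesis
      unfolding sum_templates coeff_vec.simps part_of.simps pair
      by (simp add: norm_mult sum_distrib_left distrib_left)
  qed
  moreover have "(\<Sum>km\<in>cells_upper D. (cmod (cell_part D n i km r))\<^sup>2)
      = (\<Sum>km\<in>cells_upper D. (cmod (cell_part D n i km 0))\<^sup>2)"
    using norm_cell_part[OF D, of _ n i r 0] by (intro sum.cong) auto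
  ultimately show ?thesis unfolding energy_def by simp
qed

lemma abs_coeff_vec_le:
  assumes D: "valid_setup D" and c: "c \<in> templates D"
  shows "\<bar>coeff_vec D n i g r c\<bar> \<le> sqrt (energy D n i g)"
proof -
  have "(coeff_vec D n i g r c)\<^sup>2 \<le> energy D n i g"
    unfolding sum_squares_coeff_vec[OF D, of n i g r, symmetric]
    using c finite_templates by (intro member_le_sum) auto
  then show ?thesis by (simp add: real_le_rsqrt)
qed

lemma coeff_vec_measurable:
  "(\<lambda>r. coeff_vec D n i g r c) \<in> borel_measurable borel"
proof -
  have [measurable]: "(\<lambda>r. part_of p (f r)) \<in> borel_measurable borel" if "f \<in> borel_measurable borel"
    for p and f :: "plane \<Rightarrow> complex"
    using that by (cases p) auto
  have [measurable]: "cell_part D n i km \<in> borel_measurable borel" for km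
    unfolding cell_part_def[abs_def] by measurable
  show ?thesis by (cases c) simp_all
qed

lemma sum_two_deltas:
  fixes f :: "'c \<Rightarrow> 'b :: comm_semiring_0"
  assumes "finite C" "c1 \<in> C" "c2 \<in> C" "c1 \<noteq> c2"
  shows "(\<Sum>c\<in>C. f c * (if c = c1 then x else if c = c2 then y else 0)) = f c1 * x + f c2 * y"
proof -
  have "(\<Sum>c\<in>C. f c * (if c = c1 then x else if c = c2 then y else 0))
      = (\<Sum>c\<in>{c1, c2}. f c * (if c = c1 then x else if c = c2 then y else 0))"
    using assms by (intro sum.mono_neutral_right) auto
  then show ?thesis using assms by simp
qed

text \<open>Complex coefficients that rebuild \<open>z\<close> from its two real coordinates;
  \<open>- \<i>\<close> undoes the sign in \<open>part_of ImPart\<close>.\<close>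

definition from_parts :: "real \<Rightarrow> coord \<Rightarrow> coord \<Rightarrow> coord \<Rightarrow> complex" where
  "from_parts A c1 c2 c =
    (if c = c1 then 1 / complex_of_real (sqrt 2 * A)
     else if c = c2 then - \<i> / complex_of_real (sqrt 2 * A) else 0)"

lemma sum_from_parts:
  assumes A: "0 < A" and C: "finite C" "c1 \<in> C" "c2 \<in> C" "c1 \<noteq> c2"
    and a: "a c1 = sqrt 2 * A * part_of RePart z" "a c2 = sqrt 2 * A * part_of ImPart z"
  shows "z = (\<Sum>c\<in>C. complex_of_real (a c) * from_parts A c1 c2 c)"
proof -
  define k where "k = sqrt 2 * A"
  have k: "k \<noteq> 0" using A by (simp add: k_def)
  have "(\<Sum>c\<in>C. complex_of_real (a c) * from_parts A c1 c2 c)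
      = complex_of_real (a c1) * (1 / complex_of_real (sqrt 2 * A)) +
        complex_of_real (a c2) * (- \<i> / complex_of_real (sqrt 2 * A))"
    unfolding from_parts_def by (rule sum_two_deltas[OF C])
  also have "\<dots> = complex_of_real (Re z) + \<i> * complex_of_real (Im z)"
    unfolding a part_of.simps k_def[symmetric] using k by simp
  finally show ?thesis by (simp add: complex_eq)
qed

text \<open>The order of the quantifiers matters: one vector \<open>w\<close> serves all samples,
  inputs and positions, since polarization tests with the same vector everywhere. Lower frequencies
  follow by conjugation.\<close>

lemma linear_form_output:
  assumes D: "valid_setup D" and \<nu>: "\<nu> \<in> S_all D"
  shows "\<exists>w. \<forall>i g r. fourier g \<nu> * wave \<nu> r
    = (\<Sum>c\<in>templates D. complex_of_real (coeff_vec D n i g r c) * w c)"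
proof -
  have A: "0 < amp D" using D by (simp add: valid_setup_def)
  have upper: "\<exists>w. \<forall>i g r. fourier g \<nu> * wave \<nu> r
      = (\<Sum>c\<in>templates D. complex_of_real (coeff_vec D n i g r c) * w c)"
    if "\<nu> \<in> S_all D" "arg2 \<nu> < pi" for \<nu>
    using that
    by (intro exI[of _ "from_parts (amp D) (Inner1 0 0 \<nu> RePart) (Inner1 0 0 \<nu> ImPart)"] allI
        sum_from_parts[OF A finite_templates _ _ _ coeff_vec.simps(2) coeff_vec.simps(2)])
      (auto simp: templates_def)
  show ?thesis
  proof (cases "arg2 \<nu> < pi")
    case False
    then have "arg2 (- \<nu>) < pi" using minus_upper_iff[OF S_all_nonzero[OF D \<nu>]] by simp
    from upper[OF S_all_minus[OF D \<nu>] this] obtain w where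
      w: "\<And>i g r. fourier g (- \<nu>) * wave (- \<nu>) r
        = (\<Sum>c\<in>templates D. complex_of_real (coeff_vec D n i g r c) * w c)" by blast
    show ?thesis
    proof (intro exI[of _ "\<lambda>c. cnj (w c)"] allI)
      show "fourier g \<nu> * wave \<nu> r
          = (\<Sum>c\<in>templates D. complex_of_real (coeff_vec D n i g r c) * cnj (w c))" for i g r
        using arg_cong[OF w[of g r i], of cnj] by (simp add: fourier_minus wave_minus_left)
    qed
  qed (use upper[OF \<nu>] in blast)
qed

text \<open>The cell that contains \<open>\<nu>\<close> contains no other frequency of the level, so
  the coordinates of this cell isolate its plane wave.\<close>

lemma linear_form_sample:
  assumes D: "valid_setup D" and n: "n \<in> {1..nlevels D}" and \<nu>: "\<nu> \<in> S_level D n"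
  shows "\<exists>w. \<forall>i g r. fourier (sample D i) \<nu> * wave \<nu> r
    = (\<Sum>c\<in>templates D. complex_of_real (coeff_vec D n i g r c) * w c)"
proof -
  have A: "0 < amp D" using D by (simp add: valid_setup_def)
  have upper: "\<exists>w. \<forall>i g r. fourier (sample D i) \<nu> * wave \<nu> r
      = (\<Sum>c\<in>templates D. complex_of_real (coeff_vec D n i g r c) * w c)"
    if \<nu>: "\<nu> \<in> S_level D n" "arg2 \<nu> < pi" for \<nu>
  proof -
    obtain km where km: "km \<in> cell_indices D" "0 < fst km" "\<nu> \<in> cell D km"
      using S_level_in_upper_cell[OF D n \<nu>] by blast
    have cp: "cell_part D n i km r = fourier (sample D i) \<nu> * wave \<nu> r" for i r
      by (simp add: cell_part_def S_level_Int_cell[OF D km(2) \<nu>(1) km(3)])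
    show ?thesis
      unfolding cp[symmetric] using km
      by (intro exI[of _ "from_parts (amp D) (Inner2 0 0 km RePart) (Inner2 0 0 km ImPart)"] allI
          sum_from_parts[OF A finite_templates _ _ _ coeff_vec.simps(3) coeff_vec.simps(3)])
        (auto simp: templates_eq)
  qed
  show ?thesis
  proof (cases "arg2 \<nu> < pi")
    case False
    then have "arg2 (- \<nu>) < pi" using minus_upper_iff[OF S_level_nonzero[OF D n \<nu>]] by simp
    from upper[OF S_level_minus[OF D n \<nu>] this] obtain w where
      w: "\<And>i g r. fourier (sample D i) (- \<nu>) * wave (- \<nu>) r
        = (\<Sum>c\<in>templates D. complex_of_real (coeff_vec D n i g r c) * w c)" by blast
    show ?thesis
    proof (intro exI[of _ "\<lambda>c. cnj (w c)"] allI)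
      show "fourier (sample D i) \<nu> * wave \<nu> r
          = (\<Sum>c\<in>templates D. complex_of_real (coeff_vec D n i g r c) * cnj (w c))" for i g r
        using arg_cong[OF w[of i r g], of cnj] by (simp add: fourier_minus wave_minus_left)
    qed
  qed (use upper[OF \<nu>] in blast)
qed

lemma energy_pos:
  assumes D: "valid_setup D" and n: "n \<in> {1..nlevels D}"
    and \<nu>: "\<nu> \<in> S_level D n" "fourier (sample D i) \<nu> \<noteq> 0"
  shows "0 < energy D n i g"
proof (rule ccontr)
  assume "\<not> 0 < energy D n i g"
  then have "coeff_vec D n i g 0 c = 0" if "c \<in> templates D" for c
    using abs_coeff_vec_le[OF D that, of n i g 0] by (simp add: not_less) (metis abs_le_zero_iff order_trans real_sqrt_le_0_iff)
  moreover obtain w where "fourier (sample D i) \<nu> * wave \<nu> 0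
      = (\<Sum>c\<in>templates D. complex_of_real (coeff_vec D n i g 0 c) * w c)"
    using linear_form_sample[OF D n \<nu>(1)] by blast
  ultimately show False using \<nu>(2) by simp
qed

text \<open>Positive energy provides a nonzero entry of the coefficient vector at every position,
  which is what the law of large numbers for the kernel asks for.\<close>

lemma limit_ntk_eq:
  assumes D: "valid_setup D" and n: "n \<in> {1..nlevels D}"
    and g: "integrable lborel g" "integrable lborel g'"
    and e: "0 < energy D n i g" "0 < energy D n i' g'"
  shows "limit_ntk D (g, feature D n i) (g', feature D n i') r r'
    = ntk_limit (templates D) (coeff_vec D n i g r) (coeff_vec D n i' g' r')"
  unfolding limit_ntk_def
proof (rule the_equality)
  have nz: "\<exists>c\<in>templates D. coeff_vec D n i g r c \<noteq> 0" if "0 < energy D n i g" for i g r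
  proof (rule ccontr)
    assume "\<not> ?thesis"
    then have "(\<Sum>c\<in>templates D. (coeff_vec D n i g r c)\<^sup>2) = 0" by simp
    then show False using that by (simp add: sum_squares_coeff_vec[OF D])
  qed
  obtain c0 c1 where c: "c0 \<in> templates D" "coeff_vec D n i g r c0 \<noteq> 0"
    "c1 \<in> templates D" "coeff_vec D n i' g' r' c1 \<noteq> 0"
    using nz[OF e(1)] nz[OF e(2)] by blast
  show lim: "tendsto_in_prob (init_law D)
      (\<lambda>L. empirical_ntk D L (g, feature D n i) (g', feature D n i') r r')
      (ntk_limit (templates D) (coeff_vec D n i g r) (coeff_vec D n i' g' r'))"
    using tendsto_in_prob_empirical_ntk[OF finite_templates, where a = "coeff_vec D n i g r"
        and a' = "coeff_vec D n i' g' r'", OF c]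
    by (simp add: empirical_ntk_def[abs_def] network_eq_net[OF D n] g)
  fix k assume "tendsto_in_prob (init_law D)
      (\<lambda>L. empirical_ntk D L (g, feature D n i) (g', feature D n i') r r') k"
  then show "k = ntk_limit (templates D) (coeff_vec D n i g r) (coeff_vec D n i' g' r')"
    by (rule tendsto_in_prob_unique[OF prob_space_init_law _ lim])
qed

section \<open>Recovery of the spectrum\<close>

text \<open>With the sample index as a coordinate of the measure space, the sum over pairs of
  samples becomes one double integral, to which the single-function results on Gram kernels
  apply.\<close>

lemma integral_count_space_pair:
  fixes f :: "'i \<times> 'a \<Rightarrow> 'b :: {banach, second_countable_topology}"
  assumes I: "finite I" and N: "sigma_finite_measure N"
    and f: "\<And>i. i \<in> I \<Longrightarrow> integrable N (\<lambda>r. f (i, r))"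
  shows "integrable (count_space I \<Otimes>\<^sub>M N) f"
    and "(LINT x|(count_space I \<Otimes>\<^sub>M N). f x) = (\<Sum>i\<in>I. LINT r|N. f (i, r))"
proof -
  interpret N: sigma_finite_measure N by fact
  interpret C: sigma_finite_measure "count_space I"
    by (rule sigma_finite_measure_count_space_finite[OF I])
  interpret pair_sigma_finite "count_space I" N ..
  show int: "integrable (count_space I \<Otimes>\<^sub>M N) f"
  proof (rule Fubini_integrable)
    show "f \<in> borel_measurable (count_space I \<Otimes>\<^sub>M N)"
      using f I by (intro measurable_pair_measure_countable1) (auto intro: countable_finite)
  qed (use f I in \<open>auto intro: integrable_count_space simp: AE_count_space\<close>)
  show "(LINT x|(count_space I \<Otimes>\<^sub>M N). f x) = (\<Sum>i\<in>I. LINT r|N. f (i, r))"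
    using integral_fst'[OF int] I by (simp add: lebesgue_integral_count_space_finite)
qed

lemma ntk_limit_measurable:
  assumes [measurable]: "\<And>c. c \<in> C \<Longrightarrow> (\<lambda>x. f x c) \<in> borel_measurable M"
    "\<And>c. c \<in> C \<Longrightarrow> (\<lambda>x. g x c) \<in> borel_measurable M"
  shows "(\<lambda>x. ntk_limit C (f x) (g x)) \<in> borel_measurable M"
proof -
  interpret G: prob_space "gauss C" by (rule prob_space_gauss)
  have "(\<lambda>(x, z). ntk_integrand C (f x) (g x) z) \<in> borel_measurable (M \<Otimes>\<^sub>M gauss C)"
    unfolding ntk_integrand_def by measurable
  then show ?thesis
    unfolding ntk_limit_def by (rule G.borel_measurable_lebesgue_integral)
qed

text \<open>The bound depends on \<open>B\<close> and \<open>C\<close> alone, hence is uniform in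
  samples and positions; it serves as the dominating constant for integrals of the kernel.\<close>

lemma abs_ntk_limit_le:
  assumes C: "finite C" and B: "0 \<le> B"
    and a: "\<And>c. c \<in> C \<Longrightarrow> \<bar>a c\<bar> \<le> B" and a': "\<And>c. c \<in> C \<Longrightarrow> \<bar>a' c\<bar> \<le> B"
  shows "\<bar>ntk_limit C a a'\<bar> \<le>
    (LINT z|gauss C. (real (card C) + 1) * (B * (1 + (\<Sum>c\<in>C. \<bar>z c\<bar>)))\<^sup>2)"
proof -
  interpret G: prob_space "gauss C" by (rule prob_space_gauss)
  let ?G = "\<lambda>z :: 'a \<Rightarrow> real. (real (card C) + 1) * (B * (1 + (\<Sum>c\<in>C. \<bar>z c\<bar>)))\<^sup>2"
  have bound: "\<bar>ntk_integrand C a a' z\<bar> \<le> ?G z" for z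
  proof -
    define S where "S = (\<Sum>c\<in>C. \<bar>z c\<bar>)"
    have S: "0 \<le> S" by (simp add: S_def sum_nonneg)
    have u: "\<bar>\<Sum>c\<in>C. a c * z c\<bar> \<le> B * S" "\<bar>\<Sum>c\<in>C. a' c * z c\<bar> \<le> B * S"
      unfolding S_def by (intro abs_sum_mult_le a a'; assumption)+
    have "\<bar>max 0 (\<Sum>c\<in>C. a c * z c) * max 0 (\<Sum>c\<in>C. a' c * z c)\<bar> \<le> (B * S) * (B * S)"
      unfolding abs_mult using u B S by (intro mult_mono) auto
    also have "\<dots> \<le> (B * (1 + S))\<^sup>2"
      unfolding power2_eq_square using B S by (intro mult_mono mult_left_mono) auto
    finally have 1: "\<bar>max 0 (\<Sum>c\<in>C. a c * z c) * max 0 (\<Sum>c\<in>C. a' c * z c)\<bar> \<le> (B * (1 + S))\<^sup>2" .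
    have "\<bar>\<Sum>c\<in>C. a c * a' c\<bar> \<le> B * (\<Sum>c\<in>C. \<bar>a' c\<bar>)" by (rule abs_sum_mult_le[OF a])
    also have "\<dots> \<le> B * (real (card C) * B)"
      using sum_bounded_above[of C "\<lambda>c. \<bar>a' c\<bar>" B] a' B by (intro mult_left_mono) auto
    also have "\<dots> = real (card C) * (B * B)" by simp
    also have "\<dots> \<le> real (card C) * (B * (1 + S))\<^sup>2"
      unfolding power2_eq_square using B S by (intro mult_left_mono mult_mono) (auto simp: algebra_simps)
    finally have 2: "\<bar>\<Sum>c\<in>C. a c * a' c\<bar> \<le> real (card C) * (B * (1 + S))\<^sup>2" .
    have "\<bar>ntk_integrand C a a' z\<bar> \<le> (B * (1 + S))\<^sup>2 + real (card C) * (B * (1 + S))\<^sup>2"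
      unfolding ntk_integrand_def
      by (rule order_trans[OF abs_triangle_ineq add_mono[OF 1]])
        (use 2 in \<open>auto intro: order_trans[OF abs_ge_zero]\<close>)
    then show ?thesis by (simp add: S_def algebra_simps)
  qed
  have G_int: "integrable (gauss C) ?G"
    by (intro integrable_mult_right integrable_gauss_sum_abs_squared C)
  have int: "integrable (gauss C) (ntk_integrand C a a')"
  proof (rule Bochner_Integration.integrable_bound[OF G_int])
    show "ntk_integrand C a a' \<in> borel_measurable (gauss C)"
      unfolding ntk_integrand_def[abs_def] by measurable
    show "AE z in gauss C. norm (ntk_integrand C a a' z) \<le> norm (?G z)"
      using bound by (auto intro!: AE_I2 order_trans[OF _ abs_ge_self])
  qed
  have "\<bar>ntk_limit C a a'\<bar> \<le> (LINT z|gauss C. \<bar>ntk_integrand C a a' z\<bar>)"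
    unfolding ntk_limit_def using integral_norm_bound[of "gauss C" "ntk_integrand C a a'"] by simp
  also have "\<dots> \<le> integral\<^sup>L (gauss C) ?G"
    using int G_int bound by (intro integral_mono) auto
  finally show ?thesis .
qed

lemma double_sum_ntk_eq_integral:
  fixes a :: "'i \<times> plane \<Rightarrow> 'c \<Rightarrow> real"
  assumes I: "finite I" and C: "finite C"
    and e: "\<And>i. i \<in> I \<Longrightarrow> integrable lborel (\<lambda>r. e (i, r) :: real)"
    and a[measurable]: "\<And>i c. i \<in> I \<Longrightarrow> c \<in> C \<Longrightarrow> (\<lambda>r. a (i, r) c) \<in> borel_measurable borel"
    and B: "0 \<le> B" "\<And>i r c. i \<in> I \<Longrightarrow> c \<in> C \<Longrightarrow> \<bar>a (i, r) c\<bar> \<le> B"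
  shows "(\<Sum>i\<in>I. \<Sum>i'\<in>I. LINT r|lborel. LINT r'|lborel.
      e (i, r) * ntk_limit C (a (i, r)) (a (i', r')) * e (i', r'))
    = (LINT x|(count_space I \<Otimes>\<^sub>M lborel). LINT x'|(count_space I \<Otimes>\<^sub>M lborel).
        e x * ntk_limit C (a x) (a x') * e x')"
proof -
  let ?K = "\<lambda>i r i' r'. e (i, r) * ntk_limit C (a (i, r)) (a (i', r')) * e (i', r')"
  have P: "pair_sigma_finite (lborel :: plane measure) (lborel :: plane measure)" ..
  have N: "sigma_finite_measure (lborel :: plane measure)" by (rule sigma_finite_lborel)
  define A where "A = (LINT z|gauss C. (real (card C) + 1) * (B * (1 + (\<Sum>c\<in>C. \<bar>z c\<bar>)))\<^sup>2)"
  have A: "\<bar>ntk_limit C (a (i, r)) (a (i', r'))\<bar> \<le> A" if "i \<in> I" "i' \<in> I" for i r i' r'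
    unfolding A_def using that B by (intro abs_ntk_limit_le[OF C]) auto
  have K_le: "norm (?K i r i' r') \<le> norm (A * e (i, r) * e (i', r'))" if "i \<in> I" "i' \<in> I" for i r i' r'
  proof -
    have "\<bar>ntk_limit C (a (i, r)) (a (i', r'))\<bar> * \<bar>e (i, r) * e (i', r')\<bar> \<le> \<bar>A\<bar> * \<bar>e (i, r) * e (i', r')\<bar>"
      using A[OF that, of r r'] by (intro mult_right_mono) auto
    then show ?thesis by (simp add: abs_mult mult_ac)
  qed
  have em: "(\<lambda>r. e (i, r)) \<in> borel_measurable borel" if "i \<in> I" for i using e[OF that] by auto
  have sec: "integrable lborel (\<lambda>r'. ?K i r i' r')" if i: "i \<in> I" "i' \<in> I" for i r i'
  proof (rule Bochner_Integration.integrable_bound)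
    show "integrable lborel (\<lambda>r'. A * e (i, r) * e (i', r'))" using e i by simp
    show "(\<lambda>r'. ?K i r i' r') \<in> borel_measurable lborel"
      using em[OF i(2)] ntk_limit_measurable[of C "\<lambda>_. a (i, r)" lborel "\<lambda>r'. a (i', r')"] a[OF i(2)]
      by auto
    show "AE r' in lborel. norm (?K i r i' r') \<le> norm (A * e (i, r) * e (i', r'))"
      using K_le[OF i] by (intro AE_I2)
  qed
  have joint: "integrable lborel (\<lambda>r. LINT r'|lborel. ?K i r i' r')" if i: "i \<in> I" "i' \<in> I" for i i'
  proof -
    have "integrable (lborel \<Otimes>\<^sub>M lborel) (\<lambda>(r, r'). ?K i r i' r')"
    proof (rule Bochner_Integration.integrable_bound)
      show "integrable (lborel \<Otimes>\<^sub>M lborel) (\<lambda>(r, r'). (A * e (i, r)) * e (i', r'))"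
        by (rule pair_sigma_finite.integrable_mult_prod[OF P]) (use e i in auto)
      have [measurable]: "(\<lambda>r. e (i, r)) \<in> borel_measurable borel" "(\<lambda>r. e (i', r)) \<in> borel_measurable borel"
        using em i by auto
      have [measurable]: "(\<lambda>w. ntk_limit C (a (i, fst w)) (a (i', snd w)))
          \<in> borel_measurable (borel \<Otimes>\<^sub>M borel)"
        by (intro ntk_limit_measurable measurable_compose[OF measurable_fst a[OF i(1)]]
            measurable_compose[OF measurable_snd a[OF i(2)]])
      show "(\<lambda>(r, r'). ?K i r i' r') \<in> borel_measurable (lborel \<Otimes>\<^sub>M lborel)"
        unfolding case_prod_beta' by measurable
      show "AE w in lborel \<Otimes>\<^sub>M lborel. norm (case w of (r, r') \<Rightarrow> ?K i r i' r')
          \<le> norm (case w of (r, r') \<Rightarrow> (A * e (i, r)) * e (i', r'))"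
        using K_le[OF i] by (intro AE_I2) (auto split: prod.split)
    qed
    from pair_sigma_finite.integrable_fst'[OF P this] show ?thesis by simp
  qed
  have inner: "(LINT x'|(count_space I \<Otimes>\<^sub>M lborel). e (i, r) * ntk_limit C (a (i, r)) (a x') * e x')
      = (\<Sum>i'\<in>I. LINT r'|lborel. ?K i r i' r')" if "i \<in> I" for i r
    using sec[OF that] by (intro integral_count_space_pair(2)[OF I N]) auto
  have "(LINT x|(count_space I \<Otimes>\<^sub>M lborel). LINT x'|(count_space I \<Otimes>\<^sub>M lborel).
        e x * ntk_limit C (a x) (a x') * e x')
      = (\<Sum>i\<in>I. LINT r|lborel. LINT x'|(count_space I \<Otimes>\<^sub>M lborel).
        e (i, r) * ntk_limit C (a (i, r)) (a x') * e x')"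
    by (rule integral_count_space_pair(2)[OF I N])
      (simp add: inner joint)
  also have "\<dots> = (\<Sum>i\<in>I. \<Sum>i'\<in>I. LINT r|lborel. LINT r'|lborel. ?K i r i' r')"
    by (intro sum.cong refl) (simp add: inner Bochner_Integration.integral_sum joint)
  finally show ?thesis by simp
qed

section \<open>Products of plane waves tested against the errors\<close>

text \<open>A slot is one factor of a product of plane waves: \<open>True\<close> marks a wave of
  the feature, \<open>False\<close> a wave of the previous output.\<close>

fun amplitude :: "setup_data \<Rightarrow> nat \<Rightarrow> (plane \<Rightarrow> real) \<Rightarrow> bool \<times> plane \<Rightarrow> complex" where
  "amplitude D i g (True, \<nu>) = fourier (sample D i) \<nu>"
| "amplitude D i g (False, \<nu>) = fourier g \<nu>"

text \<open>The feature offers only the frequencies of the current level, whereas the first kernel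
  passes those of all levels.\<close>

fun valid_slot :: "setup_data \<Rightarrow> nat \<Rightarrow> bool \<times> plane \<Rightarrow> bool" where
  "valid_slot D n (True, \<nu>) \<longleftrightarrow> \<nu> \<in> S_level D n"
| "valid_slot D n (False, \<nu>) \<longleftrightarrow> \<nu> \<in> S_all D"

lemma linear_form_slot:
  assumes D: "valid_setup D" and n: "n \<in> {1..nlevels D}" and s: "valid_slot D n s"
  shows "\<exists>w. \<forall>i g r. amplitude D i g s * wave (snd s) r
    = (\<Sum>c\<in>templates D. complex_of_real (coeff_vec D n i g r c) * w c)"
proof -
  obtain b \<nu> where "s = (b, \<nu>)" by (cases s)
  then show ?thesis
    using linear_form_output[OF D, of \<nu> n] linear_form_sample[OF D n, of \<nu>] s by (cases b) auto
qed

lemma prod_list_wave: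
  "prod_list (map (\<lambda>s. f s * wave (snd s) r) ss) = prod_list (map f ss) * wave (sum_list (map snd ss)) r"
  by (induction ss) (simp_all add: wave_add_left)

text \<open>The weight has one factor \<open>sqrt\<close> of the energy from rescaling the error and
  one inverse factor for every normalized linear form. The sign of the frequency comes from pairing
  with a wave, which is the transform at the opposite point.\<close>

lemma spectral_orthogonality:
  assumes D: "valid_setup D" and n: "n \<in> {1..nlevels D}" and I: "finite I"
    and e: "\<And>i. i \<in> I \<Longrightarrow> integrable lborel (e i)"
    and q: "\<And>i. i \<in> I \<Longrightarrow> 0 < energy D n i (g i)"
    and zero: "(\<Sum>i\<in>I. \<Sum>i'\<in>I. LINT r|lborel. LINT r'|lborel. e i r *
      ntk_limit (templates D) (coeff_vec D n i (g i) r) (coeff_vec D n i' (g i') r') * e i' r') = 0"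
    and ss: "\<And>s. s \<in> set ss \<Longrightarrow> valid_slot D n s" "even (length ss)" "2 \<le> length ss"
  shows "(\<Sum>i\<in>I. complex_of_real (sqrt (energy D n i (g i)) / sqrt (energy D n i (g i)) ^ length ss) *
      prod_list (map (amplitude D i (g i)) ss) * fourier (e i) (- sum_list (map snd ss))) = 0"
proof -
  let ?T = "templates D"
  let ?M = "count_space I \<Otimes>\<^sub>M (lborel :: plane measure)"
  have N: "sigma_finite_measure (lborel :: plane measure)" by (rule sigma_finite_lborel)
  define Q where "Q i = energy D n i (g i)" for i
  define a where "a x = coeff_vec D n (fst x) (g (fst x)) (snd x)" for x :: "nat \<times> plane"
  define E where "E x = e (fst x) (snd x)" for x :: "nat \<times> plane"
  have sM: "sigma_finite_measure ?M"
  proof -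
    interpret C: sigma_finite_measure "count_space I"
      by (rule sigma_finite_measure_count_space_finite[OF I])
    interpret pair_sigma_finite "count_space I" "lborel :: plane measure" ..
    show ?thesis by (rule sigma_finite_measure_axioms)
  qed
  have spM: "fst x \<in> I" if "x \<in> space ?M" for x using that by (auto simp: space_pair_measure)
  have Q: "0 < Q i" if "i \<in> I" for i using q[OF that] by (simp add: Q_def)
  define B where "B = (\<Sum>i\<in>I. sqrt (Q i))"
  have sqB: "sqrt (Q i) \<le> B" if "i \<in> I" for i
    unfolding B_def using I Q that by (intro member_le_sum) (auto intro: less_imp_le)
  have B0: "0 \<le> B" unfolding B_def by (intro sum_nonneg) (auto intro: less_imp_le Q)
  have aB: "\<bar>a x c\<bar> \<le> B" if "fst x \<in> I" "c \<in> ?T" for x c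
    using abs_coeff_vec_le[OF D that(2), of n "fst x" "g (fst x)" "snd x"] sqB[OF that(1)]
    by (simp add: a_def Q_def)
  have a_meas: "(\<lambda>x. a x c) \<in> borel_measurable ?M" if "c \<in> ?T" for c
    using I coeff_vec_measurable[of D n _ _ c]
    by (intro measurable_pair_measure_countable1) (auto simp: a_def intro: countable_finite)
  have E: "integrable ?M E"
    by (rule integral_count_space_pair(1)[OF I N]) (simp add: E_def e)
  have aB': "\<bar>coeff_vec D n i (g i) r c\<bar> \<le> B" if "i \<in> I" "c \<in> ?T" for i r c
    using aB[of "(i, r)" c] that by (simp add: a_def)
  have "(LINT x|?M. LINT x'|?M. E x * ntk_limit ?T (a x) (a x') * E x') = 0"
    using double_sum_ntk_eq_integral[where e = E and a = a and B = B, OF I finite_templates[of D]] zero e B0 aB'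
      coeff_vec_measurable by (simp add: E_def a_def)
  from ntk_form_eq_0_imp_ramp_transform_eq_0[OF sM finite_templates E a_meas _ this]
  have ramp: "(LINT x|?M. E x * max 0 (\<Sum>c\<in>?T. a x c * z c)) = 0" for z
    using aB spM by blast

  \<comment> \<open>Normalization; by positive homogeneity of the ramp the length removed from
    \<open>a\<close> reappears in \<open>E'\<close>.\<close>
  define b where "b x c = a x c / sqrt (Q (fst x))" for x c
  define E' where "E' x = E x * sqrt (Q (fst x))" for x
  have b_meas: "(\<lambda>x. b x c) \<in> borel_measurable ?M" if "c \<in> ?T" for c
    using I coeff_vec_measurable[of D n _ _ c]
    by (intro measurable_pair_measure_countable1) (auto simp: a_def b_def intro: countable_finite)
  have unit: "(\<Sum>c\<in>?T. (b x c)\<^sup>2) = 1" if "x \<in> space ?M" for x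
  proof -
    have "(\<Sum>c\<in>?T. (b x c)\<^sup>2) = (\<Sum>c\<in>?T. (a x c)\<^sup>2) / Q (fst x)"
      using Q[OF spM[OF that]] by (simp add: b_def power_divide sum_divide_distrib)
    then show ?thesis
      using Q[OF spM[OF that]] sum_squares_coeff_vec[OF D] by (simp add: a_def Q_def)
  qed
  have E': "integrable ?M E'"
    by (rule integral_count_space_pair(1)[OF I N]) (simp add: E_def E'_def e)
  have ramp': "(LINT x|?M. E' x * max 0 (\<Sum>c\<in>?T. b x c * z c)) = 0" for z
  proof -
    have "E' x * max 0 (\<Sum>c\<in>?T. b x c * z c) = E x * max 0 (\<Sum>c\<in>?T. a x c * z c)" if "x \<in> space ?M" for x
    proof -
      have s: "0 < sqrt (Q (fst x))" using Q[OF spM[OF that]] by simp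
      have "(\<Sum>c\<in>?T. a x c * z c) = sqrt (Q (fst x)) * (\<Sum>c\<in>?T. b x c * z c)"
        using s by (simp add: b_def sum_distrib_left)
      then show ?thesis using s by (simp add: E'_def max_def mult_le_0_iff zero_le_mult_iff)
    qed
    then show ?thesis using ramp[of z] by (simp cong: Bochner_Integration.integral_cong)
  qed
  have pow: "(LINT x|?M. E' x * (\<Sum>c\<in>?T. b x c * v c) ^ length ss) = 0" for v
    by (rule ramp_transform_eq_0_imp_even_power_eq_0[OF sM finite_templates E' b_meas unit ramp' ss(2,3)])
  have "\<forall>s. \<exists>w. valid_slot D n s \<longrightarrow> (\<forall>i g r. amplitude D i g s * wave (snd s) r
      = (\<Sum>c\<in>?T. complex_of_real (coeff_vec D n i g r c) * w c))"
    using linear_form_slot[OF D n] by blast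
  then obtain w where w: "\<And>s i g r. valid_slot D n s \<Longrightarrow> amplitude D i g s * wave (snd s) r
      = (\<Sum>c\<in>?T. complex_of_real (coeff_vec D n i g r c) * w s c)"
    by metis
  have b_bd: "bounded_measurable ?M (\<lambda>x. b x c)" if "c \<in> ?T" for c
    unfolding bounded_measurable_def
    using b_meas[OF that] abs_le_1_of_sum_squares[OF finite_templates unit that] by (auto intro: exI[of _ 1])
  have "(LINT x|?M. complex_of_real (E' x) *
      prod_list (map (\<lambda>w. \<Sum>c\<in>?T. complex_of_real (b x c) * w c) (map w ss))) = 0"
    using power_integral_polarization_complex[OF E' b_bd pow, of "[]" "map w ss"] by simp
  moreover have "complex_of_real (E' x) * prod_list (map (\<lambda>w. \<Sum>c\<in>?T. complex_of_real (b x c) * w c) (map w ss))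
      = complex_of_real (sqrt (Q (fst x)) / sqrt (Q (fst x)) ^ length ss) *
        prod_list (map (amplitude D (fst x) (g (fst x))) ss) *
        (complex_of_real (E x) * wave (sum_list (map snd ss)) (snd x))" for x
  proof -
    let ?s = "complex_of_real (sqrt (Q (fst x)))"
    have "(\<Sum>c\<in>?T. complex_of_real (b x c) * w s c)
        = (amplitude D (fst x) (g (fst x)) s * wave (snd s) (snd x)) / ?s" if "valid_slot D n s" for s
      unfolding w[OF that] by (simp add: b_def a_def sum_divide_distrib)
    then have maps: "map (\<lambda>s. \<Sum>c\<in>?T. complex_of_real (b x c) * w s c) ss
        = map (\<lambda>s. (amplitude D (fst x) (g (fst x)) s * wave (snd s) (snd x)) / ?s) ss"
      using ss(1) by (intro map_cong) auto
    have quot: "prod_list (map (\<lambda>s. f s / ?s) ss) = prod_list (map f ss) / ?s ^ length ss"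
      for f :: "bool \<times> plane \<Rightarrow> complex"
      by (induction ss) simp_all
    have "prod_list (map (\<lambda>w. \<Sum>c\<in>?T. complex_of_real (b x c) * w c) (map w ss))
        = prod_list (map (amplitude D (fst x) (g (fst x))) ss) *
          wave (sum_list (map snd ss)) (snd x) / ?s ^ length ss"
      unfolding map_map comp_def maps quot prod_list_wave ..
    then show ?thesis by (simp add: E'_def)
  qed
  ultimately have "(LINT x|?M. complex_of_real (sqrt (Q (fst x)) / sqrt (Q (fst x)) ^ length ss) *
        prod_list (map (amplitude D (fst x) (g (fst x))) ss) *
        (complex_of_real (E x) * wave (sum_list (map snd ss)) (snd x))) = 0"
    by simp
  moreover have "(LINT x|?M. complex_of_real (sqrt (Q (fst x)) / sqrt (Q (fst x)) ^ length ss) *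
        prod_list (map (amplitude D (fst x) (g (fst x))) ss) *
        (complex_of_real (E x) * wave (sum_list (map snd ss)) (snd x)))
      = (\<Sum>i\<in>I. complex_of_real (sqrt (Q i) / sqrt (Q i) ^ length ss) *
        prod_list (map (amplitude D i (g i)) ss) * fourier (e i) (- sum_list (map snd ss)))"
    by (subst integral_count_space_pair(2)[OF I N])
      (simp_all add: E_def fourier_eq integrable_mult_wave e)
  ultimately show ?thesis by (simp add: Q_def)
qed

section \<open>Regularity of the outputs and stationarity\<close>

lemma sample_regular:
  assumes D: "valid_setup D" and i: "i \<in> {1..nsamples D}"
  shows "sq_integrable (sample D i) \<and> supported_in (Omega D) (sample D i)"
proof -
  have sq: "sq_integrable (sample D i)" and "compactly_supported_in (Omega D) (sample D i)"
    using D i unfolding valid_setup_def by blast+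
  then obtain K where "K \<subseteq> Omega D" "supported_in K (sample D i)"
    unfolding compactly_supported_in_def by blast
  then have "supported_in (Omega D) (sample D i)"
    unfolding supported_in_def by (auto elim!: eventually_mono)
  with sq show ?thesis by blast
qed

text \<open>Induction along the levels: a feature is a trigonometric polynomial over
  \<open>S_all D\<close>, so a regular output of one level yields an admissible input of the
  next.\<close>

lemma level_output_regular:
  assumes D: "valid_setup D"
    and A1: "\<And>\<Theta> x. admissible_input D x \<Longrightarrow>
               sq_integrable (\<N> \<Theta> x) \<and> supported_in (Omega D) (\<N> \<Theta> x)"
    and "k \<le> nlevels D"
  shows "sq_integrable (level_output D \<N> \<Theta>s k i) \<and> supported_in (Omega D) (level_output D \<N> \<Theta>s k i)"
  using \<open>k \<le> nlevels D\<close>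
proof (induction k)
  case 0
  then show ?case by (simp add: sq_integrable_def supported_in_def)
next
  case (Suc k)
  then have n: "Suc k \<in> {1..nlevels D}" by simp
  let ?a = "\<lambda>\<nu>. if \<nu> \<in> S_level D (Suc k) then fourier (sample D i) \<nu> else 0"
  have "complex_of_real (feature D (Suc k) i r) = (\<Sum>\<nu>\<in>S_all D. ?a \<nu> * wave \<nu> r)" for r
    unfolding feature_eq[OF D n]
    using S_level_subset_S_all[OF n] by (intro sum.mono_neutral_cong_left) (auto simp: finite_S_all)
  then have "admissible_input D (level_output D \<N> \<Theta>s k i, feature D (Suc k) i)"
    unfolding admissible_input_def using Suc by (auto intro!: exI[of _ ?a])
  from A1[OF this] show ?case by simp
qed

lemma ntk_form_eq_0_of_stationary:
  assumes D: "valid_setup D" and regime: "ntk_regime D L \<N> \<Theta>s n \<theta>"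
    and stationary: "has_gradient (coords D L) (loss D \<N> \<Theta>s n) (\<Theta>s n) (\<lambda>c. 0)"
  shows "ntk_form D \<N> \<Theta>s n (\<Theta>s n) = 0"
proof -
  have "gradient (coords D L) (loss D \<N> \<Theta>s n) (\<Theta>s n) = (\<lambda>c. 0)"
    by (rule gradient_eqI[OF finite_coords[OF finite_templates] stationary]) simp
  then have "4 / (real (nsamples D))\<^sup>2 * ntk_form D \<N> \<Theta>s n (\<Theta>s n) = 0"
    using regime by (simp add: ntk_regime_def Let_def)
  then show ?thesis using D by (simp add: valid_setup_def)
qed

section \<open>Opposite pairs and separation of the samples\<close>

lemma prod_list_opposite_pairs:
  "prod_list (map (amplitude D i g) (concat (replicate t [(True, \<mu>), (True, - \<mu>)]))) =
    complex_of_real (cmod (fourier (sample D i) \<mu>) ^ (2 * t))"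
proof (induction t)
  case (Suc t)
  have "fourier (sample D i) \<mu> * cnj (fourier (sample D i) \<mu>) = complex_of_real ((cmod (fourier (sample D i) \<mu>))\<^sup>2)"
    by (rule complex_norm_square[symmetric])
  with Suc show ?case by (simp add: fourier_minus power2_eq_square mult_ac)
qed simp

lemma sum_list_opposite_pairs:
  "sum_list (map snd (concat (replicate t [(True, \<mu>), (True, - \<mu> :: 'a :: ab_group_add)]))) = 0"
  by (induction t) simp_all

lemma set_opposite_pairs: "set (concat (replicate t [(True, \<mu>), (True, - \<mu>)])) \<subseteq> {(True, \<mu>), (True, - \<mu>)}"
  by (induction t) auto

lemma length_opposite_pairs: "length (concat (replicate t [(True, \<mu>), (True, - \<mu>)])) = 2 * t"
  by (induction t) simp_all

text \<open>Appending \<open>\<tau>\<close> opposite pairs of frequency \<open>\<mu>\<close> leaves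
  the sum of the frequencies unchanged and multiplies the amplitude of sample \<open>i\<close> by
  \<open>cmod (fourier (sample D i) \<mu>) ^ (2 * \<tau>)\<close>. Varying \<open>\<mu>\<close> over
  the level lets linear independence isolate each sample.\<close>

lemma fourier_eq_on_sums:
  assumes D: "valid_setup D" and n: "n \<in> {1..nlevels D}" and I: "finite I"
    and e: "\<And>i. i \<in> I \<Longrightarrow> integrable lborel (e i)"
    and q: "\<And>i. i \<in> I \<Longrightarrow> 0 < energy D n i (g i)"
    and zero: "(\<Sum>i\<in>I. \<Sum>i'\<in>I. LINT r|lborel. LINT r'|lborel. e i r *
      ntk_limit (templates D) (coeff_vec D n i (g i) r) (coeff_vec D n i' (g i') r') * e i' r') = 0"
    and \<tau>: "1 \<le> \<tau>"
    and indep: "\<And>c :: nat \<Rightarrow> complex.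
      (\<And>\<nu>. \<nu> \<in> S_level D n \<Longrightarrow> (\<Sum>i\<in>I. c i * complex_of_real (cmod (fourier (sample D i) \<nu>) ^ (2 * \<tau>))) = 0) \<Longrightarrow>
      (\<forall>i\<in>I. c i = 0)"
    and us: "\<And>s. s \<in> set us \<Longrightarrow> valid_slot D n s" "even (length us)"
    and i: "i \<in> I" and nz: "\<And>s. s \<in> set us \<Longrightarrow> amplitude D i (g i) s \<noteq> 0"
  shows "fourier (e i) (sum_list (map snd us)) = 0"
proof -
  \<comment> \<open>The exponent counts the appended pairs as well; so \<open>c i\<close> does not
    depend on \<open>\<mu>\<close> and can act as the coefficient in the independence
    condition.\<close>
  define c where "c i = complex_of_real (sqrt (energy D n i (g i)) / sqrt (energy D n i (g i)) ^ (length us + 2 * \<tau>)) *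
      prod_list (map (amplitude D i (g i)) us) * fourier (e i) (- sum_list (map snd us))" for i
  have "(\<Sum>i\<in>I. c i * complex_of_real (cmod (fourier (sample D i) \<mu>) ^ (2 * \<tau>))) = 0"
    if \<mu>: "\<mu> \<in> S_level D n" for \<mu>
  proof -
    define ps where "ps = concat (replicate \<tau> [(True, \<mu>), (True, - \<mu>)])"
    have valid: "valid_slot D n s" if "s \<in> set (us @ ps)" for s
    proof -
      have "s \<in> set us \<or> s = (True, \<mu>) \<or> s = (True, - \<mu>)"
        using that set_opposite_pairs[of \<tau> \<mu>] by (auto simp: ps_def)
      then show ?thesis
        using us(1)[of s] \<mu> S_level_minus[OF D n \<mu>] valid_slot.simps(1) by blast
    qed
    have len: "length (us @ ps) = length us + 2 * \<tau>" by (simp add: ps_def length_opposite_pairs)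
    have "even (length (us @ ps))" "2 \<le> length (us @ ps)" using us(2) \<tau> unfolding len by auto
    from spectral_orthogonality[OF D n I e q zero valid this]
    have "(\<Sum>i\<in>I. complex_of_real (sqrt (energy D n i (g i)) / sqrt (energy D n i (g i)) ^ length (us @ ps)) *
      prod_list (map (amplitude D i (g i)) (us @ ps)) * fourier (e i) (- sum_list (map snd (us @ ps)))) = 0" .
    moreover have "sum_list (map snd (us @ ps)) = sum_list (map snd us)"
      unfolding map_append sum_list_append by (simp add: ps_def sum_list_opposite_pairs)
    moreover have "prod_list (map (amplitude D i (g i)) (us @ ps)) = prod_list (map (amplitude D i (g i)) us) *
        complex_of_real (cmod (fourier (sample D i) \<mu>) ^ (2 * \<tau>))" for i
      unfolding map_append prod_list.append by (simp only: ps_def prod_list_opposite_pairs)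
    ultimately show ?thesis unfolding len c_def by (simp only: mult_ac)
  qed
  then have "c i = 0" using indep[of c] i by blast
  moreover have "sqrt (energy D n i (g i)) \<noteq> 0" using q[OF i] by simp
  moreover have "prod_list (map (amplitude D i (g i)) us) \<noteq> 0"
    using nz by (auto simp: prod_list_zero_iff)
  \<comment> \<open>The other two factors of \<open>c i\<close> are nonzero. The zero is found at
    the opposite frequency, and the error is real, so conjugation carries it over.\<close>
  ultimately have "fourier (e i) (- sum_list (map snd us)) = 0"
    by (simp add: c_def)
  then show ?thesis by (simp add: fourier_minus)
qed

theorem theorem5p1:
  fixes D :: setup_data and L n :: nat
    and \<N> :: "params \<Rightarrow> input \<Rightarrow> plane \<Rightarrow> real"
    and \<Theta>s :: "nat \<Rightarrow> params" and \<theta> :: "real \<Rightarrow> params" and \<tau> :: "nat \<Rightarrow> nat"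
  assumes data: "valid_setup D"
    and width: "1 \<le> L"
    and level: "n \<in> {1..nlevels D}"
    and net: "realizes_network D L \<N>"
    and A1: "\<And>\<Theta> x. admissible_input D x \<Longrightarrow>
               sq_integrable (\<N> \<Theta> x) \<and> supported_in (Omega D) (\<N> \<Theta> x)"
    and A2: "\<And>i m. i \<in> {1..nsamples D} \<Longrightarrow> m \<in> {1..nlevels D} \<Longrightarrow>
               \<exists>\<nu>\<in>S_level D m. (cmod (fourier (sample D i) \<nu>))\<^sup>2 \<noteq> 0"
    and A3: "\<And>m. m \<in> {1..nlevels D} \<Longrightarrow> 1 \<le> \<tau> m \<and>
               (\<forall>c :: nat \<Rightarrow> complex.
                  (\<forall>\<nu>\<in>S_level D m. (\<Sum>i = 1..nsamples D.
                      c i * complex_of_real (cmod (fourier (sample D i) \<nu>) ^ (2 * \<tau> m))) = 0) \<longrightarrow>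
                  (\<forall>i\<in>{1..nsamples D}. c i = 0))"
    and flow: "gradient_flow (coords D L) (loss D \<N> \<Theta>s n) \<theta>"
    and regime: "ntk_regime D L \<N> \<Theta>s n \<theta>"
    and limit: "\<And>c. c \<in> coords D L \<Longrightarrow> ((\<lambda>t. \<theta> t c) \<longlongrightarrow> \<Theta>s n c) at_top"
    and stationary: "has_gradient (coords D L) (loss D \<N> \<Theta>s n) (\<Theta>s n) (\<lambda>c. 0)"
  shows "\<forall>i\<in>{1..nsamples D}. \<forall>\<xi>\<in>B_set D \<N> \<Theta>s (\<tau> n) n i.
           fourier (level_output D \<N> \<Theta>s n i) \<xi> = fourier (sample D i) \<xi>"
proof (intro ballI)
  let ?I = "{1..nsamples D}"
  define g where "g i = level_output D \<N> \<Theta>s (n - 1) i" for i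
  define out where "out i = level_output D \<N> \<Theta>s n i" for i
  define e where "e i r = out i r - sample D i r" for i r
  have reg_out: "integrable lborel (out i)" "supported_in (Omega D) (out i)" for i
  proof -
    have "n \<le> nlevels D" using level by simp
    from level_output_regular[where \<N> = \<N> and \<Theta>s = \<Theta>s and i = i, OF data A1 this]
    show "integrable lborel (out i)" "supported_in (Omega D) (out i)"
      by (auto simp: out_def intro: sq_integrable_supported_imp_integrable)
  qed
  have reg_g: "integrable lborel (g i)" for i
  proof -
    have "n - 1 \<le> nlevels D" using level by (auto intro: le_trans[OF diff_le_self])
    from level_output_regular[where \<N> = \<N> and \<Theta>s = \<Theta>s and i = i, OF data A1 this]
    show ?thesis
      unfolding g_def by (blast intro: sq_integrable_supported_imp_integrable)
  qed
  have reg_s: "integrable lborel (sample D i)" "supported_in (Omega D) (sample D i)" if "i \<in> ?I" for i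
    using sample_regular[OF data that] by (auto intro: sq_integrable_supported_imp_integrable)
  have e_int: "integrable lborel (e i)" if "i \<in> ?I" for i
    unfolding e_def[abs_def] by (intro Bochner_Integration.integrable_diff reg_out reg_s that)
  have q: "0 < energy D n i (g i)" if i: "i \<in> ?I" for i
    using A2[OF i level] energy_pos[OF data level] by auto
  \<comment> \<open>The kernel form integrates over the disc only. By the support conditions on
    outputs and samples the cut-off changes the error on a null set, hence not its
    transform.\<close>
  define e' where "e' i r = indicator (Omega D) r * e i r" for i r
  have O: "Omega D \<in> sets lborel"
  proof -
    have "Omega D = ball 0 (radius D)" by (auto simp: Omega_def)
    then show ?thesis by simp
  qed
  have e'_int: "integrable lborel (e' i)" if "i \<in> ?I" for i
    unfolding e'_def[abs_def]
    using integrable_mult_indicator[OF O e_int[OF that]] by simp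
  have fourier_e': "fourier (e' i) \<xi> = fourier (out i) \<xi> - fourier (sample D i) \<xi>" if i: "i \<in> ?I" for i \<xi>
  proof -
    have "fourier (e' i) \<xi> = fourier (e i) \<xi>"
      unfolding fourier_eq
    proof (rule integral_cong_AE)
      show "AE r in lborel. complex_of_real (e' i r) * wave (- \<xi>) r = complex_of_real (e i r) * wave (- \<xi>) r"
        using reg_out(2)[of i] reg_s(2)[OF i] unfolding supported_in_def
        by eventually_elim (auto simp: e'_def e_def indicator_def)
    qed (use e'_int[OF i] e_int[OF i] in auto)
    then show ?thesis
      unfolding e_def[abs_def] by (simp add: fourier_diff reg_out reg_s[OF i])
  qed
  have err: "err D \<N> \<Theta>s n (\<Theta>s n) i r = e i r" for i r
    using level by (cases n) (auto simp: err_def e_def out_def level_input_def)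
  have "(\<Sum>i\<in>?I. \<Sum>i'\<in>?I. LINT r|lborel. LINT r'|lborel. e' i r *
      ntk_limit (templates D) (coeff_vec D n i (g i) r) (coeff_vec D n i' (g i') r') * e' i' r')
      = ntk_form D \<N> \<Theta>s n (\<Theta>s n)"
    unfolding ntk_form_def
  proof (intro sum.cong refl)
    fix i i' assume i: "i \<in> ?I" "i' \<in> ?I"
    have K: "limit_ntk D (level_input D \<N> \<Theta>s n i) (level_input D \<N> \<Theta>s n i') r r'
        = ntk_limit (templates D) (coeff_vec D n i (g i) r) (coeff_vec D n i' (g i') r')" for r r'
      unfolding level_input_def g_def[symmetric]
      by (rule limit_ntk_eq[OF data level reg_g reg_g q q]) (rule i)+
    show "(LINT r|lborel. LINT r'|lborel. e' i r *
        ntk_limit (templates D) (coeff_vec D n i (g i) r) (coeff_vec D n i' (g i') r') * e' i' r')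
      = (LINT r:Omega D|lborel. LINT r':Omega D|lborel. err D \<N> \<Theta>s n (\<Theta>s n) i r *
          limit_ntk D (level_input D \<N> \<Theta>s n i) (level_input D \<N> \<Theta>s n i') r r' *
          err D \<N> \<Theta>s n (\<Theta>s n) i' r')"
      unfolding K err e'_def set_lebesgue_integral_def
      by (intro Bochner_Integration.integral_cong refl)
        (simp add: mult_ac flip: integral_mult_right_zero)
  qed
  also have "\<dots> = 0"
    by (rule ntk_form_eq_0_of_stationary[OF data regime stationary])
  finally have zero: "(\<Sum>i\<in>?I. \<Sum>i'\<in>?I. LINT r|lborel. LINT r'|lborel. e' i r *
      ntk_limit (templates D) (coeff_vec D n i (g i) r) (coeff_vec D n i' (g i') r') * e' i' r') = 0" .

  fix i \<xi> assume i: "i \<in> ?I" and "\<xi> \<in> B_set D \<N> \<Theta>s (\<tau> n) n i"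
  then obtain \<alpha>1 \<alpha>2 \<alpha>3 \<nu> w where \<alpha>: "0 \<le> gam (\<tau> n) (\<alpha>1, \<alpha>2, \<alpha>3)"
    and \<nu>: "\<And>p. p \<in> {1..nat (gam (\<tau> n) (\<alpha>1, \<alpha>2, \<alpha>3))} \<Longrightarrow> \<nu> p \<in> S_sample D n i"
    and w: "\<And>p. p \<in> {1..gam_tilde (\<alpha>1, \<alpha>2, \<alpha>3)} \<Longrightarrow> w p \<in> S_output D \<N> \<Theta>s (n - 1) i"
    and \<xi>: "\<xi> = (\<Sum>p = 1..nat (gam (\<tau> n) (\<alpha>1, \<alpha>2, \<alpha>3)). \<nu> p) + (\<Sum>p = 1..gam_tilde (\<alpha>1, \<alpha>2, \<alpha>3). w p)"
    unfolding B_set_def by fastforce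
  define G where "G = nat (gam (\<tau> n) (\<alpha>1, \<alpha>2, \<alpha>3))"
  define G' where "G' = gam_tilde (\<alpha>1, \<alpha>2, \<alpha>3)"
  \<comment> \<open>The summands of \<open>\<xi>\<close> as a list of slots: those from the sample
    first, those from the previous output second.\<close>
  define us where "us = map (\<lambda>p. (True, \<nu> p)) [1..<Suc G] @ map (\<lambda>p. (False, w p)) [1..<Suc G']"
  \<comment> \<open>\<alpha>2 occurs once in each of the two counts and everything else occurs
    doubled, so the length is even; \<open>\<alpha>\<close> makes the passage through
    \<open>nat\<close> exact.\<close>
  have "int (G + G') = 2 * (int \<alpha>1 + int \<alpha>2 + int \<alpha>3 - int (\<tau> n))"
    using \<alpha> by (simp add: G_def G'_def gam_def gam_tilde_def)
  then have "even (int (G + G'))" by simp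
  then have even: "even (length us)" by (simp add: us_def del: upt_Suc)
  have slot: "valid_slot D n s \<and> amplitude D i (g i) s \<noteq> 0" if "s \<in> set us" for s
  proof -
    have "(\<exists>p\<in>{1..G}. s = (True, \<nu> p)) \<or> (\<exists>p\<in>{1..G'}. s = (False, w p))"
      using that by (auto simp: us_def less_Suc_eq_le)
    then show ?thesis
      using \<nu> w by (auto simp: G_def G'_def S_sample_def S_output_def g_def)
  qed
  have "sum_list (map snd us) = \<xi>"
    by (simp add: us_def \<xi> G_def G'_def comp_def sum_list_distinct_conv_sum_set
        atLeastLessThanSuc_atLeastAtMost del: upt_Suc)
  moreover have "fourier (e' i) (sum_list (map snd us)) = 0"
  proof (rule fourier_eq_on_sums[OF data level _ e'_int q zero _ _ _ even i])
    show "\<forall>i\<in>?I. c i = 0" if "\<And>\<nu>. \<nu> \<in> S_level D n \<Longrightarrow>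
        (\<Sum>i\<in>?I. c i * complex_of_real (cmod (fourier (sample D i) \<nu>) ^ (2 * \<tau> n))) = 0" for c
      using A3[OF level] that by blast
  qed (use A3[OF level] slot in auto)
  ultimately show "fourier (level_output D \<N> \<Theta>s n i) \<xi> = fourier (sample D i) \<xi>"
    using fourier_e'[OF i, of \<xi>] by (simp add: out_def)
qed

end
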